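(* Let $\mu$ be a probability measure on $\mathbb{R}$, not a point mass, with $\int_{\mathbb{R}} |x|\,\mu(\mathrm{d}x)<\infty$ and $\int_{\mathbb{R}} x\,\mu(\mathrm{d}x)=x_0$. Let $u_\mu(x)=\int_{\mathbb{R}}|x-y|\,\mu(\mathrm{d}y)$, and let $\ell_-^\mu\in[-\infty,\infty)$ and $\ell_+^\mu\in(-\infty,\infty]$ denote the lower and upper bounds of the support of $\mu$. Define a measure $m$ by $$m(\mathrm{d}x)=\frac{\mu(\mathrm{d}x)}{u_\mu(x)-|x-x_0|}\quad\text{for }x\in(\ell_-^\mu,\ell_+^\mu),$$ $$m([y,x_0))=m([x_0,x])=\infty\quad\text{for real } y\le \ell_-^\mu \text{ and real } x\ge \ell_+^\mu \text{ respectively.}$$ Let $(X_t)_{t\ge 0}$ be the generalised diffusion (on natural scale) associated with $m$, constructed from a Brownian motion $B$ with $B_0=x_0$ under $\mathbb{P}^{x_0}$, and let $T$ be an $\mathcal{F}_0$-measurable random variable which under $\mathbb{P}^{x_0}$ is exponentially distributed with parameter $1$ and independent of $(X_t)$. Then, under $\mathbb{P}^{x_0}$, $X_T\sim\mu$ and $(X_{t\wedge T})_{t\ge 0}$ is a uniformly integrable martingale (with respect to the time-changed filtration $(\mathcal{F}_{A_t})_{t\ge 0}$).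
   Context: Generalised diffusions. Let $x_0\in\mathbb{R}$ and let $m$ be a measure on $\mathbb{R}$, possibly taking infinite values. Put $\ell_+=\ell_+(m)=\sup\{x\ge x_0: m([x_0,x])<\infty\}$ and $\ell_-=\ell_-(m)=\inf\{y\le x_0: m([y,x_0))<\infty\}$, and assume $\ell_-<x_0<\ell_+$ (these may be infinite). Thus $m$ is finite on compact subsets of $(\ell_-,\ell_+)$, and if $\ell_+$ (resp. $\ell_-$) is finite then $m([x_0,x])=\infty$ for $x>\ell_+$ (resp. $m([y,x_0))=\infty$ for $y<\ell_-$). For the measure $m$ of the claim, $\ell_\pm(m)=\ell_\pm^\mu$. Let $(\Omega,\mathcal{F},(\mathcal{F}_t)_{t\ge0})$ be a filtered space (usual conditions) carrying a one-dimensional $(\mathcal{F}_t)$-Brownian motion $(B_t)$ with $B_0=x_0$, $\mathbb{P}^{x_0}$-a.s.; $\mathcal{F}_0$ is rich enough to support random variables independent of $B$. Let $(L^x_t)$ be the jointly continuous version of the local time of $B$, normalised so that $|B_t-x|-L^x_t$ is a martingale. Put $$\Phi_t=\int_{\mathbb{R}}L^x_t\,m(\mathrm{d}x)\in[0,\infty],\qquad A_t=\inf\{s\ge0:\Phi_s>t\}$$ (so $A$ is the right-continuous inverse of $\Phi$). The generalised diffusion associated with $m$ is $X_t:=B_{A_t}$ for $t\le\zeta:=\inf\{t\ge0:X_t\notin(\ell_-,\ell_+)\}$, and it is absorbed at time $\zeta$, i.e. $X_t=X_\zeta$ for $t\ge\zeta$. (Since $\Phi_s=\infty$ for every $s$ strictly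 larger than the first time $B$ hits $\{\ell_-,\ell_+\}$, $X_t=B_{A_t}$ in fact holds for all $t\ge0$.) *)

theory Defs
  imports "HOL-Probability.Probability"
begin

section \<open>Filtered probability spaces\<close>

text \<open>The filtration is indexed by \<open>[0,\<infinity>]\<close> (type \<^typ>\<open>ennreal\<close>), so that the library's
  \<open>filtration.pre_sigma\<close> gives the \<open>\<sigma>\<close>-algebra of a stopping time with values in \<open>[0,\<infinity>]\<close>.
  \<open>F \<infinity>\<close> may be any sub-\<open>\<sigma>\<close>-algebra of \<open>M\<close> containing all \<open>F t\<close>. Processes are indexed by
  \<^typ>\<open>real\<close>, and only their values at times \<open>t \<ge> 0\<close> matter.\<close>

locale filtered_prob_space = prob_space M + filtration "space M" F
  for M :: "'a measure" and F :: "ennreal \<Rightarrow> 'a measure" +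
  assumes subalg: "\<And>t. subalgebra M (F t)"

locale usual_conditions = filtered_prob_space M F + complete_measure M
  for M :: "'a measure" and F :: "ennreal \<Rightarrow> 'a measure" +
  assumes null_sets_F0: "null_sets M \<subseteq> sets (F 0)"
    and right_continuous: "\<And>t. t < \<infinity> \<Longrightarrow> sets (F t) = (\<Inter>s\<in>{t<..}. sets (F s))"

definition martingale :: "'a measure \<Rightarrow> (real \<Rightarrow> 'a measure) \<Rightarrow> (real \<Rightarrow> 'a \<Rightarrow> real) \<Rightarrow> bool" where
  "martingale M G X \<longleftrightarrow>
     (\<forall>t\<ge>0. subalgebra M (G t)) \<and>
     (\<forall>s t. 0 \<le> s \<and> s \<le> t \<longrightarrow> sets (G s) \<subseteq> sets (G t)) \<and>
     (\<forall>t\<ge>0. X t \<in> borel_measurable (G t)) \<and>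
     (\<forall>t\<ge>0. integrable M (X t)) \<and>
     (\<forall>s t. 0 \<le> s \<and> s \<le> t \<longrightarrow> (AE \<omega> in M. real_cond_exp M (G s) (X t) \<omega> = X s \<omega>))"

definition uniformly_integrable :: "'a measure \<Rightarrow> (real \<Rightarrow> 'a \<Rightarrow> real) \<Rightarrow> bool" where
  "uniformly_integrable M X \<longleftrightarrow>
     (\<forall>t\<ge>0. integrable M (X t)) \<and>
     (\<forall>\<epsilon>>0. \<exists>K>0. \<forall>t\<ge>0. (\<integral>\<omega>. \<bar>X t \<omega>\<bar> * indicator {\<omega>. K < \<bar>X t \<omega>\<bar>} \<omega> \<partial>M) \<le> \<epsilon>)"

section \<open>Brownian motion and its local time\<close>

definition brownian_motion ::
    "'a measure \<Rightarrow> (ennreal \<Rightarrow> 'a measure) \<Rightarrow> (real \<Rightarrow> 'a \<Rightarrow> real) \<Rightarrow> bool" where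
  "brownian_motion M F B \<longleftrightarrow>
     (\<forall>t\<ge>0. B t \<in> borel_measurable (F (ennreal t))) \<and>
     (AE \<omega> in M. continuous_on {0..} (\<lambda>t. B t \<omega>)) \<and>
     (\<forall>s t. 0 \<le> s \<and> s < t \<longrightarrow>
        distributed M lborel (\<lambda>\<omega>. B t \<omega> - B s \<omega>) (normal_density 0 (sqrt (t - s))) \<and>
        prob_space.indep_set M (sets (F (ennreal s)))
          (sets (vimage_algebra (space M) (\<lambda>\<omega>. B t \<omega> - B s \<omega>) borel)))"

text \<open>\<open>L x t\<close> is the local time of \<open>B\<close> at level \<open>x\<close> up to time \<open>t\<close>: the jointly continuous
  density of the occupation measure of \<open>B\<close>. The last clause fixes the normalisation, which is
  the one for which the reference measure of the density is Lebesgue measure with factor 1.\<close>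

definition brownian_local_time ::
    "'a measure \<Rightarrow> (ennreal \<Rightarrow> 'a measure) \<Rightarrow> (real \<Rightarrow> 'a \<Rightarrow> real) \<Rightarrow> (real \<Rightarrow> real \<Rightarrow> 'a \<Rightarrow> real) \<Rightarrow> bool"
  where
  "brownian_local_time M F B L \<longleftrightarrow>
     (AE \<omega> in M. continuous_on (UNIV \<times> {0..}) (\<lambda>(x, t). L x t \<omega>)) \<and>
     (AE \<omega> in M. \<forall>x. \<forall>t\<ge>0. 0 \<le> L x t \<omega>) \<and>
     (AE \<omega> in M. \<forall>t\<ge>0. \<forall>D\<in>sets borel.
        emeasure lborel {s \<in> {0..t}. B s \<omega> \<in> D} = (\<integral>\<^sup>+x\<in>D. ennreal (L x t \<omega>) \<partial>lborel)) \<and>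
     (\<forall>x. martingale M (\<lambda>t. F (ennreal t)) (\<lambda>t \<omega>. \<bar>B t \<omega> - x\<bar> - L x t \<omega>))"

section \<open>Generalised diffusions\<close>

definition ell_plus :: "real measure \<Rightarrow> real \<Rightarrow> ereal" where
  "ell_plus m x0 = Sup {ereal x | x. x0 \<le> x \<and> emeasure m {x0..x} < \<infinity>}"

definition ell_minus :: "real measure \<Rightarrow> real \<Rightarrow> ereal" where
  "ell_minus m x0 = Inf {ereal y | y. y \<le> x0 \<and> emeasure m {y..<x0} < \<infinity>}"

definition additive_functional ::
    "real measure \<Rightarrow> (real \<Rightarrow> real \<Rightarrow> 'a \<Rightarrow> real) \<Rightarrow> real \<Rightarrow> 'a \<Rightarrow> ennreal" where
  "additive_functional m L t \<omega> = (\<integral>\<^sup>+x. ennreal (L x t \<omega>) \<partial>m)"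

definition time_change ::
    "real measure \<Rightarrow> (real \<Rightarrow> real \<Rightarrow> 'a \<Rightarrow> real) \<Rightarrow> real \<Rightarrow> 'a \<Rightarrow> ennreal" where
  "time_change m L t \<omega> = Inf {ennreal s | s. 0 \<le> s \<and> ennreal t < additive_functional m L s \<omega>}"

text \<open>The value \<open>time_change m L t \<omega> = \<infinity>\<close> (a null event for the measures considered here) is
  sent to time 0 by \<^const>\<open>enn2real\<close>.\<close>

definition time_changed_process ::
    "real measure \<Rightarrow> (real \<Rightarrow> 'a \<Rightarrow> real) \<Rightarrow> (real \<Rightarrow> real \<Rightarrow> 'a \<Rightarrow> real) \<Rightarrow> real \<Rightarrow> 'a \<Rightarrow> real" where
  "time_changed_process m B L t \<omega> = B (enn2real (time_change m L t \<omega>)) \<omega>"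

definition exit_time ::
    "real measure \<Rightarrow> real \<Rightarrow> (real \<Rightarrow> 'a \<Rightarrow> real) \<Rightarrow> (real \<Rightarrow> real \<Rightarrow> 'a \<Rightarrow> real) \<Rightarrow> 'a \<Rightarrow> ennreal" where
  "exit_time m x0 B L \<omega> = Inf {ennreal t | t. 0 \<le> t \<and>
     ereal (time_changed_process m B L t \<omega>) \<notin> {ell_minus m x0<..<ell_plus m x0}}"

definition generalised_diffusion ::
    "real measure \<Rightarrow> real \<Rightarrow> (real \<Rightarrow> 'a \<Rightarrow> real) \<Rightarrow> (real \<Rightarrow> real \<Rightarrow> 'a \<Rightarrow> real) \<Rightarrow> real \<Rightarrow> 'a \<Rightarrow> real" where
  "generalised_diffusion m x0 B L t \<omega> =
     time_changed_process m B L (enn2real (min (ennreal t) (exit_time m x0 B L \<omega>))) \<omega>"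

definition time_changed_filtration ::
    "'a measure \<Rightarrow> (ennreal \<Rightarrow> 'a measure) \<Rightarrow> real measure \<Rightarrow> (real \<Rightarrow> real \<Rightarrow> 'a \<Rightarrow> real) \<Rightarrow> real \<Rightarrow> 'a measure"
  where
  "time_changed_filtration M F m L t = filtration.pre_sigma (space M) F (time_change m L t)"

section \<open>The speed measure associated with a target law\<close>

definition potential :: "real measure \<Rightarrow> real \<Rightarrow> real" where
  "potential \<mu> x = (\<integral>y. \<bar>x - y\<bar> \<partial>\<mu>)"

definition measure_support :: "real measure \<Rightarrow> real set" where
  "measure_support \<mu> = {x. \<forall>U. open U \<and> x \<in> U \<longrightarrow> 0 < emeasure \<mu> U}"

definition supp_lower :: "real measure \<Rightarrow> ereal" where
  "supp_lower \<mu> = Inf (ereal ` measure_support \<mu>)"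

definition supp_upper :: "real measure \<Rightarrow> ereal" where
  "supp_upper \<mu> = Sup (ereal ` measure_support \<mu>)"

text \<open>The defining properties determine \<open>m\<close> on the open interval between the bounds of the
  support, but not how the infinite mass is distributed outside of it; hence a predicate.\<close>

definition speed_measure_for :: "real measure \<Rightarrow> real \<Rightarrow> real measure \<Rightarrow> bool" where
  "speed_measure_for \<mu> x0 m \<longleftrightarrow>
     sets m = sets borel \<and>
     (\<forall>D\<in>sets borel. D \<subseteq> {x. supp_lower \<mu> < ereal x \<and> ereal x < supp_upper \<mu>} \<longrightarrow>
        emeasure m D = emeasure (density \<mu> (\<lambda>x. ennreal (1 / (potential \<mu> x - \<bar>x - x0\<bar>)))) D) \<and>
     (\<forall>y. ereal y \<le> supp_lower \<mu> \<longrightarrow> emeasure m {y..<x0} = \<infinity>) \<and>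
     (\<forall>x. supp_upper \<mu> \<le> ereal x \<longrightarrow> emeasure m {x0..x} = \<infinity>)"

end

theory Submission
  imports Defs
begin

text \<open>Let \<open>\<tau>\<close> be the time at which the additive functional \<open>\<Phi>\<close> of the speed measure \<open>m\<close> first exceeds
  \<open>T\<close>, so that \<open>X\<^sub>T = B\<^sub>\<tau>\<close>, and put \<open>w x = u\<^sub>\<mu> x - \<bar>x - x0\<bar>\<close>, so that \<open>\<mu>\<close> has density \<open>w\<close> with respect to \<open>m\<close> inside its
  support. By Tanaka's formula, the expected local time \<open>v\<^sub>n x\<close> of \<open>B\<close> at \<open>x\<close> up to \<open>min \<tau> n\<close> is the
  expectation of \<open>\<bar>B - x\<bar> - \<bar>x0 - x\<bar>\<close> at that time, hence \<open>v\<^sub>n'' / 2\<close> is the law of \<open>B\<close> at \<open>min \<tau> n\<close> minus the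
  point mass at \<open>x0\<close>. Since \<open>T\<close> is exponential and independent of \<open>B\<close>, the process \<open>\<Phi>\<close> stopped at \<open>\<tau>\<close>
  compensates the jump at \<open>\<tau>\<close>, so this law dominates \<open>v\<^sub>n\<close> times \<open>m\<close> inside the support. Therefore
  \<open>v\<^sub>n - w\<close> is convex where it is positive and vanishes at the ends, which forces \<open>v\<^sub>n \<le> w\<close>. This bound on
  potentials makes \<open>B\<close> stopped at \<open>\<tau>\<close> uniformly integrable and \<open>\<tau>\<close> finite. In the limit \<open>n \<longlonglongrightarrow> \<infinity>\<close>
  domination becomes equality, and the same maximum principle gives \<open>v = w\<close>: the law of \<open>B\<^sub>\<tau>\<close> has the
  potential of \<open>\<mu>\<close>. Finally \<open>X\<close> stopped at \<open>T\<close> is the uniformly integrable martingale \<open>B\<close>, stopped at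
  \<open>\<tau>\<close>, sampled at the times \<open>A\<^sub>t\<close>.\<close>

text \<open>The horizon n is there because optional stopping is applied at bounded times, whereas
  uniform integrability becomes known only through the bound on potentials. It does no harm: paths
  not yet stopped at time n add mass to the law of B, which is the direction that the maximum
  principle needs. The exponential law enters only through \<open>E min(T, a) = P(T < a)\<close>. As
  T is independent of the whole path, a may be the clock at any time, and both sides may be weighted
  by functionals of the path; this takes the place of conditioning and of the theory of
  compensators. The obstacle is the ends of the support. There \<mu> may have atoms while m has
  infinite mass, so the clock may jump from below T to \<infinity>, and stopping at an end is not
  compensated. Test functions are therefore supported inside the open interval, and the ends are
  controlled by the vanishing of w and of the expected local times there. This requires that B
  cannot leave the closed interval before the local time at an end is positive, which is deduced
  from Tanaka's formula.\<close>

section \<open>Uniform integrability\<close>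

text \<open>The expectation of \<open>excess K\<close> is a combination of the potentials at \<open>K\<close> and \<open>- K\<close>, so bounds on
  potentials give uniform integrability.\<close>

definition excess :: "real \<Rightarrow> real \<Rightarrow> real" where
  "excess K x = max 0 (\<bar>x\<bar> - K)"

lemma excess_nonneg: "0 \<le> excess K x"
  by (simp add: excess_def)

lemma excess_le_abs: "0 \<le> K \<Longrightarrow> excess K x \<le> \<bar>x\<bar>"
  by (simp add: excess_def)

lemma abs_le_excess: "\<bar>x\<bar> \<le> K + excess K x"
  by (simp add: excess_def)

lemma excess_lipschitz: "\<bar>excess K x - excess K y\<bar> \<le> \<bar>x - y\<bar>"
  unfolding excess_def by (auto simp: max_def abs_if)

lemma borel_measurable_excess [measurable]: "excess K \<in> borel_measurable borel"
  unfolding excess_def by measurable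

lemma continuous_on_excess: "continuous_on A (excess K)"
  unfolding excess_def by (intro continuous_intros)

lemma excess_eq_two_sided: "0 \<le> K \<Longrightarrow> excess K x = max 0 (x - K) + max 0 (- x - K)"
  by (auto simp: excess_def)

lemma excess_eq_potential: "0 \<le> K \<Longrightarrow> excess K x = (\<bar>x - K\<bar> + \<bar>x - (-K)\<bar>) / 2 - K"
  unfolding excess_def by (simp add: abs_if max_def field_simps)

lemma integrable_excess:
  assumes "integrable M f" "0 \<le> K"
  shows "integrable M (\<lambda>\<omega>. excess K (f \<omega>))"
proof (rule Bochner_Integration.integrable_bound[OF assms(1)])
  show "(\<lambda>\<omega>. excess K (f \<omega>)) \<in> borel_measurable M"
    using assms(1) by measurable
qed (auto simp: excess_nonneg excess_le_abs[OF assms(2)])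

lemma excess_integral_tendsto_0:
  assumes f: "integrable M f"
  shows "(\<lambda>k. \<integral>\<omega>. excess (real k) (f \<omega>) \<partial>M) \<longlonglongrightarrow> 0"
proof -
  have [measurable]: "f \<in> borel_measurable M" using f by simp
  have "(\<lambda>k. \<integral>\<omega>. excess (real k) (f \<omega>) \<partial>M) \<longlonglongrightarrow> (\<integral>\<omega>. 0 \<partial>M)"
  proof (rule integral_dominated_convergence[where w="\<lambda>\<omega>. \<bar>f \<omega>\<bar>"])
    show "AE \<omega> in M. (\<lambda>k. excess (real k) (f \<omega>)) \<longlonglongrightarrow> 0"
    proof (intro AE_I2)
      fix \<omega>
      have "eventually (\<lambda>k. excess (real k) (f \<omega>) = 0) sequentially"
        using eventually_ge_at_top[of "nat \<lceil>\<bar>f \<omega>\<bar>\<rceil>"]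
      proof eventually_elim
        case (elim k)
        then have "\<bar>f \<omega>\<bar> \<le> real k" by linarith
        then show ?case by (simp add: excess_def)
      qed
      then show "(\<lambda>k. excess (real k) (f \<omega>)) \<longlonglongrightarrow> 0"
        by (rule tendsto_eventually)
    qed
  qed (use f in \<open>auto simp: excess_nonneg excess_le_abs\<close>)
  then show ?thesis by simp
qed

lemma excess_integral_small:
  assumes f: "integrable M f" and "0 < \<epsilon>"
  obtains K where "0 \<le> K" "(\<integral>\<omega>. excess K (f \<omega>) \<partial>M) \<le> \<epsilon>"
proof -
  have "eventually (\<lambda>k. (\<integral>\<omega>. excess (real k) (f \<omega>) \<partial>M) < \<epsilon>) sequentially"
    using excess_integral_tendsto_0[OF f] \<open>0 < \<epsilon>\<close> by (rule order_tendstoD)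
  then obtain k where "(\<integral>\<omega>. excess (real k) (f \<omega>) \<partial>M) < \<epsilon>"
    by (auto simp: eventually_sequentially)
  then show ?thesis using that[of "real k"] by simp
qed

text \<open>Vitali's convergence theorem, with uniform integrability measured by
  \<open>excess\<close>. Fatou's lemma carries the uniform bound over to the limit, which yields
  integrability of \<open>Y\<close>; the truncated variables converge by dominated
  convergence.\<close>

lemma (in finite_measure) vitali_excess:
  fixes X :: "nat \<Rightarrow> 'a \<Rightarrow> real"
  assumes X: "\<And>k. integrable M (X k)" and Y[measurable]: "Y \<in> borel_measurable M"
    and lim: "AE \<omega> in M. (\<lambda>k. X k \<omega>) \<longlonglongrightarrow> Y \<omega>"
    and ui: "\<And>\<epsilon>. 0 < \<epsilon> \<Longrightarrow> \<exists>K\<ge>0. \<forall>k. (\<integral>\<omega>. excess K (X k \<omega>) \<partial>M) \<le> \<epsilon>"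
  shows "integrable M Y" "(\<lambda>k. \<integral>\<omega>. \<bar>X k \<omega> - Y \<omega>\<bar> \<partial>M) \<longlonglongrightarrow> 0"
proof -
  have [measurable]: "X k \<in> borel_measurable M" for k using X by simp
  have fatou: "(\<integral>\<^sup>+\<omega>. excess K (Y \<omega>) \<partial>M) \<le> ennreal \<epsilon>"
    if K: "0 \<le> K" "\<And>k. (\<integral>\<omega>. excess K (X k \<omega>) \<partial>M) \<le> \<epsilon>" for K \<epsilon>
  proof -
    have "(\<integral>\<^sup>+\<omega>. excess K (Y \<omega>) \<partial>M) = (\<integral>\<^sup>+\<omega>. liminf (\<lambda>k. ennreal (excess K (X k \<omega>))) \<partial>M)"
    proof (rule nn_integral_cong_AE)
      show "AE \<omega> in M. ennreal (excess K (Y \<omega>)) = liminf (\<lambda>k. ennreal (excess K (X k \<omega>)))"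
        using lim
      proof eventually_elim
        case (elim \<omega>)
        have "(\<lambda>k. ennreal (excess K (X k \<omega>))) \<longlonglongrightarrow> ennreal (excess K (Y \<omega>))"
          by (intro tendsto_intros continuous_on_tendsto_compose[OF continuous_on_excess[of UNIV] elim]) auto
        then show ?case by (simp add: lim_imp_Liminf)
      qed
    qed
    also have "\<dots> \<le> liminf (\<lambda>k. \<integral>\<^sup>+\<omega>. ennreal (excess K (X k \<omega>)) \<partial>M)"
      by (rule nn_integral_liminf) simp
    also have "\<dots> \<le> liminf (\<lambda>k. ennreal \<epsilon>)"
    proof (intro Liminf_mono always_eventually allI)
      fix k
      have "(\<integral>\<^sup>+\<omega>. ennreal (excess K (X k \<omega>)) \<partial>M) = ennreal (\<integral>\<omega>. excess K (X k \<omega>) \<partial>M)"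
        by (intro nn_integral_eq_integral integrable_excess X K) (simp add: excess_nonneg)
      also have "\<dots> \<le> ennreal \<epsilon>" using K(2)[of k] by (rule ennreal_leI)
      finally show "(\<integral>\<^sup>+\<omega>. ennreal (excess K (X k \<omega>)) \<partial>M) \<le> ennreal \<epsilon>" .
    qed
    also have "\<dots> = ennreal \<epsilon>" by (simp add: Liminf_const)
    finally show ?thesis .
  qed
  obtain K where K: "0 \<le> K" "\<And>k. (\<integral>\<omega>. excess K (X k \<omega>) \<partial>M) \<le> 1" using ui[of 1] by auto
  have "(\<integral>\<^sup>+\<omega>. \<bar>Y \<omega>\<bar> \<partial>M) \<le> (\<integral>\<^sup>+\<omega>. ennreal K + ennreal (excess K (Y \<omega>)) \<partial>M)"
    using K(1) by (intro nn_integral_mono) (simp add: ennreal_plus[symmetric] excess_nonneg abs_le_excess del: ennreal_plus)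
  also have "\<dots> = ennreal K * emeasure M (space M) + (\<integral>\<^sup>+\<omega>. excess K (Y \<omega>) \<partial>M)"
    by (simp add: nn_integral_add)
  also have "\<dots> \<le> ennreal K * emeasure M (space M) + ennreal 1"
    by (intro add_left_mono fatou K)
  also have "\<dots> < \<infinity>" by (simp add: ennreal_mult_less_top emeasure_eq_measure)
  finally show Y_int: "integrable M Y" by (intro integrableI_bounded) auto
  show "(\<lambda>k. \<integral>\<omega>. \<bar>X k \<omega> - Y \<omega>\<bar> \<partial>M) \<longlonglongrightarrow> 0"
  proof (rule LIMSEQ_I)
    fix r :: real assume "0 < r"
    then obtain K where K: "0 \<le> K" "\<And>k. (\<integral>\<omega>. excess K (X k \<omega>) \<partial>M) \<le> r/4"
      using ui[of "r/4"] by auto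
    have KY: "(\<integral>\<omega>. excess K (Y \<omega>) \<partial>M) \<le> r/4"
    proof -
      have "ennreal (\<integral>\<omega>. excess K (Y \<omega>) \<partial>M) = (\<integral>\<^sup>+\<omega>. excess K (Y \<omega>) \<partial>M)"
        by (intro nn_integral_eq_integral[symmetric] integrable_excess Y_int K) (simp add: excess_nonneg)
      also have "\<dots> \<le> ennreal (r/4)" by (intro fatou K)
      finally show ?thesis using \<open>0 < r\<close> by (simp add: ennreal_le_iff)
    qed
    \<comment> \<open>Truncation to \<open>[-K, K]\<close>: since
      \<open>\<bar>x - c x\<bar> = excess K x\<close>, the distance of \<open>X k\<close> and
      \<open>Y\<close> is at most two excesses plus the distance of the truncations.\<close>
    define c where "c x = max (-K) (min K x)" for x
    have c_bound: "\<bar>c x\<bar> \<le> K" for x using K(1) by (auto simp: c_def)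
    have c_meas[measurable]: "c \<in> borel_measurable borel" unfolding c_def by measurable
    have cont_c: "continuous_on UNIV c" unfolding c_def by (intro continuous_intros)
    have "(\<lambda>k. \<integral>\<omega>. \<bar>c (X k \<omega>) - c (Y \<omega>)\<bar> \<partial>M) \<longlonglongrightarrow> (\<integral>\<omega>. 0 \<partial>M)"
    proof (rule integral_dominated_convergence[where w="\<lambda>\<omega>. 2 * K"])
      show "AE \<omega> in M. (\<lambda>k. \<bar>c (X k \<omega>) - c (Y \<omega>)\<bar>) \<longlonglongrightarrow> 0"
        using lim
      proof eventually_elim
        case (elim \<omega>)
        have "(\<lambda>k. c (X k \<omega>)) \<longlonglongrightarrow> c (Y \<omega>)"
          by (intro continuous_on_tendsto_compose[OF cont_c elim]) auto
        then show ?case by (simp add: LIM_zero tendsto_rabs_zero)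
      qed
      show "AE \<omega> in M. norm \<bar>c (X k \<omega>) - c (Y \<omega>)\<bar> \<le> 2 * K" for k
        using c_bound by (intro AE_I2) (smt (verit) real_norm_def)
    qed auto
    then have "eventually (\<lambda>k. (\<integral>\<omega>. \<bar>c (X k \<omega>) - c (Y \<omega>)\<bar> \<partial>M) < r/4) sequentially"
      using \<open>0 < r\<close> by (intro order_tendstoD) auto
    then obtain n where n: "\<And>k. k \<ge> n \<Longrightarrow> (\<integral>\<omega>. \<bar>c (X k \<omega>) - c (Y \<omega>)\<bar> \<partial>M) < r/4"
      by (auto simp: eventually_sequentially)
    have cint: "integrable M (\<lambda>\<omega>. \<bar>c (X k \<omega>) - c (Y \<omega>)\<bar>)" for k
    proof (rule integrable_const_bound[where B="2*K"])
      show "AE \<omega> in M. norm \<bar>c (X k \<omega>) - c (Y \<omega>)\<bar> \<le> 2 * K"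
        using c_bound by (intro AE_I2) (smt (verit) real_norm_def)
    qed auto
    have "norm ((\<integral>\<omega>. \<bar>X k \<omega> - Y \<omega>\<bar> \<partial>M) - 0) < r" if "k \<ge> n" for k
    proof -
      have "(\<integral>\<omega>. \<bar>X k \<omega> - Y \<omega>\<bar> \<partial>M) \<le> (\<integral>\<omega>. excess K (X k \<omega>) + \<bar>c (X k \<omega>) - c (Y \<omega>)\<bar> + excess K (Y \<omega>) \<partial>M)"
      proof (rule integral_mono)
        show "integrable M (\<lambda>\<omega>. excess K (X k \<omega>) + \<bar>c (X k \<omega>) - c (Y \<omega>)\<bar> + excess K (Y \<omega>))"
          by (intro Bochner_Integration.integrable_add integrable_excess X Y_int K cint)
        show "integrable M (\<lambda>\<omega>. \<bar>X k \<omega> - Y \<omega>\<bar>)" using X Y_int by auto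
      qed (use K(1) in \<open>auto simp: excess_def c_def max_def min_def abs_if\<close>)
      also have "\<dots> = (\<integral>\<omega>. excess K (X k \<omega>) \<partial>M) + (\<integral>\<omega>. \<bar>c (X k \<omega>) - c (Y \<omega>)\<bar> \<partial>M) + (\<integral>\<omega>. excess K (Y \<omega>) \<partial>M)"
        using integrable_excess[OF X K(1)] integrable_excess[OF Y_int K(1)] cint by (simp add: Bochner_Integration.integrable_add)
      also have "\<dots> < r" using K(2)[of k] KY n[OF that] \<open>0 < r\<close> by linarith
      finally show ?thesis by simp
    qed
    then show "\<exists>no. \<forall>k\<ge>no. norm ((\<integral>\<omega>. \<bar>X k \<omega> - Y \<omega>\<bar> \<partial>M) - 0) < r" by auto
  qed
qed

lemma L1_tendsto_integral_indicator:
  fixes X :: "nat \<Rightarrow> 'a \<Rightarrow> real"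
  assumes X: "\<And>k. integrable M (X k)" and Y: "integrable M Y" and A: "A \<in> sets M"
    and lim: "(\<lambda>k. \<integral>\<omega>. \<bar>X k \<omega> - Y \<omega>\<bar> \<partial>M) \<longlonglongrightarrow> 0"
  shows "(\<lambda>k. \<integral>\<omega>. X k \<omega> * indicator A \<omega> \<partial>M) \<longlonglongrightarrow> (\<integral>\<omega>. Y \<omega> * indicator A \<omega> \<partial>M)"
proof -
  have "(\<lambda>k. (\<integral>\<omega>. X k \<omega> * indicator A \<omega> \<partial>M) - (\<integral>\<omega>. Y \<omega> * indicator A \<omega> \<partial>M)) \<longlonglongrightarrow> 0"
  proof (rule Lim_null_comparison[OF always_eventually lim], intro allI)
    fix k
    have i: "integrable M (\<lambda>\<omega>. X k \<omega> * indicator A \<omega>)" "integrable M (\<lambda>\<omega>. Y \<omega> * indicator A \<omega>)"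
      using X Y A by (auto intro: integrable_real_mult_indicator)
    have "(\<integral>\<omega>. X k \<omega> * indicator A \<omega> \<partial>M) - (\<integral>\<omega>. Y \<omega> * indicator A \<omega> \<partial>M)
        = (\<integral>\<omega>. X k \<omega> * indicator A \<omega> - Y \<omega> * indicator A \<omega> \<partial>M)" using i by simp
    also have "norm \<dots> \<le> (\<integral>\<omega>. \<bar>X k \<omega> * indicator A \<omega> - Y \<omega> * indicator A \<omega>\<bar> \<partial>M)"
      using integral_norm_bound[of M "\<lambda>\<omega>. X k \<omega> * indicator A \<omega> - Y \<omega> * indicator A \<omega>"] by simp
    also have "\<dots> \<le> (\<integral>\<omega>. \<bar>X k \<omega> - Y \<omega>\<bar> \<partial>M)"
      using i X Y by (intro integral_mono) (auto simp: indicator_def)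
    finally show "norm ((\<integral>\<omega>. X k \<omega> * indicator A \<omega> \<partial>M) - (\<integral>\<omega>. Y \<omega> * indicator A \<omega> \<partial>M))
      \<le> (\<integral>\<omega>. \<bar>X k \<omega> - Y \<omega>\<bar> \<partial>M)" .
  qed
  then show ?thesis by (simp add: LIM_zero_iff)
qed

text \<open>Times are approximated strictly from the right. Strictness matters for
  \<open>optional_time\<close>, which knows only the events \<open>\<sigma> < t\<close>: the
  approximation of \<open>\<sigma>\<close> equals a grid point \<open>i * h\<close> exactly when
  \<open>(i - 1) * h \<le> \<sigma> < i * h\<close>, and this is decided at time
  \<open>i * h\<close>.\<close>

lemma tendsto_floor_grid:
  fixes t :: real
  shows "(\<lambda>k. (real_of_int \<lfloor>real (Suc k) * t\<rfloor> + 1) / real (Suc k)) \<longlonglongrightarrow> t"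
    and "t < (real_of_int \<lfloor>real (Suc k) * t\<rfloor> + 1) / real (Suc k)"
    and "(real_of_int \<lfloor>real (Suc k) * t\<rfloor> + 1) / real (Suc k) \<le> t + 1 / real (Suc k)"
proof -
  have "real (Suc k) * t < real_of_int \<lfloor>real (Suc k) * t\<rfloor> + 1" for k by linarith
  then show *: "t < (real_of_int \<lfloor>real (Suc k) * t\<rfloor> + 1) / real (Suc k)" for k
    by (simp only: pos_less_divide_eq of_nat_0_less_iff zero_less_Suc mult.commute)
  have "real_of_int \<lfloor>real (Suc k) * t\<rfloor> + 1 \<le> real (Suc k) * t + 1" for k by linarith
  then have "(real_of_int \<lfloor>real (Suc k) * t\<rfloor> + 1) / real (Suc k) \<le> (real (Suc k) * t + 1) / real (Suc k)" for k
    by (intro divide_right_mono) auto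
  also have "(real (Suc k) * t + 1) / real (Suc k) = t + 1 / real (Suc k)" for k
    by (simp add: add_divide_distrib del: of_nat_Suc)
  finally show **: "(real_of_int \<lfloor>real (Suc k) * t\<rfloor> + 1) / real (Suc k) \<le> t + 1 / real (Suc k)" for k .
  show "(\<lambda>k. (real_of_int \<lfloor>real (Suc k) * t\<rfloor> + 1) / real (Suc k)) \<longlonglongrightarrow> t"
  proof (rule tendsto_sandwich)
    show "(\<lambda>k. t) \<longlonglongrightarrow> t" by simp
    have "(\<lambda>k. t + 1 / real (Suc k)) \<longlonglongrightarrow> t + 0"
      by (intro tendsto_add tendsto_const LIMSEQ_Suc lim_1_over_n)
    then show "(\<lambda>k. t + 1 / real (Suc k)) \<longlonglongrightarrow> t" by simp
  qed (use * ** in \<open>auto simp del: of_nat_Suc intro!: always_eventually less_imp_le\<close>)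
qed

text \<open>The value at \<open>t\<close> is the limit of values at grid points; for each grid only
  countably many of them occur, so each approximation is jointly measurable. The continuous
  parameter may be time or, for local times, the level.\<close>

lemma measurable_continuous_process:
  fixes f :: "real \<Rightarrow> 'b \<Rightarrow> real"
  assumes meas: "\<And>t. f t \<in> borel_measurable N"
    and cont: "\<And>\<omega>. \<omega> \<in> space N \<Longrightarrow> continuous_on UNIV (\<lambda>t. f t \<omega>)"
  shows "(\<lambda>(t, \<omega>). f t \<omega>) \<in> borel_measurable (borel \<Otimes>\<^sub>M N)"
proof (rule borel_measurable_LIMSEQ_real)
  let ?g = "\<lambda>k p. f ((real_of_int \<lfloor>real (Suc k) * fst p\<rfloor> + 1) / real (Suc k)) (snd p)"
  show "?g k \<in> borel_measurable (borel \<Otimes>\<^sub>M N)" for k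
  proof (rule measurable_compose_countable[where f="\<lambda>i p. f ((real_of_int i + 1) / real (Suc k)) (snd p)"])
    show "(\<lambda>p. f ((real_of_int i + 1) / real (Suc k)) (snd p)) \<in> borel_measurable (borel \<Otimes>\<^sub>M N)" for i
      by (intro measurable_compose[OF measurable_snd meas])
    show "(\<lambda>p. \<lfloor>real (Suc k) * fst p\<rfloor>) \<in> (borel :: real measure) \<Otimes>\<^sub>M N \<rightarrow>\<^sub>M count_space UNIV"
      by measurable
  qed
  fix p assume "p \<in> space ((borel :: real measure) \<Otimes>\<^sub>M N)"
  then have "snd p \<in> space N" by (auto simp: space_pair_measure)
  from continuous_on_tendsto_compose[OF cont[OF this] tendsto_floor_grid(1)[of "fst p"]]
  show "(\<lambda>k. ?g k p) \<longlonglongrightarrow> (case p of (t, \<omega>) \<Rightarrow> f t \<omega>)"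
    by (simp add: case_prod_beta)
qed

lemma (in complete_measure) measurable_AE_eq:
  fixes Y X :: "'a \<Rightarrow> real"
  assumes G: "subalgebra M G" and null: "null_sets M \<subseteq> sets G"
    and Y: "Y \<in> borel_measurable G" and eq: "AE \<omega> in M. X \<omega> = Y \<omega>"
  shows "X \<in> borel_measurable G"
proof (rule measurableI)
  fix D :: "real set" assume D: "D \<in> sets borel"
  have sp: "space G = space M" using G by (auto simp: subalgebra_def)
  let ?N = "{\<omega>\<in>space M. X \<omega> \<noteq> Y \<omega>}"
  have N: "?N \<in> null_sets M" using eq by (simp add: AE_iff_null_sets)
  have "X -` D \<inter> ?N \<in> null_sets M" by (rule complete2[OF _ N]) auto
  then have "(Y -` D \<inter> space G - ?N) \<union> (X -` D \<inter> ?N) \<in> sets G"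
    using N null measurable_sets[OF Y D] by blast
  also have "(Y -` D \<inter> space G - ?N) \<union> (X -` D \<inter> ?N) = X -` D \<inter> space G"
    using sp by auto
  finally show "X -` D \<inter> space G \<in> sets G" .
qed auto

section \<open>Optional stopping\<close>

text \<open>Bounded, so that optional stopping needs no uniform integrability as a hypothesis, and
  with strict inequalities, which debuts satisfy without right-continuity of the filtration.\<close>

definition optional_time :: "'a measure \<Rightarrow> (ennreal \<Rightarrow> 'a measure) \<Rightarrow> real \<Rightarrow> ('a \<Rightarrow> real) \<Rightarrow> bool" where
  "optional_time M F c \<sigma> \<longleftrightarrow>
     (\<forall>\<omega>\<in>space M. 0 \<le> \<sigma> \<omega> \<and> \<sigma> \<omega> \<le> c) \<and> (\<forall>t>0. {\<omega>\<in>space M. \<sigma> \<omega> < t} \<in> sets (F (ennreal t)))"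

context filtered_prob_space
begin

lemma F_sets_mono: "s \<le> t \<Longrightarrow> A \<in> sets (F s) \<Longrightarrow> A \<in> sets (F t)"
  using sets_F_mono[of s t] by auto

lemma F_sets_M: "A \<in> sets (F t) \<Longrightarrow> A \<in> sets M"
  using subalg[of t] by (auto simp: subalgebra_def)

lemma F_measurable_mono:
  assumes "f \<in> measurable (F s) N" "s \<le> t" shows "f \<in> measurable (F t) N"
  using assms sets_F_mono[OF assms(2)] by (auto simp: measurable_def space_F)

lemma F_measurable_M: "f \<in> measurable (F s) N \<Longrightarrow> f \<in> measurable M N"
  using measurable_from_subalg[OF subalg] .

lemma sigma_finite_subalgebra_F: "sigma_finite_subalgebra M (F t)"
  using finite_measure_subalgebra.intro[OF _ finite_measure_subalgebra_axioms.intro[OF subalg]]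
    finite_measure_axioms finite_measure_subalgebra_is_sigma_finite
  by (metis finite_measure_subalgebra.intro finite_measure_subalgebra_axioms.intro)

lemma martingale_set_integral:
  assumes Y: "martingale M (\<lambda>t. F (ennreal t)) Y" and st: "0 \<le> s" "s \<le> t" and A: "A \<in> sets (F (ennreal s))"
  shows "(\<integral>\<omega>. Y t \<omega> * indicator A \<omega> \<partial>M) = (\<integral>\<omega>. Y s \<omega> * indicator A \<omega> \<partial>M)"
proof -
  interpret S: sigma_finite_subalgebra M "F (ennreal s)" by (rule sigma_finite_subalgebra_F)
  have Yt: "integrable M (Y t)" and ce: "AE \<omega> in M. real_cond_exp M (F (ennreal s)) (Y t) \<omega> = Y s \<omega>"
    using Y st by (auto simp: martingale_def)
  have Ys [measurable]: "Y s \<in> borel_measurable M"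
    using Y st F_measurable_M by (auto simp: martingale_def)
  have [measurable]: "A \<in> sets M" using A by (rule F_sets_M)
  have "(\<integral>\<omega>. Y t \<omega> * indicator A \<omega> \<partial>M) = set_lebesgue_integral M A (Y t)"
    by (simp add: set_lebesgue_integral_def mult.commute)
  also have "\<dots> = set_lebesgue_integral M A (real_cond_exp M (F (ennreal s)) (Y t))"
    by (rule S.real_cond_exp_intA[OF Yt A])
  also have "\<dots> = (\<integral>\<omega>. Y s \<omega> * indicator A \<omega> \<partial>M)"
    unfolding set_lebesgue_integral_def
  proof (rule integral_cong_AE)
    show "AE \<omega> in M. indicat_real A \<omega> *\<^sub>R real_cond_exp M (F (ennreal s)) (Y t) \<omega> = Y s \<omega> * indicat_real A \<omega>"
      using ce by eventually_elim simp
  qed auto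
  finally show ?thesis .
qed

text \<open>The submartingale property of a convex function of \<open>Y\<close>. For each side
  \<open>r = 1\<close> and \<open>r = -1\<close>, the positive part at time \<open>s\<close> is the
  affine function \<open>r * Y s - K\<close> on an event of \<open>F s\<close>; there the martingale
  property applies, and at time \<open>t\<close> the affine function is below the positive
  part.\<close>

lemma martingale_excess_mono:
  assumes Y: "martingale M (\<lambda>t. F (ennreal t)) Y" and st: "0 \<le> s" "s \<le> t" and A: "A \<in> sets (F (ennreal s))"
    and K: "0 \<le> K"
  shows "(\<integral>\<omega>. excess K (Y s \<omega>) * indicator A \<omega> \<partial>M) \<le> (\<integral>\<omega>. excess K (Y t \<omega>) * indicator A \<omega> \<partial>M)"
proof -
  have intY: "integrable M (Y s)" "integrable M (Y t)" using Y st by (auto simp: martingale_def)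
  have Ys [measurable]: "Y s \<in> borel_measurable (F (ennreal s))" using Y st by (auto simp: martingale_def)
  have A' [measurable]: "A \<in> sets M" using A by (rule F_sets_M)
  have one: "(\<integral>\<omega>. max 0 (r * Y s \<omega> - K) * indicator A \<omega> \<partial>M) \<le> (\<integral>\<omega>. max 0 (r * Y t \<omega> - K) * indicator A \<omega> \<partial>M)"
    for r :: real
  proof -
    define A1 where "A1 = {\<omega>\<in>space (F (ennreal s)). r * Y s \<omega> > K} \<inter> A"
    have A1: "A1 \<in> sets (F (ennreal s))" unfolding A1_def by (intro sets.Int A) measurable
    note [measurable] = F_sets_M[OF A1]
    have iA: "integrable M (\<lambda>\<omega>. Y s \<omega> * indicator A1 \<omega>)" "integrable M (\<lambda>\<omega>. Y t \<omega> * indicator A1 \<omega>)"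
      using intY by (auto intro: integrable_real_mult_indicator)
    have iK: "integrable M (\<lambda>\<omega>. K * indicator A1 \<omega> :: real)"
      by (auto intro!: integrable_real_indicator simp: emeasure_eq_measure)
    have "(\<integral>\<omega>. max 0 (r * Y s \<omega> - K) * indicator A \<omega> \<partial>M) = (\<integral>\<omega>. r * (Y s \<omega> * indicator A1 \<omega>) - K * indicator A1 \<omega> \<partial>M)"
      using space_F by (intro Bochner_Integration.integral_cong) (auto simp: A1_def indicator_def max_def)
    also have "\<dots> = r * (\<integral>\<omega>. Y s \<omega> * indicator A1 \<omega> \<partial>M) - (\<integral>\<omega>. K * indicator A1 \<omega> \<partial>M)"
      using iA iK by simp
    also have "\<dots> = r * (\<integral>\<omega>. Y t \<omega> * indicator A1 \<omega> \<partial>M) - (\<integral>\<omega>. K * indicator A1 \<omega> \<partial>M)"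
      using martingale_set_integral[OF Y st A1] by simp
    also have "\<dots> = (\<integral>\<omega>. r * (Y t \<omega> * indicator A1 \<omega>) - K * indicator A1 \<omega> \<partial>M)"
      using iA iK by simp
    also have "\<dots> \<le> (\<integral>\<omega>. max 0 (r * Y t \<omega> - K) * indicator A \<omega> \<partial>M)"
    proof (rule integral_mono)
      show "integrable M (\<lambda>\<omega>. max 0 (r * Y t \<omega> - K) * indicator A \<omega>)"
        using intY A' by (intro integrable_real_mult_indicator Bochner_Integration.integrable_max) auto
    qed (use iA iK in \<open>auto simp: A1_def indicator_def max_def\<close>)
    finally show ?thesis .
  qed
  have i: "integrable M (\<lambda>\<omega>. max 0 (r * Y u \<omega> - K) * indicator A \<omega>)" if "integrable M (Y u)" for r u
    using that A' by (intro integrable_real_mult_indicator Bochner_Integration.integrable_max) auto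
  have "(\<integral>\<omega>. excess K (Y u \<omega>) * indicator A \<omega> \<partial>M)
     = (\<integral>\<omega>. max 0 (1 * Y u \<omega> - K) * indicator A \<omega> \<partial>M) + (\<integral>\<omega>. max 0 (-1 * Y u \<omega> - K) * indicator A \<omega> \<partial>M)"
    if "integrable M (Y u)" for u
    using i[OF that, of 1] i[OF that, of "-1"]
    by (subst Bochner_Integration.integral_add[symmetric]) (auto simp: excess_eq_two_sided[OF K] distrib_right)
  then show ?thesis using one[of 1] one[of "-1"] intY by fastforce
qed

lemma optional_timeD:
  assumes "optional_time M F c \<sigma>"
  shows "\<omega> \<in> space M \<Longrightarrow> 0 \<le> \<sigma> \<omega>" "\<omega> \<in> space M \<Longrightarrow> \<sigma> \<omega> \<le> c"
    "{\<omega>\<in>space M. \<sigma> \<omega> < t} \<in> sets (F (ennreal t))"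
proof -
  show "{\<omega>\<in>space M. \<sigma> \<omega> < t} \<in> sets (F (ennreal t))"
  proof (cases "0 < t")
    case False
    then have "{\<omega>\<in>space M. \<sigma> \<omega> < t} = {}" using assms by (fastforce simp: optional_time_def)
    then show ?thesis by (simp only: sets.empty_sets)
  qed (use assms in \<open>auto simp: optional_time_def\<close>)
qed (use assms in \<open>auto simp: optional_time_def\<close>)

lemma optional_time_measurable:
  assumes "optional_time M F c \<sigma>" shows "\<sigma> \<in> borel_measurable M"
proof (rule borel_measurableI_less)
  show "{\<omega> \<in> space M. \<sigma> \<omega> < t} \<in> sets M" for t
    using optional_timeD(3)[OF assms] by (rule F_sets_M)
qed

lemma optional_time_min:
  assumes "optional_time M F c \<sigma>" "optional_time M F d \<rho>"
  shows "optional_time M F c (\<lambda>\<omega>. min (\<sigma> \<omega>) (\<rho> \<omega>))"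
proof -
  have "{\<omega> \<in> space M. min (\<sigma> \<omega>) (\<rho> \<omega>) < t} = {\<omega> \<in> space M. \<sigma> \<omega> < t} \<union> {\<omega> \<in> space M. \<rho> \<omega> < t}" for t
    by auto
  then show ?thesis
    using optional_timeD[OF assms(1)] optional_timeD[OF assms(2)]
    by (auto simp: optional_time_def min_le_iff_disj)
qed

text \<open>The time is replaced by grid times on its right. After splitting by the grid value, the
  martingale property moves every piece to the fixed time \<open>c + 1\<close>, for expectations
  and, as an inequality, for excesses. The latter gives uniform integrability, so the limit along
  finer grids holds in mean.\<close>

theorem optional_stopping:
  assumes Y: "martingale M (\<lambda>t. F (ennreal t)) Y"
    and cont: "\<And>\<omega>. \<omega> \<in> space M \<Longrightarrow> continuous_on UNIV (\<lambda>t. Y t \<omega>)"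
    and meas: "\<And>t. Y t \<in> borel_measurable M"
    and \<sigma>: "optional_time M F c \<sigma>"
  shows "integrable M (\<lambda>\<omega>. Y (\<sigma> \<omega>) \<omega>)" "(\<integral>\<omega>. Y (\<sigma> \<omega>) \<omega> \<partial>M) = (\<integral>\<omega>. Y 0 \<omega> \<partial>M)"
proof -
  have c: "0 \<le> c" using optional_timeD(1,2)[OF \<sigma>] not_empty by fastforce
  have [measurable]: "\<sigma> \<in> borel_measurable M" by (rule optional_time_measurable[OF \<sigma>])
  \<comment> \<open>\<open>j k \<omega> * h k\<close> is the first multiple of the mesh
    \<open>h k\<close> strictly above \<open>\<sigma> \<omega>\<close>. Meshes are at most 1, so all
    these times are at most \<open>c + 1\<close>.\<close>
  define j where "j k \<omega> = nat (\<lfloor>real (Suc k) * \<sigma> \<omega>\<rfloor> + 1)" for k \<omega>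
  define h where "h k = 1 / real (Suc k)" for k
  define J where "J k = nat (\<lfloor>real (Suc k) * c\<rfloor> + 1)" for k
  define E where "E k i = {\<omega>\<in>space M. j k \<omega> = i}" for k i
  have jh: "real (j k \<omega>) * h k = (real_of_int \<lfloor>real (Suc k) * \<sigma> \<omega>\<rfloor> + 1) / real (Suc k)" if "\<omega> \<in> space M" for k \<omega>
  proof -
    have "0 \<le> real (Suc k) * \<sigma> \<omega>" using optional_timeD(1)[OF \<sigma> that] by simp
    then have "0 \<le> \<lfloor>real (Suc k) * \<sigma> \<omega>\<rfloor>" by linarith
    then have "real (j k \<omega>) = real_of_int \<lfloor>real (Suc k) * \<sigma> \<omega>\<rfloor> + 1" by (simp add: j_def)
    then show ?thesis by (simp add: h_def)
  qed
  have j_range: "j k \<omega> \<in> {1..J k}" if "\<omega> \<in> space M" for k \<omega>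
  proof -
    have "0 \<le> real (Suc k) * \<sigma> \<omega>" "real (Suc k) * \<sigma> \<omega> \<le> real (Suc k) * c"
      using optional_timeD(1,2)[OF \<sigma> that] by (auto simp del: of_nat_Suc intro!: mult_left_mono)
    then have "0 \<le> \<lfloor>real (Suc k) * \<sigma> \<omega>\<rfloor>" "\<lfloor>real (Suc k) * \<sigma> \<omega>\<rfloor> \<le> \<lfloor>real (Suc k) * c\<rfloor>"
      by (linarith, intro floor_mono)
    then show ?thesis unfolding j_def J_def atLeastAtMost_iff by linarith
  qed
  have J_bound: "real i * h k \<le> c + 1" if "i \<le> J k" for i k
  proof -
    have "0 \<le> \<lfloor>real (Suc k) * c\<rfloor>" using c by (simp del: of_nat_Suc)
    then have "real (J k) * h k = (real_of_int \<lfloor>real (Suc k) * c\<rfloor> + 1) / real (Suc k)" by (simp add: J_def h_def)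
    also have "\<dots> \<le> c + 1 / real (Suc k)" by (rule tendsto_floor_grid(3))
    also have "1 / real (Suc k) \<le> 1" by simp
    finally have "real (J k) * h k \<le> c + 1" by simp
    moreover have "real i * h k \<le> real (J k) * h k" using that by (intro mult_right_mono) (auto simp: h_def)
    ultimately show ?thesis by linarith
  qed
  have E_sets: "E k i \<in> sets (F (ennreal (real i * h k)))" if "1 \<le> i" for k i
  proof -
    have "E k i = {\<omega>\<in>space M. \<sigma> \<omega> < real i * h k} - {\<omega>\<in>space M. \<sigma> \<omega> < real (i - 1) * h k}"
    proof (rule set_eqI)
      fix \<omega>
      show "\<omega> \<in> E k i \<longleftrightarrow> \<omega> \<in> {\<omega>\<in>space M. \<sigma> \<omega> < real i * h k} - {\<omega>\<in>space M. \<sigma> \<omega> < real (i - 1) * h k}"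
      proof (cases "\<omega> \<in> space M")
        case True
        have "0 \<le> real (Suc k) * \<sigma> \<omega>" using optional_timeD(1)[OF \<sigma> True] by simp
        then have "j k \<omega> = i \<longleftrightarrow> \<lfloor>real (Suc k) * \<sigma> \<omega>\<rfloor> = int i - 1"
          unfolding j_def by linarith
        also have "\<dots> \<longleftrightarrow> real i - 1 \<le> real (Suc k) * \<sigma> \<omega> \<and> real (Suc k) * \<sigma> \<omega> < real i"
          by (subst floor_eq_iff) simp
        also have "\<dots> \<longleftrightarrow> real (i-1) * h k \<le> \<sigma> \<omega> \<and> \<sigma> \<omega> < real i * h k"
          using that by (simp add: h_def of_nat_diff pos_divide_le_eq pos_less_divide_eq mult.commute[of "\<sigma> \<omega>"] del: of_nat_Suc) simp
        finally show ?thesis using True by (auto simp: E_def)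
      qed (auto simp: E_def)
    qed
    moreover have "{\<omega>\<in>space M. \<sigma> \<omega> < real (i - 1) * h k} \<in> sets (F (ennreal (real i * h k)))"
      by (rule F_sets_mono[OF _ optional_timeD(3)[OF \<sigma>]]) (intro ennreal_leI mult_right_mono, auto simp: h_def)
    ultimately show ?thesis using optional_timeD(3)[OF \<sigma>] by auto
  qed
  have E_M[measurable]: "E k i \<in> sets M" if "1 \<le> i" for k i using E_sets[OF that] by (rule F_sets_M)
  define X where "X k \<omega> = Y (real (j k \<omega>) * h k) \<omega>" for k \<omega>
  have X_split: "g (X k \<omega>) = (\<Sum>i\<in>{1..J k}. g (Y (real i * h k) \<omega>) * indicator (E k i) \<omega>)"
    if "\<omega> \<in> space M" for \<omega> k and g :: "real \<Rightarrow> real"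
  proof -
    have "(\<Sum>i\<in>{1..J k}. g (Y (real i * h k) \<omega>) * indicator (E k i) \<omega>) =
       (\<Sum>i\<in>{1..J k}. if i = j k \<omega> then g (Y (real i * h k) \<omega>) else 0)"
      using that by (intro sum.cong) (auto simp: E_def)
    also have "\<dots> = g (X k \<omega>)" using j_range[OF that, of k] by (simp add: X_def)
    finally show ?thesis by simp
  qed
  have Yint: "0 \<le> t \<Longrightarrow> integrable M (Y t)" for t using Y by (auto simp: martingale_def)
  have h0: "0 \<le> h k" for k by (simp add: h_def)
  have ti: "0 \<le> real i * h k" for i k using h0 by simp
  have part_int: "integrable M (\<lambda>\<omega>. Y t \<omega> * indicator (E k i) \<omega>)" if "0 \<le> t" "i \<in> {1..J k}" for t k i
    using that by (intro integrable_real_mult_indicator Yint E_M) auto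
  have X_int: "integrable M (X k)" for k
  proof -
    have "integrable M (\<lambda>\<omega>. \<Sum>i\<in>{1..J k}. Y (real i * h k) \<omega> * indicator (E k i) \<omega>)"
      using part_int ti by (intro Bochner_Integration.integrable_sum) auto
    then show ?thesis by (rule Bochner_Integration.integrable_cong[THEN iffD1, rotated 2]) (auto simp: X_split[of _ "\<lambda>x. x"])
  qed
  have E_disj: "(\<Sum>i\<in>{1..J k}. g \<omega> * indicator (E k i) \<omega>) = g \<omega>" if "\<omega> \<in> space M" for g :: "'a \<Rightarrow> real" and k \<omega>
  proof -
    have "(\<Sum>i\<in>{1..J k}. g \<omega> * indicator (E k i) \<omega>) = (\<Sum>i\<in>{1..J k}. if i = j k \<omega> then g \<omega> else 0)"
      using that by (intro sum.cong) (auto simp: E_def)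
    then show ?thesis using j_range[OF that, of k] by simp
  qed
  have X_exp: "(\<integral>\<omega>. X k \<omega> \<partial>M) = (\<integral>\<omega>. Y 0 \<omega> \<partial>M)" for k
  proof -
    have "(\<integral>\<omega>. X k \<omega> \<partial>M) = (\<integral>\<omega>. (\<Sum>i\<in>{1..J k}. Y (real i * h k) \<omega> * indicator (E k i) \<omega>) \<partial>M)"
      by (intro Bochner_Integration.integral_cong) (auto simp: X_split[of _ "\<lambda>x. x"])
    also have "\<dots> = (\<Sum>i\<in>{1..J k}. \<integral>\<omega>. Y (real i * h k) \<omega> * indicator (E k i) \<omega> \<partial>M)"
      using part_int ti by (intro Bochner_Integration.integral_sum) auto
    also have "\<dots> = (\<Sum>i\<in>{1..J k}. \<integral>\<omega>. Y (c + 1) \<omega> * indicator (E k i) \<omega> \<partial>M)"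
      by (intro sum.cong refl martingale_set_integral[OF Y, symmetric] E_sets ti J_bound) auto
    also have "\<dots> = (\<integral>\<omega>. (\<Sum>i\<in>{1..J k}. Y (c + 1) \<omega> * indicator (E k i) \<omega>) \<partial>M)"
      using part_int[of "c+1"] c by (intro Bochner_Integration.integral_sum[symmetric]) auto
    also have "\<dots> = (\<integral>\<omega>. Y (c + 1) \<omega> \<partial>M)"
      by (intro Bochner_Integration.integral_cong E_disj) auto
    also have "\<dots> = (\<integral>\<omega>. Y (c + 1) \<omega> * indicator (space M) \<omega> \<partial>M)"
      by (intro Bochner_Integration.integral_cong) auto
    also have "\<dots> = (\<integral>\<omega>. Y 0 \<omega> * indicator (space M) \<omega> \<partial>M)"
      using c sets.top[of "F (ennreal 0)"] by (intro martingale_set_integral[OF Y]) (auto simp: space_F)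
    also have "\<dots> = (\<integral>\<omega>. Y 0 \<omega> \<partial>M)"
      by (intro Bochner_Integration.integral_cong) auto
    finally show ?thesis .
  qed
  have X_exc: "(\<integral>\<omega>. excess K (X k \<omega>) \<partial>M) \<le> (\<integral>\<omega>. excess K (Y (c + 1) \<omega>) \<partial>M)" if K: "0 \<le> K" for k K
  proof -
    have pe: "integrable M (\<lambda>\<omega>. excess K (Y t \<omega>) * indicator (E k i) \<omega>)" if "0 \<le> t" "i \<in> {1..J k}" for t i
      using that K by (intro integrable_real_mult_indicator integrable_excess Yint E_M) auto
    have "(\<integral>\<omega>. excess K (X k \<omega>) \<partial>M) = (\<integral>\<omega>. (\<Sum>i\<in>{1..J k}. excess K (Y (real i * h k) \<omega>) * indicator (E k i) \<omega>) \<partial>M)"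
      by (intro Bochner_Integration.integral_cong) (auto simp: X_split[of _ "excess K"])
    also have "\<dots> = (\<Sum>i\<in>{1..J k}. \<integral>\<omega>. excess K (Y (real i * h k) \<omega>) * indicator (E k i) \<omega> \<partial>M)"
      using pe ti by (intro Bochner_Integration.integral_sum) auto
    also have "\<dots> \<le> (\<Sum>i\<in>{1..J k}. \<integral>\<omega>. excess K (Y (c + 1) \<omega>) * indicator (E k i) \<omega> \<partial>M)"
      by (intro sum_mono martingale_excess_mono[OF Y] E_sets ti J_bound K) auto
    also have "\<dots> = (\<integral>\<omega>. (\<Sum>i\<in>{1..J k}. excess K (Y (c + 1) \<omega>) * indicator (E k i) \<omega>) \<partial>M)"
      using pe[of "c+1"] c by (intro Bochner_Integration.integral_sum[symmetric]) auto
    also have "\<dots> = (\<integral>\<omega>. excess K (Y (c + 1) \<omega>) \<partial>M)"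
      by (intro Bochner_Integration.integral_cong E_disj) auto
    finally show ?thesis .
  qed
  have lim: "(\<lambda>k. X k \<omega>) \<longlonglongrightarrow> Y (\<sigma> \<omega>) \<omega>" if "\<omega> \<in> space M" for \<omega>
    unfolding X_def jh[OF that]
    by (rule continuous_on_tendsto_compose[OF cont[OF that] tendsto_floor_grid(1)]) auto
  have Y\<sigma>: "(\<lambda>\<omega>. Y (\<sigma> \<omega>) \<omega>) \<in> borel_measurable M"
    using X_int by (intro borel_measurable_LIMSEQ_real[OF lim]) auto
  have ui: "\<exists>K\<ge>0. \<forall>k. (\<integral>\<omega>. excess K (X k \<omega>) \<partial>M) \<le> \<epsilon>" if \<epsilon>: "0 < \<epsilon>" for \<epsilon>
  proof -
    have "integrable M (Y (c + 1))" using Yint c by simp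
    then obtain K where "0 \<le> K" "(\<integral>\<omega>. excess K (Y (c + 1) \<omega>) \<partial>M) \<le> \<epsilon>"
      using excess_integral_small[OF _ \<epsilon>] by blast
    then show ?thesis using X_exc[of K] by (meson order_trans)
  qed
  note V = vitali_excess[OF X_int Y\<sigma> AE_I2[OF lim] ui]
  show I: "integrable M (\<lambda>\<omega>. Y (\<sigma> \<omega>) \<omega>)" by (rule V(1))
  have "(\<lambda>k. \<integral>\<omega>. X k \<omega> * indicator (space M) \<omega> \<partial>M) \<longlonglongrightarrow> (\<integral>\<omega>. Y (\<sigma> \<omega>) \<omega> * indicator (space M) \<omega> \<partial>M)"
    by (rule L1_tendsto_integral_indicator[OF X_int I sets.top V(2)])
  moreover have "(\<integral>\<omega>. g \<omega> * indicator (space M) \<omega> \<partial>M) = (\<integral>\<omega>. g \<omega> \<partial>M)" for g :: "'a \<Rightarrow> real"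
    by (intro Bochner_Integration.integral_cong) auto
  ultimately have "(\<lambda>k. \<integral>\<omega>. X k \<omega> \<partial>M) \<longlonglongrightarrow> (\<integral>\<omega>. Y (\<sigma> \<omega>) \<omega> \<partial>M)" by simp
  then show "(\<integral>\<omega>. Y (\<sigma> \<omega>) \<omega> \<partial>M) = (\<integral>\<omega>. Y 0 \<omega> \<partial>M)"
    unfolding X_exp by (simp add: LIMSEQ_const_iff)
qed

end

lemma (in prob_space) indep_var_of_indep_set:
  assumes ind: "indep_set (sets G) (sets (vimage_algebra (space M) Y N'))"
    and G: "space G = space M" and X: "X \<in> measurable G N" and Y: "Y \<in> measurable M N'"
  shows "indep_var N X N' Y"
proof -
  have sub: "sets G \<subseteq> events" using indep_setD_ev1[OF ind] .
  have X': "X \<in> measurable M N"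
    using X sub G by (auto simp: measurable_def)
  have "sigma_sets (space M) {X -` A \<inter> space M |A. A \<in> sets N} \<subseteq> sets G"
    using measurable_sets[OF X] by (auto simp: G[symmetric] intro!: sets.sigma_sets_subset)
  moreover have "sigma_sets (space M) {Y -` A \<inter> space M |A. A \<in> sets N'} \<subseteq> sets (vimage_algebra (space M) Y N')"
    by (simp add: sets_vimage_algebra)
  ultimately have "indep_set (sigma_sets (space M) {X -` A \<inter> space M |A. A \<in> sets N})
      (sigma_sets (space M) {Y -` A \<inter> space M |A. A \<in> sets N'})"
    using ind unfolding indep_sets2_eq by blast
  then show ?thesis unfolding indep_var_eq using X' Y by auto
qed

text \<open>Inserting \<open>c\<close> caps the entrance time and keeps the infimum of reals away
  from the empty set.\<close>

definition debut :: "real \<Rightarrow> (real \<Rightarrow> 'a \<Rightarrow> bool) \<Rightarrow> 'a \<Rightarrow> real" where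
  "debut c P \<omega> = Inf (insert c {r. 0 \<le> r \<and> P r \<omega>})"

lemma debut_less_iff: "debut c P \<omega> < t \<longleftrightarrow> c < t \<or> (\<exists>r\<ge>0. P r \<omega> \<and> r < t)"
proof -
  have "bdd_below (insert c {r. 0 \<le> r \<and> P r \<omega>})" by (auto intro!: bdd_belowI[of _ "min 0 c"])
  then show ?thesis unfolding debut_def by (subst cInf_less_iff) auto
qed

lemma debut_nonneg: "0 \<le> c \<Longrightarrow> 0 \<le> debut c P \<omega>"
  using debut_less_iff[of c P \<omega> 0] by force

lemma debut_le: "debut c P \<omega> \<le> c"
  using debut_less_iff[of c P \<omega> "debut c P \<omega>"] by force

lemma debut_le_at: "0 \<le> r \<Longrightarrow> P r \<omega> \<Longrightarrow> debut c P \<omega> \<le> r"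
  using debut_less_iff[of c P \<omega> "debut c P \<omega>"] by force

lemma not_before_debut: "0 \<le> r \<Longrightarrow> r < debut c P \<omega> \<Longrightarrow> \<not> P r \<omega>"
  using debut_le_at[of r P \<omega> c] by auto

text \<open>An uncountable union over times before \<open>t\<close> need not be measurable. By
  \<open>right\<close>, a time at which \<open>P\<close> holds can be moved to a rational time
  before \<open>t\<close>, which makes the union countable.\<close>

lemma (in filtered_prob_space) optional_time_debut:
  assumes c: "0 \<le> c" and P: "\<And>t. 0 \<le> t \<Longrightarrow> {\<omega>\<in>space M. P t \<omega>} \<in> sets (F (ennreal t))"
    and right: "\<And>\<omega> s t. \<omega> \<in> space M \<Longrightarrow> 0 \<le> s \<Longrightarrow> s < t \<Longrightarrow> P s \<omega> \<Longrightarrow> \<exists>q\<in>\<rat>. s \<le> q \<and> q < t \<and> P q \<omega>"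
  shows "optional_time M F c (debut c P)"
  unfolding optional_time_def
proof (intro conjI ballI allI impI)
  fix t :: real assume "0 < t"
  have eq: "{\<omega>\<in>space M. debut c P \<omega> < t} =
      (if c < t then space M else (\<Union>q\<in>{q\<in>\<rat>. 0 \<le> q \<and> q < t}. {\<omega>\<in>space M. P q \<omega>}))"
    using right by (auto simp: debut_less_iff) (meson order_trans)
  have "(\<Union>q\<in>{q\<in>\<rat>. 0 \<le> q \<and> q < t}. {\<omega>\<in>space M. P q \<omega>}) \<in> sets (F (ennreal t))"
  proof (rule sets.countable_UN'')
    show "countable {q\<in>\<rat>. 0 \<le> q \<and> q < t}" by (rule countable_subset[OF _ countable_rat]) auto
    fix q assume "q \<in> {q\<in>\<rat>. 0 \<le> q \<and> q < t}"
    then show "{\<omega>\<in>space M. P q \<omega>} \<in> sets (F (ennreal t))"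
      by (intro F_sets_mono[OF _ P]) (auto intro!: ennreal_leI)
  qed
  then show "{\<omega>\<in>space M. debut c P \<omega> < t} \<in> sets (F (ennreal t))"
    using eq sets.top[of "F (ennreal t)"] by (auto simp: space_F)
qed (simp_all add: c debut_nonneg debut_le)

section \<open>Brownian motion with local time\<close>

text \<open>All pathwise properties except \<open>occupation\<close> are demanded at every
  \<open>\<omega>\<close>, and the processes are extended to negative times by constants, so that
  continuity is available on the whole line. \<open>regular_version\<close> provides such versions
  of a given Brownian motion and local time.\<close>

locale brownian_local_time_space = usual_conditions M F
  for M :: "'a measure" and F :: "ennreal \<Rightarrow> 'a measure" +
  fixes B :: "real \<Rightarrow> 'a \<Rightarrow> real" and L :: "real \<Rightarrow> real \<Rightarrow> 'a \<Rightarrow> real" and x0 :: real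
  assumes B_adapted: "\<And>t. 0 \<le> t \<Longrightarrow> B t \<in> borel_measurable (F (ennreal t))"
    and B_continuous: "\<And>\<omega>. \<omega> \<in> space M \<Longrightarrow> continuous_on UNIV (\<lambda>t. B t \<omega>)"
    and B_start: "\<And>t \<omega>. t \<le> 0 \<Longrightarrow> B t \<omega> = x0"
    and B_normal: "\<And>s t. 0 \<le> s \<Longrightarrow> s < t \<Longrightarrow>
      distributed M lborel (\<lambda>\<omega>. B t \<omega> - B s \<omega>) (normal_density 0 (sqrt (t - s)))"
    and B_indep: "\<And>s t. 0 \<le> s \<Longrightarrow> s < t \<Longrightarrow> indep_set (sets (F (ennreal s)))
          (sets (vimage_algebra (space M) (\<lambda>\<omega>. B t \<omega> - B s \<omega>) borel))"
    and L_adapted: "\<And>t x. 0 \<le> t \<Longrightarrow> L x t \<in> borel_measurable (F (ennreal t))"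
    and L_continuous: "\<And>\<omega>. \<omega> \<in> space M \<Longrightarrow> continuous_on UNIV (\<lambda>(x, t). L x t \<omega>)"
    and L_nonneg: "\<And>\<omega> x t. \<omega> \<in> space M \<Longrightarrow> 0 \<le> L x t \<omega>"
    and L_start: "\<And>\<omega> x t. t \<le> 0 \<Longrightarrow> L x t \<omega> = 0"
    and L_mono: "\<And>\<omega> x s t. \<omega> \<in> space M \<Longrightarrow> s \<le> t \<Longrightarrow> L x s \<omega> \<le> L x t \<omega>"
    and L_support: "\<And>\<omega> x s t. \<omega> \<in> space M \<Longrightarrow> s \<le> t \<Longrightarrow> \<forall>r\<in>{s..t}. B r \<omega> \<noteq> x \<Longrightarrow> L x s \<omega> = L x t \<omega>"
    and occupation: "AE \<omega> in M. \<forall>t\<ge>0. \<forall>D\<in>sets borel.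
        emeasure lborel {s \<in> {0..t}. B s \<omega> \<in> D} = (\<integral>\<^sup>+x\<in>D. ennreal (L x t \<omega>) \<partial>lborel)"
    and tanaka: "\<And>x. martingale M (\<lambda>t. F (ennreal t)) (\<lambda>t \<omega>. \<bar>B t \<omega> - x\<bar> - L x t \<omega>)"
begin

lemma L_continuous_time: "\<omega> \<in> space M \<Longrightarrow> continuous_on UNIV (\<lambda>t. L x t \<omega>)"
  using continuous_on_compose2[OF L_continuous continuous_on_Pair[OF continuous_on_const continuous_on_id]] by simp

lemma L_continuous_space: "\<omega> \<in> space M \<Longrightarrow> continuous_on UNIV (\<lambda>x. L x t \<omega>)"
  using continuous_on_compose2[OF L_continuous continuous_on_Pair[OF continuous_on_id continuous_on_const]] by simp

lemma B_measurable_le: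
  assumes "r \<le> t" "0 \<le> t" shows "B r \<in> borel_measurable (F (ennreal t))"
proof (cases "0 \<le> r")
  case True then show ?thesis by (intro F_measurable_mono[OF B_adapted]) (auto intro!: ennreal_leI assms)
next
  case False then have "B r = (\<lambda>\<omega>. x0)" using B_start by auto
  then show ?thesis by simp
qed

lemma L_measurable_le:
  assumes "r \<le> t" "0 \<le> t" shows "L x r \<in> borel_measurable (F (ennreal t))"
proof (cases "0 \<le> r")
  case True then show ?thesis by (intro F_measurable_mono[OF L_adapted]) (auto intro!: ennreal_leI assms)
next
  case False then have "L x r = (\<lambda>\<omega>. 0)" using L_start by auto
  then show ?thesis by simp
qed

lemma B_measurable [measurable]: "B r \<in> borel_measurable M"
  using F_measurable_M[OF B_measurable_le[of r "max r 0"]] by simp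

lemma L_measurable [measurable]: "L x r \<in> borel_measurable M"
  using F_measurable_M[OF L_measurable_le[of r "max r 0"]] by simp

lemma B_joint [measurable]: "(\<lambda>(t, \<omega>). B t \<omega>) \<in> borel_measurable (borel \<Otimes>\<^sub>M M)"
  by (rule measurable_continuous_process) (auto intro: B_continuous)

lemma L_joint [measurable]: "(\<lambda>(t, \<omega>). L x t \<omega>) \<in> borel_measurable (borel \<Otimes>\<^sub>M M)"
  by (rule measurable_continuous_process) (auto intro: L_continuous_time)

lemma measurable_B_at [measurable]:
  assumes "\<sigma> \<in> borel_measurable M" shows "(\<lambda>\<omega>. B (\<sigma> \<omega>) \<omega>) \<in> borel_measurable M"
  using measurable_compose[OF measurable_Pair[OF assms measurable_ident] B_joint] by simp

lemma measurable_L_at [measurable]: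
  assumes "\<sigma> \<in> borel_measurable M" shows "(\<lambda>\<omega>. L x (\<sigma> \<omega>) \<omega>) \<in> borel_measurable M"
  using measurable_compose[OF measurable_Pair[OF assms measurable_ident] L_joint] by simp

lemma increment_integral:
  assumes st: "0 \<le> s" "s < t"
  shows "integrable M (\<lambda>\<omega>. B t \<omega> - B s \<omega>)" "(\<integral>\<omega>. B t \<omega> - B s \<omega> \<partial>M) = 0"
proof -
  have pos: "0 < sqrt (t - s)" using st by simp
  note D = B_normal[OF st]
  show "integrable M (\<lambda>\<omega>. B t \<omega> - B s \<omega>)"
    using distributed_integrable[OF D, of "\<lambda>x. x"] integrable_normal_moment_nz_1[OF pos, of 0] by simp
  have "(\<integral>\<omega>. B t \<omega> - B s \<omega> \<partial>M) = (\<integral>x. normal_density 0 (sqrt (t - s)) x * x \<partial>lborel)"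
    using distributed_integral[OF D, of "\<lambda>x. x"] by simp
  also have "\<dots> = 0" using integral_normal_moment_nz_1[OF pos, of 0] by simp
  finally show "(\<integral>\<omega>. B t \<omega> - B s \<omega> \<partial>M) = 0" .
qed

lemma B_integrable: "integrable M (B t)"
proof (cases "0 < t")
  case True
  have "integrable M (\<lambda>\<omega>. (B t \<omega> - B 0 \<omega>) + x0)"
    by (intro Bochner_Integration.integrable_add increment_integral True) auto
  then show ?thesis by (simp add: B_start)
next
  case False then have "B t = (\<lambda>\<omega>. x0)" using B_start by auto
  then show ?thesis by simp
qed

lemma B_martingale: "martingale M (\<lambda>t. F (ennreal t)) B"
  unfolding martingale_def
proof (intro conjI allI impI)
  fix s t :: real assume "0 \<le> s \<and> s \<le> t"
  then have st: "0 \<le> s" "s \<le> t" by auto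
  interpret S: sigma_finite_subalgebra M "F (ennreal s)" by (rule sigma_finite_subalgebra_F)
  show "AE \<omega> in M. real_cond_exp M (F (ennreal s)) (B t) \<omega> = B s \<omega>"
  proof (cases "s = t")
    case True
    then show ?thesis using S.real_cond_exp_F_meas[OF B_integrable B_adapted] st by auto
  next
    case False
    then have st': "s < t" using st by simp
    show ?thesis
    proof (rule S.real_cond_exp_charact)
      fix A assume A: "A \<in> sets (F (ennreal s))"
      note [measurable] = F_sets_M[OF A]
      have iv: "indep_var borel (indicat_real A) borel (\<lambda>\<omega>. B t \<omega> - B s \<omega>)"
        by (rule indep_var_of_indep_set[OF B_indep[OF st(1) st']]) (use A in \<open>auto simp: space_F\<close>)
      have iA: "integrable M (indicat_real A)" by (auto intro!: integrable_real_indicator simp: emeasure_eq_measure)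
      have "(\<integral>\<omega>. indicat_real A \<omega> * (B t \<omega> - B s \<omega>) \<partial>M) = 0"
        using indep_var_lebesgue_integral[OF iv iA] increment_integral[OF st(1) st'] by simp
      moreover have "(\<integral>\<omega>. indicat_real A \<omega> * (B t \<omega> - B s \<omega>) \<partial>M) =
         (\<integral>\<omega>. indicat_real A \<omega> * B t \<omega> \<partial>M) - (\<integral>\<omega>. indicat_real A \<omega> * B s \<omega> \<partial>M)"
      proof -
        have "integrable M (\<lambda>\<omega>. indicat_real A \<omega> * B r \<omega>)" for r
          using integrable_real_mult_indicator[OF _ B_integrable[of r], of A] by (simp add: mult.commute)
        then show ?thesis by (simp add: right_diff_distrib)
      qed
      ultimately show "set_lebesgue_integral M A (B t) = set_lebesgue_integral M A (B s)"
        by (simp add: set_lebesgue_integral_def)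
    qed (use B_integrable B_adapted st in auto)
  qed
qed (use subalg sets_F_mono ennreal_leI B_adapted B_integrable in auto)

lemma L_integrable: "integrable M (L x t)"
proof (cases "0 \<le> t")
  case True
  have N: "integrable M (\<lambda>\<omega>. \<bar>B t \<omega> - x\<bar> - L x t \<omega>)"
    using tanaka[of x] True by (simp add: martingale_def)
  have "integrable M (\<lambda>\<omega>. \<bar>B t \<omega> - x\<bar>)"
    by (simp add: B_integrable)
  from Bochner_Integration.integrable_diff[OF this N]
  have "integrable M (\<lambda>\<omega>. \<bar>B t \<omega> - x\<bar> - (\<bar>B t \<omega> - x\<bar> - L x t \<omega>))" .
  then show ?thesis by simp
next
  case False then have "L x t = (\<lambda>\<omega>. 0)" using L_start by auto
  then show ?thesis by simp
qed

text \<open>Optional stopping applied to \<open>B\<close> and to Tanaka's martingale. The last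
  equation is what converts expected local times into potentials of stopped laws.\<close>

lemma stopped:
  assumes \<sigma>: "optional_time M F c \<sigma>"
  shows "integrable M (\<lambda>\<omega>. B (\<sigma> \<omega>) \<omega>)" "(\<integral>\<omega>. B (\<sigma> \<omega>) \<omega> \<partial>M) = x0"
    "integrable M (\<lambda>\<omega>. L x (\<sigma> \<omega>) \<omega>)"
    "(\<integral>\<omega>. \<bar>B (\<sigma> \<omega>) \<omega> - x\<bar> \<partial>M) = \<bar>x0 - x\<bar> + (\<integral>\<omega>. L x (\<sigma> \<omega>) \<omega> \<partial>M)"
proof -
  have [measurable]: "\<sigma> \<in> borel_measurable M" by (rule optional_time_measurable[OF \<sigma>])
  note OB = optional_stopping[OF B_martingale B_continuous B_measurable \<sigma>]
  show iB: "integrable M (\<lambda>\<omega>. B (\<sigma> \<omega>) \<omega>)" by (rule OB(1))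
  show "(\<integral>\<omega>. B (\<sigma> \<omega>) \<omega> \<partial>M) = x0" using OB(2) by (simp add: B_start prob_space)
  show iL: "integrable M (\<lambda>\<omega>. L x (\<sigma> \<omega>) \<omega>)"
  proof (rule Bochner_Integration.integrable_bound[OF L_integrable[of x c]])
    show "AE \<omega> in M. norm (L x (\<sigma> \<omega>) \<omega>) \<le> norm (L x c \<omega>)"
      using optional_timeD(2)[OF \<sigma>] L_nonneg L_mono by (intro AE_I2) simp
  qed auto
  have "(\<integral>\<omega>. \<bar>B (\<sigma> \<omega>) \<omega> - x\<bar> - L x (\<sigma> \<omega>) \<omega> \<partial>M) = (\<integral>\<omega>. \<bar>B 0 \<omega> - x\<bar> - L x 0 \<omega> \<partial>M)"
    by (rule optional_stopping(2)[OF tanaka _ _ \<sigma>])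
      (auto intro!: continuous_intros B_continuous L_continuous_time)
  also have "\<dots> = \<bar>x0 - x\<bar>" by (simp add: B_start L_start prob_space)
  finally show "(\<integral>\<omega>. \<bar>B (\<sigma> \<omega>) \<omega> - x\<bar> \<partial>M) = \<bar>x0 - x\<bar> + (\<integral>\<omega>. L x (\<sigma> \<omega>) \<omega> \<partial>M)"
    using iB iL by (subst (asm) Bochner_Integration.integral_diff) auto
qed

text \<open>By Tanaka's formula, \<open>\<bar>B - e\<bar>\<close> stopped when the local time at \<open>e\<close> becomes positive is a nonnegative
  martingale, so it stays at \<open>0\<close> once it has got there.\<close>

lemma absorbed_until_local_time_rational:
  fixes e q :: real
  assumes q: "0 \<le> q"
  defines "\<sigma> \<equiv> debut q (\<lambda>t \<omega>. 0 < L e t \<omega>)"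
    and "H \<equiv> \<lambda>n. debut q (\<lambda>t \<omega>. \<bar>B t \<omega> - e\<bar> < 1 / real (Suc n))"
  shows "AE \<omega> in M. (\<forall>n. H n \<omega> < \<sigma> \<omega>) \<longrightarrow> B (\<sigma> \<omega>) \<omega> = e"
proof -
  have opt\<sigma>: "optional_time M F q \<sigma>"
    unfolding \<sigma>_def
  proof (rule optional_time_debut[OF q])
    show "{\<omega> \<in> space M. 0 < L e t \<omega>} \<in> sets (F (ennreal t))" if "0 \<le> t" for t
      using L_adapted[OF that, of e] unfolding borel_measurable_iff_greater by (simp add: space_F)
    fix \<omega> and s t :: real assume "\<omega> \<in> space M" "0 \<le> s" "s < t" "0 < L e s \<omega>"
    then show "\<exists>q\<in>\<rat>. s \<le> q \<and> q < t \<and> 0 < L e q \<omega>"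
      using Rats_dense_in_real[of s t] L_mono[of \<omega> s _ e] by (meson less_imp_le less_le_trans)
  qed
  have optH: "optional_time M F q (H n)" for n
    unfolding H_def
  proof (rule optional_time_debut[OF q])
    show "{\<omega> \<in> space M. \<bar>B t \<omega> - e\<bar> < 1 / real (Suc n)} \<in> sets (F (ennreal t))" if "0 \<le> t" for t
    proof -
      have [measurable]: "B t \<in> borel_measurable (F (ennreal t))" by (rule B_adapted[OF that])
      have "{\<omega> \<in> space (F (ennreal t)). \<bar>B t \<omega> - e\<bar> < 1 / real (Suc n)} \<in> sets (F (ennreal t))" by measurable
      then show ?thesis by (simp add: space_F)
    qed
    fix \<omega> and s t :: real assume *: "\<omega> \<in> space M" "0 \<le> s" "s < t" "\<bar>B s \<omega> - e\<bar> < 1 / real (Suc n)"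
    have "((\<lambda>t. \<bar>B t \<omega> - e\<bar>) \<longlongrightarrow> \<bar>B s \<omega> - e\<bar>) (at_right s)"
      using B_continuous[OF *(1)] by (intro tendsto_intros) (auto simp: continuous_on_def intro: tendsto_within_subset)
    then have "eventually (\<lambda>t. \<bar>B t \<omega> - e\<bar> < 1 / real (Suc n)) (at_right s)"
      using *(4) by (rule order_tendstoD)
    then obtain b where b: "s < b" "\<And>y. s < y \<Longrightarrow> y < b \<Longrightarrow> \<bar>B y \<omega> - e\<bar> < 1 / real (Suc n)"
      by (auto simp: eventually_at_right_field)
    obtain r where "r \<in> \<rat>" "s < r" "r < min b t" using Rats_dense_in_real[of s "min b t"] b(1) *(3) by auto
    then show "\<exists>q\<in>\<rat>. s \<le> q \<and> q < t \<and> \<bar>B q \<omega> - e\<bar> < 1 / real (Suc n)"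
      using b(2) by (intro bexI[of _ r]) auto
  qed
  have [measurable]: "\<sigma> \<in> borel_measurable M" "H n \<in> borel_measurable M" for n
    using optional_time_measurable opt\<sigma> optH by auto
  \<comment> \<open>No local time accumulates strictly before \<open>\<sigma>\<close>, and by
    continuity none at \<open>\<sigma>\<close> either; so the expectations of
    \<open>\<bar>B - e\<bar>\<close> at \<open>\<sigma>\<close> and at \<open>\<rho> n\<close> are
    both \<open>\<bar>x0 - e\<bar>\<close>.\<close>
  have L\<sigma>: "L e t \<omega> = 0" if "\<omega> \<in> space M" "t \<le> \<sigma> \<omega>" for t \<omega>
  proof -
    have "L e (\<sigma> \<omega>) \<omega> = 0"
    proof (cases "\<sigma> \<omega> = 0")
      case False
      then have pos: "0 < \<sigma> \<omega>" using optional_timeD(1)[OF opt\<sigma> that(1)] by simp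
      have "((\<lambda>t. L e t \<omega>) \<longlongrightarrow> L e (\<sigma> \<omega>) \<omega>) (at_left (\<sigma> \<omega>))"
        using L_continuous_time[OF that(1)] by (auto simp: continuous_on_def intro: tendsto_within_subset)
      moreover have "eventually (\<lambda>t. L e t \<omega> \<le> 0) (at_left (\<sigma> \<omega>))"
      proof (rule eventually_at_leftI[OF _ pos])
        fix t assume "t \<in> {0<..<\<sigma> \<omega>}"
        then show "L e t \<omega> \<le> 0" using not_before_debut[of t q "\<lambda>t \<omega>. 0 < L e t \<omega>" \<omega>] by (auto simp: \<sigma>_def)
      qed
      ultimately have "L e (\<sigma> \<omega>) \<omega> \<le> 0" by (intro tendsto_upperbound) auto
      then show ?thesis using L_nonneg[OF that(1), of e "\<sigma> \<omega>"] by simp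
    qed (simp add: L_start)
    then show ?thesis using L_mono[OF that, of e] L_nonneg[OF that(1), of e t] by simp
  qed
  define \<rho> where "\<rho> n \<omega> = min (\<sigma> \<omega>) (H n \<omega>)" for n \<omega>
  have opt\<rho>: "optional_time M F q (\<rho> n)" for n
    unfolding \<rho>_def by (rule optional_time_min[OF opt\<sigma> optH])
  have [measurable]: "\<rho> n \<in> borel_measurable M" for n by (rule optional_time_measurable[OF opt\<rho>])
  have E\<sigma>: "(\<integral>\<omega>. \<bar>B (\<sigma> \<omega>) \<omega> - e\<bar> \<partial>M) = \<bar>x0 - e\<bar>"
  proof -
    have "(\<integral>\<omega>. L e (\<sigma> \<omega>) \<omega> \<partial>M) = (\<integral>\<omega>. 0 \<partial>M)"
      by (rule Bochner_Integration.integral_cong) (auto simp: L\<sigma>)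
    then show ?thesis using stopped(4)[OF opt\<sigma>, of e] by simp
  qed
  have E\<rho>: "(\<integral>\<omega>. \<bar>B (\<rho> n \<omega>) \<omega> - e\<bar> \<partial>M) = \<bar>x0 - e\<bar>" for n
  proof -
    have "(\<integral>\<omega>. L e (\<rho> n \<omega>) \<omega> \<partial>M) = (\<integral>\<omega>. 0 \<partial>M)"
      by (rule Bochner_Integration.integral_cong) (auto simp: L\<sigma> \<rho>_def)
    then show ?thesis using stopped(4)[OF opt\<rho>, of n e] by simp
  qed
  define A where "A = {\<omega>\<in>space M. \<forall>n. H n \<omega> < \<sigma> \<omega>}"
  have A[measurable]: "A \<in> sets M" unfolding A_def by measurable
  have i\<sigma>: "integrable M (\<lambda>\<omega>. \<bar>B (\<sigma> \<omega>) \<omega> - e\<bar>)" using stopped(1)[OF opt\<sigma>] by simp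
  have i\<rho>: "integrable M (\<lambda>\<omega>. \<bar>B (\<rho> n \<omega>) \<omega> - e\<bar>)" for n using stopped(1)[OF opt\<rho>] by simp
  \<comment> \<open>For \<open>H n \<omega> < q\<close> the infimum comes from visits of the path to
    the neighbourhood of \<open>e\<close> and not from the cap \<open>q\<close>.\<close>
  have near: "\<bar>B (H n \<omega>) \<omega> - e\<bar> \<le> 1 / real (Suc n)" if "\<omega> \<in> space M" "H n \<omega> < q" for n \<omega>
  proof (rule ccontr)
    assume "\<not> ?thesis"
    then have gt: "1 / real (Suc n) < \<bar>B (H n \<omega>) \<omega> - e\<bar>" by simp
    have "((\<lambda>t. \<bar>B t \<omega> - e\<bar>) \<longlongrightarrow> \<bar>B (H n \<omega>) \<omega> - e\<bar>) (at_right (H n \<omega>))"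
      using B_continuous[OF that(1)] by (intro tendsto_intros) (auto simp: continuous_on_def intro: tendsto_within_subset)
    then have "eventually (\<lambda>t. 1 / real (Suc n) < \<bar>B t \<omega> - e\<bar>) (at_right (H n \<omega>))"
      using gt by (rule order_tendstoD)
    then obtain b where b: "H n \<omega> < b" "\<And>y. H n \<omega> < y \<Longrightarrow> y < b \<Longrightarrow> 1 / real (Suc n) < \<bar>B y \<omega> - e\<bar>"
      by (auto simp: eventually_at_right_field)
    have "H n \<omega> < min b q" using b(1) that(2) by simp
    then obtain r where r: "0 \<le> r" "\<bar>B r \<omega> - e\<bar> < 1 / real (Suc n)" "r < min b q"
      unfolding H_def debut_less_iff by auto
    have "H n \<omega> \<le> r" unfolding H_def using r by (intro debut_le_at) auto
    then show False using b(2)[of r] r gt by (cases "r = H n \<omega>") auto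
  qed
  \<comment> \<open>Off the event \<open>H n < \<sigma>\<close> the times \<open>\<sigma>\<close>
    and \<open>\<rho> n\<close> coincide. Hence the equality of the two expectations passes to this
    event, on which \<open>\<rho> n = H n\<close> and the distance from \<open>e\<close> is at most
    \<open>1 / Suc n\<close>.\<close>
  have bound: "(\<integral>\<omega>. \<bar>B (\<sigma> \<omega>) \<omega> - e\<bar> * indicator A \<omega> \<partial>M) \<le> 1 / real (Suc n)" for n
  proof -
    have "(\<integral>\<omega>. \<bar>B (\<sigma> \<omega>) \<omega> - e\<bar> * indicator A \<omega> \<partial>M) =
      (\<integral>\<omega>. \<bar>B (\<sigma> \<omega>) \<omega> - e\<bar> * indicator {\<omega>\<in>space M. H n \<omega> < \<sigma> \<omega>} \<omega> * indicator A \<omega> \<partial>M)"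
      by (intro Bochner_Integration.integral_cong) (auto simp: A_def indicator_def)
    also have "\<dots> \<le> (\<integral>\<omega>. \<bar>B (\<sigma> \<omega>) \<omega> - e\<bar> * indicator {\<omega>\<in>space M. H n \<omega> < \<sigma> \<omega>} \<omega> \<partial>M)"
      by (intro integral_mono integrable_real_mult_indicator i\<sigma>) (auto simp: indicator_def)
    also have "\<dots> = (\<integral>\<omega>. (\<bar>B (\<sigma> \<omega>) \<omega> - e\<bar> - \<bar>B (\<rho> n \<omega>) \<omega> - e\<bar>) + \<bar>B (\<rho> n \<omega>) \<omega> - e\<bar> * indicator {\<omega>\<in>space M. H n \<omega> < \<sigma> \<omega>} \<omega> \<partial>M)"
      by (intro Bochner_Integration.integral_cong) (auto simp: indicator_def \<rho>_def)
    also have "\<dots> = (\<integral>\<omega>. \<bar>B (\<rho> n \<omega>) \<omega> - e\<bar> * indicator {\<omega>\<in>space M. H n \<omega> < \<sigma> \<omega>} \<omega> \<partial>M)"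
    proof -
      have i: "integrable M (\<lambda>\<omega>. \<bar>B (\<rho> n \<omega>) \<omega> - e\<bar> * indicator {\<omega>\<in>space M. H n \<omega> < \<sigma> \<omega>} \<omega>)"
        by (intro integrable_real_mult_indicator i\<rho>) auto
      have "(\<integral>\<omega>. (\<bar>B (\<sigma> \<omega>) \<omega> - e\<bar> - \<bar>B (\<rho> n \<omega>) \<omega> - e\<bar>) + \<bar>B (\<rho> n \<omega>) \<omega> - e\<bar> * indicator {\<omega>\<in>space M. H n \<omega> < \<sigma> \<omega>} \<omega> \<partial>M)
        = ((\<integral>\<omega>. \<bar>B (\<sigma> \<omega>) \<omega> - e\<bar> \<partial>M) - (\<integral>\<omega>. \<bar>B (\<rho> n \<omega>) \<omega> - e\<bar> \<partial>M)) + (\<integral>\<omega>. \<bar>B (\<rho> n \<omega>) \<omega> - e\<bar> * indicator {\<omega>\<in>space M. H n \<omega> < \<sigma> \<omega>} \<omega> \<partial>M)"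
        using i i\<sigma> i\<rho>[of n] by (subst Bochner_Integration.integral_add) (auto intro!: Bochner_Integration.integrable_diff)
      then show ?thesis using E\<sigma> E\<rho> by simp
    qed
    also have "\<dots> \<le> (\<integral>\<omega>. 1 / real (Suc n) \<partial>M)"
    proof (rule integral_mono)
      fix \<omega> assume w: "\<omega> \<in> space M"
      have "\<sigma> \<omega> \<le> q" using optional_timeD(2)[OF opt\<sigma> w] .
      then show "\<bar>B (\<rho> n \<omega>) \<omega> - e\<bar> * indicator {\<omega>\<in>space M. H n \<omega> < \<sigma> \<omega>} \<omega> \<le> 1 / real (Suc n)"
        using near[OF w, of n] by (auto simp: indicator_def \<rho>_def simp del: of_nat_Suc)
    qed (auto intro!: integrable_real_mult_indicator i\<rho>)
    finally show ?thesis by (simp add: prob_space)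
  qed
  have "(\<integral>\<omega>. \<bar>B (\<sigma> \<omega>) \<omega> - e\<bar> * indicator A \<omega> \<partial>M) \<le> 0"
    using bound LIMSEQ_Suc[OF lim_1_over_n] by (intro tendsto_lowerbound[where F=sequentially]) auto
  moreover have "0 \<le> (\<integral>\<omega>. \<bar>B (\<sigma> \<omega>) \<omega> - e\<bar> * indicator A \<omega> \<partial>M)" by (intro integral_nonneg_AE) auto
  ultimately have "(\<integral>\<omega>. \<bar>B (\<sigma> \<omega>) \<omega> - e\<bar> * indicator A \<omega> \<partial>M) = 0" by simp
  then have "AE \<omega> in M. \<bar>B (\<sigma> \<omega>) \<omega> - e\<bar> * indicator A \<omega> = 0"
    using integrable_real_mult_indicator[OF A i\<sigma>] by (subst (asm) integral_nonneg_eq_0_iff_AE) auto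
  then show ?thesis using AE_space
    by eventually_elim (auto simp: A_def indicator_def split: if_splits)
qed

text \<open>With rational horizons only countably many null sets occur. If \<open>B r = e\<close>,
  every \<open>H q n\<close> is at most \<open>r\<close>, and for rational \<open>q\<close> between
  \<open>r\<close> and \<open>s\<close> the time \<open>\<sigma> q\<close> equals \<open>q\<close>;
  so \<open>B q = e\<close> for all of these, and continuity reaches \<open>s\<close>.\<close>

lemma absorbed_until_local_time:
  "AE \<omega> in M. \<forall>s r. 0 \<le> r \<longrightarrow> r \<le> s \<longrightarrow> (\<forall>q\<in>{0..<s}. L e q \<omega> = 0) \<longrightarrow> B r \<omega> = e \<longrightarrow> B s \<omega> = e"
proof -
  define \<sigma> where "\<sigma> q = debut q (\<lambda>t \<omega>. 0 < L e t \<omega>)" for q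
  define H where "H q n = debut q (\<lambda>t \<omega>. \<bar>B t \<omega> - e\<bar> < 1 / real (Suc n))" for q n
  have "AE \<omega> in M. \<forall>q\<in>{q\<in>\<rat>. 0 \<le> q}. (\<forall>n. H q n \<omega> < \<sigma> q \<omega>) \<longrightarrow> B (\<sigma> q \<omega>) \<omega> = e"
  proof (rule AE_ball_countable')
    show "countable {q \<in> \<rat>. 0 \<le> (q::real)}" by (rule countable_subset[OF _ countable_rat]) auto
  qed (auto simp: \<sigma>_def H_def intro!: absorbed_until_local_time_rational[simplified])
  then show ?thesis using AE_space
  proof eventually_elim
    case (elim \<omega>)
    show ?case
    proof (intro allI impI)
      fix s r assume rs: "0 \<le> r" "r \<le> s" and L0: "\<forall>q\<in>{0..<s}. L e q \<omega> = 0" and Br: "B r \<omega> = e"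
      have Bq: "B q \<omega> = e" if q: "q \<in> \<rat>" "r < q" "q < s" for q
      proof -
        have \<sigma>: "\<sigma> q \<omega> = q"
        proof (rule antisym)
          show "\<sigma> q \<omega> \<le> q" unfolding \<sigma>_def by (rule debut_le)
          have "\<not> \<sigma> q \<omega> < q"
            unfolding \<sigma>_def debut_less_iff using L0 q by auto
          then show "q \<le> \<sigma> q \<omega>" by simp
        qed
        have "H q n \<omega> \<le> r" for n
          unfolding H_def using rs(1) Br by (intro debut_le_at) auto
        then have "\<forall>n. H q n \<omega> < \<sigma> q \<omega>" using q(2) \<sigma> by (metis le_less_trans)
        then show ?thesis using elim(1) q rs(1) \<sigma> by auto
      qed
      show "B s \<omega> = e"
      proof (cases "r = s")
        case False
        then have "r < s" using rs by simp
        show ?thesis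
        proof (rule ccontr)
          assume ne: "B s \<omega> \<noteq> e"
          have "((\<lambda>t. B t \<omega>) \<longlongrightarrow> B s \<omega>) (at_left s)"
            using B_continuous[OF elim(2)] by (auto simp: continuous_on_def intro: tendsto_within_subset)
          then have "eventually (\<lambda>t. B t \<omega> \<noteq> e) (at_left s)" by (rule tendsto_imp_eventually_ne[OF _ ne])
          then obtain b where b: "b < s" "\<And>y. b < y \<Longrightarrow> y < s \<Longrightarrow> B y \<omega> \<noteq> e"
            by (auto simp: eventually_at_left_field)
          obtain q where "q \<in> \<rat>" "max b r < q" "q < s"
            using Rats_dense_in_real[of "max b r" s] b(1) \<open>r < s\<close> by auto
          then show False using b(2)[of q] Bq[of q] by auto
        qed
      qed (use Br in simp)
    qed
  qed
qed

section \<open>Independence of the path of \<open>B\<close> and \<open>F 0\<close>\<close>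

definition path_sigma :: "real set \<Rightarrow> 'a measure" where
  "path_sigma J = sigma (space M) {B t -` D \<inter> space M | t D. t \<in> J \<and> D \<in> sets borel}"

lemma space_path_sigma [simp]: "space (path_sigma J) = space M"
  by (simp add: path_sigma_def space_measure_of_conv)

lemma sets_path_sigma: "sets (path_sigma J) = sigma_sets (space M) {B t -` D \<inter> space M | t D. t \<in> J \<and> D \<in> sets borel}"
  unfolding path_sigma_def by (rule sets_measure_of) auto

lemma path_sigma_mono: "J \<subseteq> K \<Longrightarrow> sets (path_sigma J) \<subseteq> sets (path_sigma K)"
  unfolding sets_path_sigma by (rule sigma_sets_mono') auto

lemma measurable_path_sigma: "t \<in> J \<Longrightarrow> B t \<in> borel_measurable (path_sigma J)"
proof (rule measurableI)
  fix D :: "real set" assume "t \<in> J" "D \<in> sets borel"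
  then show "B t -` D \<inter> space (path_sigma J) \<in> sets (path_sigma J)"
    unfolding sets_path_sigma by (intro sigma_sets.Basic) auto
qed auto

lemma sets_path_sigma_F:
  assumes "\<And>t. t \<in> J \<Longrightarrow> t \<le> a" "0 \<le> a"
  shows "sets (path_sigma J) \<subseteq> sets (F (ennreal a))"
  unfolding sets_path_sigma
proof -
  have "sigma_sets (space (F (ennreal a))) {B t -` D \<inter> space M | t D. t \<in> J \<and> D \<in> sets borel} \<subseteq> sets (F (ennreal a))"
    using measurable_sets[OF B_measurable_le[OF assms(1) assms(2)]]
    by (intro sets.sigma_sets_subset) (auto simp: space_F)
  then show "sigma_sets (space M) {B t -` D \<inter> space M | t D. t \<in> J \<and> D \<in> sets borel} \<subseteq> sets (F (ennreal a))"
    by (simp add: space_F)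
qed

text \<open>Induction on the largest time \<open>b\<close>. The increment from the previous time
  \<open>a\<close> to \<open>b\<close> is independent of \<open>F a\<close>, which contains both
  \<open>F 0\<close> and the path on \<open>A\<close>; so the increment splits off first, and the
  induction hypothesis separates the rest. Time 0 serves as previous time when \<open>A\<close> is
  empty.\<close>

lemma indep_path_sigma_finite:
  assumes "finite J" "\<And>t. t \<in> J \<Longrightarrow> 0 \<le> t"
  shows "indep_set (sets (F 0)) (sets (path_sigma J))"
  using assms
proof (induction J rule: finite_linorder_max_induct)
  case empty
  have "indep_set (sigma_sets (space M) (sets (F 0))) (sigma_sets (space M) {})"
    by (rule indep_set_sigma_sets) (auto simp: indep_sets2_eq F_sets_M Int_stable_def)
  then show ?case
    using sets.sigma_sets_eq[of "F 0"] by (simp add: sets_path_sigma space_F)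
next
  case (insert b A)
  define a where "a = Max (insert 0 A)"
  have a: "a \<in> insert 0 A" "0 \<le> a" "\<And>t. t \<in> A \<Longrightarrow> t \<le> a"
    using insert.hyps(1) Max_in[of "insert 0 A"] by (auto simp: a_def)
  have IH: "indep_set (sets (F 0)) (sets (path_sigma A))" using insert by auto
  have AF: "sets (path_sigma A) \<subseteq> sets (F (ennreal a))" using a by (intro sets_path_sigma_F) auto
  have B0: "B 0 = (\<lambda>\<omega>. x0)" using B_start by auto
  have Ba: "B a \<in> borel_measurable (path_sigma A)"
    using a(1) measurable_path_sigma[of a A] B0 by auto
  show ?case
  proof (cases "a < b")
    case False
    \<comment> \<open>Time 0 adds no information, as \<open>B 0\<close> is the constant
      \<open>x0\<close>.\<close>
    then have "b = 0" using insert.prems[of b] insert.hyps(2) a by fastforce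
    then have "sets (path_sigma (insert b A)) \<subseteq> sets (path_sigma A)"
    proof -
      have "sigma_sets (space (path_sigma A)) {B t -` D \<inter> space M | t D. t \<in> insert b A \<and> D \<in> sets borel} \<subseteq> sets (path_sigma A)"
      proof (intro sets.sigma_sets_subset subsetI)
        fix X assume "X \<in> {B t -` D \<inter> space M | t D. t \<in> insert b A \<and> D \<in> sets borel}"
        then obtain t D where X: "X = B t -` D \<inter> space M" "t \<in> insert b A" "D \<in> sets borel" by auto
        have "B t \<in> borel_measurable (path_sigma A)"
          using X(2) \<open>b = 0\<close> B0 measurable_path_sigma[of t A] by auto
        from measurable_sets[OF this X(3)] show "X \<in> sets (path_sigma A)" by (simp add: X(1))
      qed
      then show ?thesis by (simp add: sets_path_sigma)
    qed
    then show ?thesis using IH unfolding indep_sets2_eq by blast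
  next
    case True
    let ?d = "\<lambda>\<omega>. B b \<omega> - B a \<omega>"
    \<comment> \<open>An intersection-stable family. The \<sigma>-algebra that it generates contains
      the path on \<open>A\<close> and the increment, and makes \<open>B b\<close> measurable as
      \<open>B a\<close> plus the increment.\<close>
    let ?P = "{D \<inter> (?d -` E \<inter> space M) | D E. D \<in> sets (path_sigma A) \<and> E \<in> sets borel}"
    note ind = B_indep[OF a(2) True]
    have dE: "?d -` E \<inter> space M \<in> sets (vimage_algebra (space M) ?d borel)" if "E \<in> sets borel" for E
      using that by (auto simp: sets_vimage_algebra2)
    have D_M: "D \<in> sets M" if "D \<in> sets (path_sigma A)" for D using AF that F_sets_M by auto
    have "indep_set (sets (F 0)) ?P"
      unfolding indep_sets2_eq
    proof (intro conjI ballI)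
      show "sets (F 0) \<subseteq> events" using F_sets_M by auto
      show "?P \<subseteq> events"
      proof
        fix X assume "X \<in> ?P"
        then obtain D E where X: "X = D \<inter> (?d -` E \<inter> space M)" and D: "D \<in> sets (path_sigma A)" and E: "E \<in> sets borel"
          by blast
        have "?d \<in> borel_measurable M" by measurable
        from measurable_sets[OF this E] show "X \<in> events" using D_M[OF D] X by simp
      qed
      fix C X assume C: "C \<in> sets (F 0)" and "X \<in> ?P"
      then obtain D E where X: "X = D \<inter> (?d -` E \<inter> space M)" and D: "D \<in> sets (path_sigma A)" and E: "E \<in> sets borel"
        by auto
      have "C \<in> sets (F (ennreal a))" by (rule F_sets_mono[OF _ C]) simp
      then have CD: "C \<inter> D \<in> sets (F (ennreal a))" using AF D by auto
      have D': "D \<in> sets (F (ennreal a))" using AF D by auto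
      have "prob (C \<inter> X) = prob ((C \<inter> D) \<inter> (?d -` E \<inter> space M))" by (simp add: X Int_assoc)
      also have "\<dots> = prob (C \<inter> D) * prob (?d -` E \<inter> space M)" by (rule indep_setD[OF ind CD dE[OF E]])
      also have "prob (C \<inter> D) = prob C * prob D" by (rule indep_setD[OF IH C D])
      also have "prob C * prob D * prob (?d -` E \<inter> space M) = prob C * prob X"
        using indep_setD[OF ind D' dE[OF E]] by (simp add: X)
      finally show "prob (C \<inter> X) = prob C * prob X" .
    qed
    moreover have "Int_stable ?P"
    proof (rule Int_stableI)
      fix X Y assume "X \<in> ?P" "Y \<in> ?P"
      then obtain D E D' E' where *: "X = D \<inter> (?d -` E \<inter> space M)" "D \<in> sets (path_sigma A)" "E \<in> sets borel"
        "Y = D' \<inter> (?d -` E' \<inter> space M)" "D' \<in> sets (path_sigma A)" "E' \<in> sets borel" by auto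
      then have "X \<inter> Y = (D \<inter> D') \<inter> (?d -` (E \<inter> E') \<inter> space M)" by auto
      moreover have "D \<inter> D' \<in> sets (path_sigma A)" "E \<inter> E' \<in> sets borel" using * by auto
      ultimately show "X \<inter> Y \<in> ?P" by blast
    qed
    ultimately have "indep_set (sigma_sets (space M) (sets (F 0))) (sigma_sets (space M) ?P)"
      by (intro indep_set_sigma_sets) (auto simp: Int_stable_def)
    then have ind': "indep_set (sets (F 0)) (sigma_sets (space M) ?P)"
      using sets.sigma_sets_eq[of "F 0"] by (simp add: space_F)
    have PM: "?P \<subseteq> Pow (space M)" by auto
    have P_I: "D \<inter> (?d -` E \<inter> space M) \<in> ?P" if "D \<in> sets (path_sigma A)" "E \<in> sets borel" for D E
      unfolding mem_Collect_eq by (rule exI[of _ D], rule exI[of _ E]) (simp add: that)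
    let ?N = "sigma (space M) ?P"
    have sN: "sets ?N = sigma_sets (space M) ?P" by (rule sets_measure_of[OF PM])
    have spN: "space ?N = space M" by (rule space_measure_of[OF PM])
    have A_sub: "sets (path_sigma A) \<subseteq> sets ?N"
    proof
      fix D assume D: "D \<in> sets (path_sigma A)"
      have "D \<subseteq> space M" using sets.sets_into_space[OF D] by simp
      then have eq: "D = D \<inter> (?d -` UNIV \<inter> space M)" by auto
      have "D \<in> ?P" by (subst eq, rule P_I[OF D]) simp
      then show "D \<in> sets ?N" unfolding sN by (rule sigma_sets.Basic)
    qed
    have d_meas: "?d \<in> borel_measurable ?N"
    proof (rule measurableI)
      fix E :: "real set" assume E: "E \<in> sets borel"
      have sp: "space M \<in> sets (path_sigma A)" using sets.top[of "path_sigma A"] by simp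
      have eq: "?d -` E \<inter> space M = space M \<inter> (?d -` E \<inter> space M)" by auto
      have "?d -` E \<inter> space M \<in> ?P" by (subst eq, rule P_I[OF sp E])
      then show "?d -` E \<inter> space ?N \<in> sets ?N" unfolding sN spN by (rule sigma_sets.Basic)
    qed simp
    have A_meas: "f \<in> borel_measurable ?N" if "f \<in> borel_measurable (path_sigma A)" for f :: "'a \<Rightarrow> real"
      using that A_sub spN unfolding measurable_def by auto
    have "(\<lambda>\<omega>. B a \<omega> + ?d \<omega>) \<in> borel_measurable ?N"
      by (intro borel_measurable_add A_meas Ba d_meas)
    then have b_meas: "B b \<in> borel_measurable ?N" by simp
    have "sigma_sets (space ?N) {B t -` D \<inter> space M | t D. t \<in> insert b A \<and> D \<in> sets borel} \<subseteq> sets ?N"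
    proof (intro sets.sigma_sets_subset subsetI)
      fix X assume "X \<in> {B t -` D \<inter> space M | t D. t \<in> insert b A \<and> D \<in> sets borel}"
      then obtain t D where X: "X = B t -` D \<inter> space M" "t \<in> insert b A" "D \<in> sets borel" by auto
      have "B t \<in> borel_measurable ?N"
        using X(2) b_meas A_meas[OF measurable_path_sigma[of t A]] by auto
      from measurable_sets[OF this X(3)] show "X \<in> sets ?N" by (simp add: X(1) spN)
    qed
    then have "sets (path_sigma (insert b A)) \<subseteq> sigma_sets (space M) ?P"
      unfolding sets_path_sigma[of "insert b A"] by (simp only: spN sN)
    then show ?thesis using ind' unfolding indep_sets2_eq by (meson subsetD subset_trans)
  qed
qed

text \<open>Events that depend on finitely many times are stable under intersection, as two finite
  sets of times have a finite union, and they generate the path.\<close>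

lemma indep_path_sigma: "indep_set (sets (F 0)) (sets (path_sigma {0..}))"
proof -
  let ?P = "\<Union>J\<in>{J. finite J \<and> J \<subseteq> {0..}}. sets (path_sigma J)"
  have "indep_set (sets (F 0)) ?P"
    using indep_path_sigma_finite unfolding indep_sets2_eq by blast
  moreover have "Int_stable ?P"
  proof (rule Int_stableI)
    fix X Y assume "X \<in> ?P" "Y \<in> ?P"
    then obtain J K where *: "finite J" "J \<subseteq> {0..}" "X \<in> sets (path_sigma J)" "finite K" "K \<subseteq> {0..}" "Y \<in> sets (path_sigma K)"
      by auto
    then have "X \<in> sets (path_sigma (J \<union> K))" "Y \<in> sets (path_sigma (J \<union> K))"
      using path_sigma_mono[of J "J \<union> K"] path_sigma_mono[of K "J \<union> K"] by auto
    then have "X \<inter> Y \<in> sets (path_sigma (J \<union> K))" by auto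
    then show "X \<inter> Y \<in> ?P" using * by blast
  qed
  ultimately have "indep_set (sigma_sets (space M) (sets (F 0))) (sigma_sets (space M) ?P)"
    by (intro indep_set_sigma_sets) (auto simp: Int_stable_def)
  then have *: "indep_set (sets (F 0)) (sigma_sets (space M) ?P)"
    using sets.sigma_sets_eq[of "F 0"] by (simp add: space_F)
  have "sets (path_sigma {0..}) \<subseteq> sigma_sets (space M) ?P"
    unfolding sets_path_sigma[of "{0..}"]
  proof (rule sigma_sets_mono, rule subsetI)
    fix X assume "X \<in> {B t -` D \<inter> space M | t D. t \<in> {0..} \<and> D \<in> sets borel}"
    then obtain t D where X: "X = B t -` D \<inter> space M" "t \<in> {0..}" "D \<in> sets borel" by blast
    then have "X \<in> sets (path_sigma {t})"
      using measurable_sets[OF measurable_path_sigma[of t "{t}"], of D] by simp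
    then show "X \<in> sigma_sets (space M) ?P"
      using X(2) by (intro sigma_sets.Basic) auto
  qed
  then show ?thesis using * unfolding indep_sets2_eq by blast
qed

end

lemma emeasure_lborel_below:
  fixes a :: ennreal
  shows "emeasure lborel {r::real. 0 \<le> r \<and> ennreal r < a} = a"
proof (cases a)
  case (real b)
  have "{r::real. 0 \<le> r \<and> ennreal r < a} = {0..<b}"
    using real by (auto simp: ennreal_less_iff)
  then show ?thesis using real by simp
next
  case top
  have "emeasure lborel {0::real..} = \<infinity>"
  proof (rule ccontr)
    assume "emeasure lborel {0::real..} \<noteq> \<infinity>"
    then obtain c where c: "emeasure lborel {0::real..} = ennreal c" "0 \<le> c" by (cases "emeasure lborel {0::real..}") auto
    have "emeasure lborel {0..c + 1} \<le> emeasure lborel {0::real..}" by (rule emeasure_mono) auto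
    then show False using c by (simp add: ennreal_le_iff)
  qed
  moreover have "{r::real. 0 \<le> r \<and> ennreal r < a} = {0..}" using top by auto
  ultimately show ?thesis using top by simp
qed

text \<open>Both sides are the integral over \<open>r < a\<close> of \<open>P(T > r)\<close>, which is also the density of \<open>T\<close> at \<open>r\<close>.\<close>

lemma (in prob_space) exponential_min:
  fixes a :: ennreal
  assumes D: "distributed M lborel T (exponential_density 1)"
  shows "(\<integral>\<^sup>+\<omega>. min (ennreal (T \<omega>)) a \<partial>M) = (\<integral>\<^sup>+\<omega>. indicator {\<omega>. ennreal (T \<omega>) < a} \<omega> \<partial>M)"
proof -
  have T[measurable]: "T \<in> borel_measurable M" using D by (simp add: distributed_def)
  interpret pair_sigma_finite M "lborel :: real measure" ..
  have "(\<integral>\<^sup>+\<omega>. min (ennreal (T \<omega>)) a \<partial>M)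
      = (\<integral>\<^sup>+\<omega>. (\<integral>\<^sup>+r. indicator {r. 0 \<le> r \<and> r < T \<omega> \<and> ennreal r < a} r \<partial>lborel) \<partial>M)"
  proof (rule nn_integral_cong)
    fix \<omega>
    have "{r. 0 \<le> r \<and> r < T \<omega> \<and> ennreal r < a} = {r. 0 \<le> r \<and> ennreal r < min (ennreal (T \<omega>)) a}"
      by (auto simp: ennreal_less_iff)
    then have "min (ennreal (T \<omega>)) a = emeasure lborel {r. 0 \<le> r \<and> r < T \<omega> \<and> ennreal r < a}"
      using emeasure_lborel_below[of "min (ennreal (T \<omega>)) a"] by (simp only:)
    then show "min (ennreal (T \<omega>)) a = (\<integral>\<^sup>+r. indicator {r. 0 \<le> r \<and> r < T \<omega> \<and> ennreal r < a} r \<partial>lborel)"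
      by simp
  qed
  also have "\<dots> = (\<integral>\<^sup>+r. (\<integral>\<^sup>+\<omega>. indicator {r. 0 \<le> r \<and> r < T \<omega> \<and> ennreal r < a} r \<partial>M) \<partial>lborel)"
    by (rule Fubini'[symmetric]) measurable
  also have "\<dots> = (\<integral>\<^sup>+r. ennreal (exponential_density 1 r) * indicator {r. ennreal r < a} r \<partial>lborel)"
  proof (rule nn_integral_cong)
    fix r :: real
    show "(\<integral>\<^sup>+\<omega>. indicator {r. 0 \<le> r \<and> r < T \<omega> \<and> ennreal r < a} r \<partial>M)
        = ennreal (exponential_density 1 r) * indicator {r. ennreal r < a} r"
    proof (cases "0 \<le> r")
      case True
      have "(\<integral>\<^sup>+\<omega>. indicator {r. 0 \<le> r \<and> r < T \<omega> \<and> ennreal r < a} r \<partial>M)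
          = (\<integral>\<^sup>+\<omega>. indicator {\<omega>\<in>space M. r < T \<omega>} \<omega> * indicator {r. ennreal r < a} r \<partial>M)"
        using True by (intro nn_integral_cong) (auto simp: indicator_def)
      also have "\<dots> = emeasure M {\<omega>\<in>space M. r < T \<omega>} * indicator {r. ennreal r < a} r"
        by (subst nn_integral_multc) auto
      also have "emeasure M {\<omega>\<in>space M. r < T \<omega>} = ennreal (exponential_density 1 r)"
        using exponential_distributedD_gt[OF D True] True by (simp add: emeasure_eq_measure exponential_density_def)
      finally show ?thesis .
    qed (simp add: exponential_density_def)
  qed
  also have "\<dots> = (\<integral>\<^sup>+\<omega>. indicator {r. ennreal r < a} (T \<omega>) \<partial>M)"
    by (rule distributed_nn_integral[OF D]) measurable
  finally show ?thesis by (simp add: indicator_def)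
qed

context brownian_local_time_space
begin

text \<open>As \<open>T\<close> is \<open>F 0\<close>-measurable, the pair of \<open>T\<close> and
  the path has a product law, and \<open>exponential_min\<close> can be applied for every fixed path
  with \<open>a\<close> the value of \<open>\<Phi>\<close>. Fubini's theorem thus takes the place of
  conditioning on the path.\<close>

lemma exponential_min_path:
  fixes Z \<Phi> :: "'a \<Rightarrow> ennreal"
  assumes T: "T \<in> borel_measurable (F 0)" and D: "distributed M lborel T (exponential_density 1)"
    and Z[measurable]: "Z \<in> borel_measurable (path_sigma {0..})" and \<Phi>[measurable]: "\<Phi> \<in> borel_measurable (path_sigma {0..})"
  shows "(\<integral>\<^sup>+\<omega>. Z \<omega> * min (ennreal (T \<omega>)) (\<Phi> \<omega>) \<partial>M) = (\<integral>\<^sup>+\<omega>. Z \<omega> * indicator {\<omega>. ennreal (T \<omega>) < \<Phi> \<omega>} \<omega> \<partial>M)"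
proof -
  let ?S = "path_sigma {0..}"
  have TM[measurable]: "T \<in> borel_measurable M" using T by (rule F_measurable_M)
  have SM: "sets ?S \<subseteq> sets M"
    using indep_setD_ev2[OF indep_path_sigma] .
  \<comment> \<open>The path is represented by \<open>\<omega>\<close> itself, seen through the
    coarser \<sigma>-algebra \<open>path_sigma {0..}\<close>.\<close>
  have id: "(\<lambda>\<omega>. \<omega>) \<in> measurable M ?S" using SM by (auto simp: measurable_def)
  interpret PT: prob_space "distr M borel T" by (rule prob_space_distr) simp
  interpret PS: prob_space "distr M ?S (\<lambda>\<omega>. \<omega>)" by (rule prob_space_distr[OF id])
  have pair: "(\<lambda>\<omega>. (T \<omega>, \<omega>)) \<in> measurable M (borel \<Otimes>\<^sub>M ?S)" by (rule measurable_Pair[OF TM id])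
  have joint: "distr M borel T \<Otimes>\<^sub>M distr M ?S (\<lambda>\<omega>. \<omega>) = distr M (borel \<Otimes>\<^sub>M ?S) (\<lambda>\<omega>. (T \<omega>, \<omega>))"
  proof (rule pair_measure_eqI)
    show "sigma_finite_measure (distr M borel T)" "sigma_finite_measure (distr M ?S (\<lambda>\<omega>. \<omega>))" by unfold_locales
    fix A C assume "A \<in> sets (distr M borel T)" "C \<in> sets (distr M ?S (\<lambda>\<omega>. \<omega>))"
    then have A: "A \<in> sets borel" and C: "C \<in> sets ?S" by auto
    have TA: "T -` A \<inter> space M \<in> sets (F 0)" using measurable_sets[OF T A] by (simp add: space_F)
    have "(\<lambda>\<omega>. (T \<omega>, \<omega>)) -` (A \<times> C) \<inter> space M = (T -` A \<inter> space M) \<inter> C"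
      using sets.sets_into_space[OF C] by auto
    then have "emeasure (distr M (borel \<Otimes>\<^sub>M ?S) (\<lambda>\<omega>. (T \<omega>, \<omega>))) (A \<times> C) = emeasure M ((T -` A \<inter> space M) \<inter> C)"
      using A C by (subst emeasure_distr[OF pair]) auto
    also have "\<dots> = emeasure M (T -` A \<inter> space M) * emeasure M C"
      using indep_setD[OF indep_path_sigma TA C] by (simp add: emeasure_eq_measure ennreal_mult)
    also have "\<dots> = emeasure (distr M borel T) A * emeasure (distr M ?S (\<lambda>\<omega>. \<omega>)) C"
      using A C sets.sets_into_space[OF C] by (simp add: emeasure_distr id Int_absorb2)
    finally show "emeasure (distr M borel T) A * emeasure (distr M ?S (\<lambda>\<omega>. \<omega>)) C
      = emeasure (distr M (borel \<Otimes>\<^sub>M ?S) (\<lambda>\<omega>. (T \<omega>, \<omega>))) (A \<times> C)" by simp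
  qed simp
  interpret pair_sigma_finite "distr M borel T" "distr M ?S (\<lambda>\<omega>. \<omega>)" ..
  have fubini: "(\<integral>\<^sup>+\<omega>. f (T \<omega>, \<omega>) \<partial>M) = (\<integral>\<^sup>+\<omega>. (\<integral>\<^sup>+\<omega>'. f (T \<omega>', \<omega>) \<partial>M) \<partial>(distr M ?S (\<lambda>\<omega>. \<omega>)))"
    if f[measurable]: "f \<in> borel_measurable (borel \<Otimes>\<^sub>M ?S)" for f :: "real \<times> 'a \<Rightarrow> ennreal"
  proof -
    have "(\<integral>\<^sup>+\<omega>. f (T \<omega>, \<omega>) \<partial>M) = (\<integral>\<^sup>+p. f p \<partial>(distr M (borel \<Otimes>\<^sub>M ?S) (\<lambda>\<omega>. (T \<omega>, \<omega>))))"
      by (rule nn_integral_distr[symmetric]) (use measurable_Pair[OF TM id] in auto)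
    also have "\<dots> = (\<integral>\<^sup>+p. f p \<partial>(distr M borel T \<Otimes>\<^sub>M distr M ?S (\<lambda>\<omega>. \<omega>)))" by (simp add: joint)
    also have "\<dots> = (\<integral>\<^sup>+\<omega>. (\<integral>\<^sup>+t. f (t, \<omega>) \<partial>(distr M borel T)) \<partial>(distr M ?S (\<lambda>\<omega>. \<omega>)))"
      by (rule nn_integral_snd[symmetric]) simp
    also have "\<dots> = (\<integral>\<^sup>+\<omega>. (\<integral>\<^sup>+\<omega>'. f (T \<omega>', \<omega>) \<partial>M) \<partial>(distr M ?S (\<lambda>\<omega>. \<omega>)))"
    proof (rule nn_integral_cong)
      fix \<omega> assume "\<omega> \<in> space (distr M ?S (\<lambda>\<omega>. \<omega>))"
      then have "(\<lambda>t. f (t, \<omega>)) \<in> borel_measurable borel" by (intro measurable_compose[OF _ f]) auto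
      then show "(\<integral>\<^sup>+t. f (t, \<omega>) \<partial>(distr M borel T)) = (\<integral>\<^sup>+\<omega>'. f (T \<omega>', \<omega>) \<partial>M)"
        by (intro nn_integral_distr) auto
    qed
    finally show ?thesis .
  qed
  have f2: "(\<lambda>p. Z (snd p) * indicator {p. ennreal (fst p) < \<Phi> (snd p)} p) \<in> borel_measurable (borel \<Otimes>\<^sub>M ?S)"
    by measurable
  have "(\<integral>\<^sup>+\<omega>. Z \<omega> * min (ennreal (T \<omega>)) (\<Phi> \<omega>) \<partial>M)
      = (\<integral>\<^sup>+\<omega>. (\<integral>\<^sup>+\<omega>'. Z \<omega> * min (ennreal (T \<omega>')) (\<Phi> \<omega>) \<partial>M) \<partial>(distr M ?S (\<lambda>\<omega>. \<omega>)))"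
    by (rule fubini[of "\<lambda>(t, \<omega>). Z \<omega> * min (ennreal t) (\<Phi> \<omega>)", simplified]) measurable
  also have "\<dots> = (\<integral>\<^sup>+\<omega>. (\<integral>\<^sup>+\<omega>'. Z \<omega> * indicator {\<omega>'. ennreal (T \<omega>') < \<Phi> \<omega>} \<omega>' \<partial>M) \<partial>(distr M ?S (\<lambda>\<omega>. \<omega>)))"
  proof (rule nn_integral_cong)
    fix \<omega>
    have "(\<integral>\<^sup>+\<omega>'. Z \<omega> * min (ennreal (T \<omega>')) (\<Phi> \<omega>) \<partial>M) = Z \<omega> * (\<integral>\<^sup>+\<omega>'. min (ennreal (T \<omega>')) (\<Phi> \<omega>) \<partial>M)"
      by (rule nn_integral_cmult) measurable
    also have "\<dots> = (\<integral>\<^sup>+\<omega>'. Z \<omega> * indicator {\<omega>'. ennreal (T \<omega>') < \<Phi> \<omega>} \<omega>' \<partial>M)"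
      unfolding exponential_min[OF D] by (rule nn_integral_cmult[symmetric]) measurable
    finally show "(\<integral>\<^sup>+\<omega>'. Z \<omega> * min (ennreal (T \<omega>')) (\<Phi> \<omega>) \<partial>M)
      = (\<integral>\<^sup>+\<omega>'. Z \<omega> * indicator {\<omega>'. ennreal (T \<omega>') < \<Phi> \<omega>} \<omega>' \<partial>M)" .
  qed
  also have "\<dots> = (\<integral>\<^sup>+\<omega>. Z \<omega> * indicator {\<omega>. ennreal (T \<omega>) < \<Phi> \<omega>} \<omega> \<partial>M)"
    using fubini[OF f2] by (simp add: indicator_def)
  finally show ?thesis .
qed

end

text \<open>Recovers a continuous occupation density from the occupation times of shrinking
  intervals. The integrals are nonnegative ones because occupation times come as measures.\<close>

lemma average_tendsto:
  fixes f :: "real \<Rightarrow> real"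
  assumes cont: "isCont f x" and nn: "\<And>y. 0 \<le> f y" and [measurable]: "f \<in> borel_measurable borel"
  shows "(\<lambda>k. ennreal (real (Suc k) / 2) * (\<integral>\<^sup>+y\<in>{x - 1 / real (Suc k)<..<x + 1 / real (Suc k)}. ennreal (f y) \<partial>lborel)) \<longlonglongrightarrow> ennreal (f x)"
proof -
  let ?I = "\<lambda>k. {x - 1 / real (Suc k)<..<x + 1 / real (Suc k)}"
  have const: "ennreal (real (Suc k) / 2) * (\<integral>\<^sup>+y\<in>?I k. ennreal c \<partial>lborel) = ennreal c" for k c
  proof -
    have "(\<integral>\<^sup>+y\<in>?I k. ennreal c \<partial>lborel) = ennreal c * ennreal (2 / real (Suc k))"
      by (subst nn_integral_cmult_indicator) (auto simp: field_simps simp del: of_nat_Suc)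
    moreover have "ennreal (real (Suc k) / 2) * ennreal (2 / real (Suc k)) = 1"
      by (subst ennreal_mult[symmetric]) (auto simp del: of_nat_Suc)
    ultimately show ?thesis by (metis (no_types) mult.commute mult.left_commute mult_1)
  qed
  have near: "eventually (\<lambda>k. \<forall>y\<in>?I k. P y) sequentially" if P: "eventually P (nhds x)" for P
  proof -
    obtain d where d: "0 < d" "\<And>y. dist y x < d \<Longrightarrow> P y" using P by (auto simp: eventually_nhds_metric)
    have "eventually (\<lambda>k. 1 / real (Suc k) < d) sequentially"
      using LIMSEQ_Suc[OF lim_1_over_n[where 'a=real]] d(1) by (rule order_tendstoD)
    then show ?thesis
    proof eventually_elim
      case (elim k)
      then show ?case using d(2) by (auto simp: dist_real_def simp del: of_nat_Suc)
    qed
  qed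
  have tend: "(f \<longlongrightarrow> f x) (nhds x)" using cont by (simp add: continuous_at tendsto_at_iff_tendsto_nhds)
  show ?thesis
  proof (rule order_tendstoI)
    fix a assume a: "a < ennreal (f x)"
    then obtain c where c: "a < ennreal c" "c < f x" "0 \<le> c"
    proof -
      obtain b where "a < b" "b < ennreal (f x)" using dense[OF a] by auto
      then show ?thesis using that[of "enn2real b"] nn[of x] by (cases b) (auto simp: ennreal_less_iff)
    qed
    have "eventually (\<lambda>y. c < f y) (nhds x)" using tend c(2) by (rule order_tendstoD)
    from near[OF this] show "eventually (\<lambda>k. a < ennreal (real (Suc k) / 2) * (\<integral>\<^sup>+y\<in>?I k. ennreal (f y) \<partial>lborel)) sequentially"
    proof eventually_elim
      case (elim k)
      have "ennreal c \<le> ennreal (real (Suc k) / 2) * (\<integral>\<^sup>+y\<in>?I k. ennreal (f y) \<partial>lborel)"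
      proof (subst const[of k c, symmetric], intro mult_left_mono nn_integral_mono)
        fix y
        show "ennreal c * indicator (?I k) y \<le> ennreal (f y) * indicator (?I k) y"
        proof (cases "y \<in> ?I k")
          case True
          show ?thesis by (rule mult_right_mono[OF ennreal_leI[OF less_imp_le[OF bspec[OF elim True]]]]) simp
        qed (simp add: indicator_def del: greaterThanLessThan_iff of_nat_Suc)
      qed simp
      then show ?case using c(1) by simp
    qed
  next
    fix a assume a: "ennreal (f x) < a"
    then obtain c where c: "ennreal c < a" "f x < c"
    proof -
      obtain b where "ennreal (f x) < b" "b < a" using dense[OF a] by auto
      then show ?thesis using that[of "enn2real b"] nn[of x] by (cases b) (auto simp: ennreal_less_iff)
    qed
    have "eventually (\<lambda>y. f y < c) (nhds x)" using tend c(2) by (rule order_tendstoD)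
    from near[OF this] show "eventually (\<lambda>k. ennreal (real (Suc k) / 2) * (\<integral>\<^sup>+y\<in>?I k. ennreal (f y) \<partial>lborel) < a) sequentially"
    proof eventually_elim
      case (elim k)
      have "ennreal (real (Suc k) / 2) * (\<integral>\<^sup>+y\<in>?I k. ennreal (f y) \<partial>lborel) \<le> ennreal c"
      proof (subst const[of k c, symmetric], intro mult_left_mono nn_integral_mono)
        fix y
        show "ennreal (f y) * indicator (?I k) y \<le> ennreal c * indicator (?I k) y"
        proof (cases "y \<in> ?I k")
          case True
          show ?thesis by (rule mult_right_mono[OF ennreal_leI[OF less_imp_le[OF bspec[OF elim True]]]]) simp
        qed (simp add: indicator_def del: greaterThanLessThan_iff of_nat_Suc)
      qed simp
      then show ?case using c(1) by simp
    qed
  qed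
qed

context brownian_local_time_space
begin

text \<open>A version of the local time that is a functional of the path of \<open>B\<close>, hence independent of \<open>F 0\<close>.\<close>

definition path_local_time :: "real \<Rightarrow> real \<Rightarrow> 'a \<Rightarrow> ennreal" where
  "path_local_time x t \<omega> = liminf (\<lambda>k. ennreal (real (Suc k) / 2) *
     (\<integral>\<^sup>+s. indicator {s\<in>{0..t}. B s \<omega> \<in> {x - 1 / real (Suc k)<..<x + 1 / real (Suc k)}} s \<partial>lborel))"

lemma path_local_time_measurable:
  "(\<lambda>(x, \<omega>). path_local_time x t \<omega>) \<in> borel_measurable (borel \<Otimes>\<^sub>M path_sigma {0..})"
proof -
  \<comment> \<open>Only nonnegative times belong to \<open>path_sigma {0..}\<close>; at negative
    times \<open>B\<close> is \<open>x0\<close>, so clipping the time at 0 changes no value.\<close>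
  have *: "(\<lambda>(s, \<omega>). B (max 0 s) \<omega>) \<in> borel_measurable (borel \<Otimes>\<^sub>M path_sigma {0..})"
  proof (rule measurable_continuous_process)
    show "continuous_on UNIV (\<lambda>t. B (max 0 t) \<omega>)" if "\<omega> \<in> space (path_sigma {0..})" for \<omega>
      using that by (intro continuous_on_compose2[OF B_continuous[of \<omega>]] continuous_intros) auto
  qed (auto intro: measurable_path_sigma)
  have B_eq: "B (max 0 s) \<omega> = B s \<omega>" for s \<omega> using B_start[of s] B_start[of 0] by (auto simp: max_def)
  have B[measurable]: "(\<lambda>(s, \<omega>). B s \<omega>) \<in> borel_measurable (borel \<Otimes>\<^sub>M path_sigma {0..})"
    using * by (simp add: B_eq)
  show ?thesis unfolding path_local_time_def greaterThanLessThan_iff atLeastAtMost_iff by measurable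
qed

lemma path_local_time_eq: "AE \<omega> in M. \<forall>t\<ge>0. \<forall>x. path_local_time x t \<omega> = ennreal (L x t \<omega>)"
  using occupation AE_space
proof eventually_elim
  case (elim \<omega>)
  show ?case
  proof (intro allI impI)
    fix t x :: real assume t: "0 \<le> t"
    have cont: "continuous_on UNIV (\<lambda>x. L x t \<omega>)" by (rule L_continuous_space[OF elim(2)])
    let ?I = "\<lambda>k. {x - 1 / real (Suc k)<..<x + 1 / real (Suc k)}"
    have B': "(\<lambda>s. B s \<omega>) \<in> borel_measurable borel"
      by (rule borel_measurable_continuous_onI[OF B_continuous[OF elim(2)]])
    have occ: "(\<integral>\<^sup>+s. indicator {s\<in>{0..t}. B s \<omega> \<in> ?I k} s \<partial>lborel) = (\<integral>\<^sup>+y\<in>?I k. ennreal (L y t \<omega>) \<partial>lborel)" for k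
    proof -
      have "{s\<in>{0..t}. B s \<omega> \<in> ?I k} = {0..t} \<inter> ((\<lambda>s. B s \<omega>) -` ?I k \<inter> space borel)" by auto
      also have "\<dots> \<in> sets borel" by (intro sets.Int measurable_sets[OF B']) auto
      finally have "(\<integral>\<^sup>+s. indicator {s\<in>{0..t}. B s \<omega> \<in> ?I k} s \<partial>lborel) = emeasure lborel {s\<in>{0..t}. B s \<omega> \<in> ?I k}"
        by (intro nn_integral_indicator) simp
      also have "\<dots> = (\<integral>\<^sup>+y\<in>?I k. ennreal (L y t \<omega>) \<partial>lborel)"
        by (rule elim(1)[rule_format, OF t]) simp
      finally show ?thesis .
    qed
    have "(\<lambda>k. ennreal (real (Suc k) / 2) * (\<integral>\<^sup>+y\<in>?I k. ennreal (L y t \<omega>) \<partial>lborel)) \<longlonglongrightarrow> ennreal (L x t \<omega>)"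
      using cont L_nonneg[OF elim(2)]
      by (intro average_tendsto borel_measurable_continuous_onI) (auto simp: continuous_on_eq_continuous_at)
    then show "path_local_time x t \<omega> = ennreal (L x t \<omega>)"
      unfolding path_local_time_def occ by (rule lim_imp_Liminf[OF sequentially_bot])
  qed
qed

end

section \<open>Potentials of centred laws\<close>

definition centred_law :: "real measure \<Rightarrow> real \<Rightarrow> bool" where
  "centred_law \<nu> x0 \<longleftrightarrow> prob_space \<nu> \<and> sets \<nu> = sets borel \<and> integrable \<nu> (\<lambda>x. x) \<and> (\<integral>x. x \<partial>\<nu>) = x0"

text \<open>If \<open>B\<close> stopped at a suitable time has law \<open>\<nu>\<close>, then by Tanaka's formula \<open>gap \<nu> x0 x\<close> is the expected
  local time at \<open>x\<close> up to that time.\<close>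

definition gap :: "real measure \<Rightarrow> real \<Rightarrow> real \<Rightarrow> real" where
  "gap \<nu> x0 x = potential \<nu> x - \<bar>x - x0\<bar>"

text \<open>Half the second difference with step \<open>h\<close> at \<open>z\<close> of
  \<open>\<lambda>x. \<bar>x - y\<bar>\<close>. Its integral under a law is therefore half a second
  difference of the potential, so that inequalities between tent integrals express convexity without
  second derivatives.\<close>

definition tent :: "real \<Rightarrow> real \<Rightarrow> real \<Rightarrow> real" where
  "tent z h y = max 0 (h - \<bar>y - z\<bar>)"

lemma tent_nonneg: "0 \<le> tent z h y"
  by (simp add: tent_def)

lemma tent_le: "0 \<le> h \<Longrightarrow> tent z h y \<le> h"
  by (simp add: tent_def)

lemma tent_eq_0: "y \<notin> {z - h..z + h} \<Longrightarrow> tent z h y = 0"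
  by (auto simp: tent_def abs_if)

lemma tent_lipschitz: "\<bar>tent z h x - tent z h y\<bar> \<le> \<bar>x - y\<bar>"
  unfolding tent_def by (simp add: max_def abs_if)

lemma borel_measurable_tent [measurable]: "tent z h \<in> borel_measurable borel"
  unfolding tent_def by measurable

lemma continuous_on_tent: "continuous_on A (tent z h)"
  unfolding tent_def by (intro continuous_intros)

lemma tent_eq_potential: "0 \<le> h \<Longrightarrow> tent z h y = (\<bar>(z + h) - y\<bar> + \<bar>(z - h) - y\<bar>) / 2 - \<bar>z - y\<bar>"
  unfolding tent_def by (simp add: max_def abs_if field_simps)

lemma centred_lawD:
  assumes "centred_law \<nu> x0"
  shows "prob_space \<nu>" "sets \<nu> = sets borel" "integrable \<nu> (\<lambda>x. x)" "(\<integral>x. x \<partial>\<nu>) = x0" "space \<nu> = UNIV"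
  using assms sets_eq_imp_space_eq[of \<nu> borel] by (auto simp: centred_law_def)

lemma centred_law_integrable:
  assumes "centred_law \<nu> x0"
  shows "integrable \<nu> (\<lambda>y. \<bar>x - y\<bar>)" "integrable \<nu> (\<lambda>y. max 0 (x - y))" "integrable \<nu> (\<lambda>y. max 0 (y - x))"
    "integrable \<nu> (\<lambda>y. c::real)"
proof -
  interpret prob_space \<nu> using assms by (rule centred_lawD)
  note centred_lawD(3)[OF assms, simp]
  show "integrable \<nu> (\<lambda>y. c::real)" by simp
  show "integrable \<nu> (\<lambda>y. \<bar>x - y\<bar>)" by (intro integrable_abs Bochner_Integration.integrable_diff) auto
  show "integrable \<nu> (\<lambda>y. max 0 (x - y))" "integrable \<nu> (\<lambda>y. max 0 (y - x))"
    by (intro Bochner_Integration.integrable_max Bochner_Integration.integrable_diff; simp)+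
qed

text \<open>\<open>\<bar>x - y\<bar>\<close> is an affine function of \<open>y\<close> plus twice a
  positive part, and the affine part integrates to \<open>x - x0\<close> or \<open>x0 - x\<close>
  because the mean is \<open>x0\<close>. From this form positivity of the gap, its decay at infinity
  and its vanishing beyond the support are read off.\<close>

lemma gap_eq:
  assumes "centred_law \<nu> x0"
  shows "x0 \<le> x \<Longrightarrow> gap \<nu> x0 x = 2 * (\<integral>y. max 0 (y - x) \<partial>\<nu>)"
    and "x \<le> x0 \<Longrightarrow> gap \<nu> x0 x = 2 * (\<integral>y. max 0 (x - y) \<partial>\<nu>)"
proof -
  interpret prob_space \<nu> using assms by (rule centred_lawD)
  note i = centred_law_integrable[OF assms]
  note [simp] = centred_lawD(3)[OF assms]
  have "potential \<nu> x = (\<integral>y. (x - y) + 2 * max 0 (y - x) \<partial>\<nu>)"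
    unfolding potential_def by (intro Bochner_Integration.integral_cong) (auto simp: max_def abs_if)
  also have "\<dots> = (x - x0) + 2 * (\<integral>y. max 0 (y - x) \<partial>\<nu>)"
    using i(3)[of x] by (simp add: centred_lawD(4)[OF assms] prob_space)
  finally show "x0 \<le> x \<Longrightarrow> gap \<nu> x0 x = 2 * (\<integral>y. max 0 (y - x) \<partial>\<nu>)"
    by (simp add: gap_def)
  have "potential \<nu> x = (\<integral>y. (y - x) + 2 * max 0 (x - y) \<partial>\<nu>)"
    unfolding potential_def by (intro Bochner_Integration.integral_cong) (auto simp: max_def abs_if)
  also have "\<dots> = (x0 - x) + 2 * (\<integral>y. max 0 (x - y) \<partial>\<nu>)"
    using i(2)[of x] by (simp add: centred_lawD(4)[OF assms] prob_space)
  finally show "x \<le> x0 \<Longrightarrow> gap \<nu> x0 x = 2 * (\<integral>y. max 0 (x - y) \<partial>\<nu>)"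
    by (simp add: gap_def)
qed

lemma gap_nonneg:
  assumes "centred_law \<nu> x0" shows "0 \<le> gap \<nu> x0 x"
  using gap_eq[OF assms, of x] by (cases "x0 \<le> x") (auto intro!: integral_nonneg_AE)

lemma potential_lipschitz:
  assumes "centred_law \<nu> x0" shows "\<bar>potential \<nu> x - potential \<nu> y\<bar> \<le> \<bar>x - y\<bar>"
proof -
  interpret prob_space \<nu> using assms by (rule centred_lawD)
  note i = centred_law_integrable(1)[OF assms]
  have "\<bar>potential \<nu> x - potential \<nu> y\<bar> = \<bar>\<integral>t. \<bar>x - t\<bar> - \<bar>y - t\<bar> \<partial>\<nu>\<bar>"
    unfolding potential_def using i by simp
  also have "\<dots> \<le> (\<integral>t. \<bar>\<bar>x - t\<bar> - \<bar>y - t\<bar>\<bar> \<partial>\<nu>)" by (rule integral_abs_bound)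
  also have "\<dots> \<le> (\<integral>t. \<bar>x - y\<bar> \<partial>\<nu>)"
  proof (rule integral_mono)
    show "integrable \<nu> (\<lambda>t. \<bar>\<bar>x - t\<bar> - \<bar>y - t\<bar>\<bar>)"
      by (rule integrable_abs[OF Bochner_Integration.integrable_diff[OF i i]])
  qed auto
  finally show ?thesis by (simp add: prob_space)
qed

lemma continuous_on_potential:
  assumes "centred_law \<nu> x0" shows "continuous_on A (potential \<nu>)"
  unfolding continuous_on_iff
proof (intro ballI allI impI)
  fix x and e :: real assume "0 < e"
  then show "\<exists>d>0. \<forall>x'\<in>A. dist x' x < d \<longrightarrow> dist (potential \<nu> x') (potential \<nu> x) < e"
    using le_less_trans[OF potential_lipschitz[OF assms]] by (intro exI[of _ e]) (auto simp: dist_real_def)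
qed

lemma continuous_on_gap:
  assumes "centred_law \<nu> x0" shows "continuous_on A (gap \<nu> x0)"
  unfolding gap_def by (intro continuous_intros continuous_on_potential[OF assms])

lemma gap_tendsto_0:
  assumes "centred_law \<nu> x0"
  shows "(gap \<nu> x0 \<longlongrightarrow> 0) at_top" "(gap \<nu> x0 \<longlongrightarrow> 0) at_bot"
proof -
  interpret prob_space \<nu> using assms by (rule centred_lawD)
  note [simp] = centred_lawD(3)[OF assms]
  have [measurable_cong]: "sets \<nu> = sets borel" by (rule centred_lawD(2)[OF assms])
  have "((\<lambda>x. \<integral>y. max 0 (y - x) \<partial>\<nu>) \<longlongrightarrow> (\<integral>y. 0 \<partial>\<nu>)) at_top"
  proof (rule integral_dominated_convergence_at_top[where w="\<lambda>y. \<bar>y\<bar>"])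
    show "AE y in \<nu>. ((\<lambda>x. max 0 (y - x)) \<longlongrightarrow> 0) at_top"
      by (intro AE_I2 tendsto_eventually eventually_at_top_linorderI) (rule max_absorb1, simp)
    show "\<forall>\<^sub>F x in at_top. AE y in \<nu>. norm (max 0 (y - x)) \<le> \<bar>y\<bar>"
      using eventually_ge_at_top[of 0] by eventually_elim auto
  qed auto
  then have "((\<lambda>x. 2 * (\<integral>y. max 0 (y - x) \<partial>\<nu>)) \<longlongrightarrow> 0) at_top" by (intro tendsto_eq_intros) auto
  moreover have "eventually (\<lambda>x. gap \<nu> x0 x = 2 * (\<integral>y. max 0 (y - x) \<partial>\<nu>)) at_top"
    using eventually_ge_at_top[of x0] by eventually_elim (rule gap_eq(1)[OF assms])
  ultimately show "(gap \<nu> x0 \<longlongrightarrow> 0) at_top" by (simp add: tendsto_cong)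
  have "((\<lambda>x. \<integral>y. max 0 (- x - y) \<partial>\<nu>) \<longlongrightarrow> (\<integral>y. 0 \<partial>\<nu>)) at_top"
  proof (rule integral_dominated_convergence_at_top[where w="\<lambda>y. \<bar>y\<bar>"])
    show "AE y in \<nu>. ((\<lambda>x. max 0 (- x - y)) \<longlongrightarrow> 0) at_top"
    proof (intro AE_I2 tendsto_eventually)
      fix y :: real show "\<forall>\<^sub>F x in at_top. max 0 (- x - y) = 0"
        using eventually_ge_at_top[of "- y"] by eventually_elim auto
    qed
    show "\<forall>\<^sub>F x in at_top. AE y in \<nu>. norm (max 0 (- x - y)) \<le> \<bar>y\<bar>"
      using eventually_ge_at_top[of 0] by eventually_elim auto
  qed auto
  then have "((\<lambda>x. 2 * (\<integral>y. max 0 (- x - y) \<partial>\<nu>)) \<longlongrightarrow> 0) at_top" by (intro tendsto_eq_intros) auto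
  moreover have "eventually (\<lambda>x. gap \<nu> x0 (- x) = 2 * (\<integral>y. max 0 (- x - y) \<partial>\<nu>)) at_top"
    using eventually_ge_at_top[of "- x0"] by eventually_elim (rule gap_eq(2)[OF assms], simp)
  ultimately have "((\<lambda>x. gap \<nu> x0 (- x)) \<longlongrightarrow> 0) at_top" by (simp add: tendsto_cong)
  then show "(gap \<nu> x0 \<longlongrightarrow> 0) at_bot" by (simp add: filterlim_at_bot_mirror)
qed

lemma integral_tent:
  assumes "centred_law \<nu> x0" "0 \<le> h"
  shows "(\<integral>y. tent z h y \<partial>\<nu>) = (potential \<nu> (z + h) + potential \<nu> (z - h)) / 2 - potential \<nu> z"
proof -
  note i = centred_law_integrable(1)[OF assms(1)]
  have "(\<integral>y. tent z h y \<partial>\<nu>) = (\<integral>y. (\<bar>(z + h) - y\<bar> + \<bar>(z - h) - y\<bar>) / 2 - \<bar>z - y\<bar> \<partial>\<nu>)"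
    using assms(2) by (intro Bochner_Integration.integral_cong) (auto simp: tent_eq_potential)
  also have "\<dots> = (potential \<nu> (z + h) + potential \<nu> (z - h)) / 2 - potential \<nu> z"
    unfolding potential_def using i[of "z + h"] i[of "z - h"] i[of z] by simp
  finally show ?thesis .
qed

text \<open>A maximum principle: the difference \<open>f\<close> of two gaps is convex wherever it is positive, so it
  has no positive maximum. The second derivative of \<open>f\<close> is tested against tents.\<close>

lemma gap_comparison:
  assumes \<nu>1: "centred_law \<nu>1 x0" and \<nu>2: "centred_law \<nu>2 x0" and I: "open I"
    and outside: "\<And>x. x \<notin> I \<Longrightarrow> gap \<nu>1 x0 x \<le> gap \<nu>2 x0 x"
    and convex: "\<And>z h. 0 < h \<Longrightarrow> {z - h..z + h} \<subseteq> I \<Longrightarrow>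
      (\<And>y. y \<in> {z - h..z + h} \<Longrightarrow> gap \<nu>2 x0 y < gap \<nu>1 x0 y) \<Longrightarrow>
      (\<integral>y. tent z h y \<partial>\<nu>2) \<le> (\<integral>y. tent z h y \<partial>\<nu>1)"
  shows "gap \<nu>1 x0 x \<le> gap \<nu>2 x0 x"
proof (rule ccontr)
  define f where "f y = gap \<nu>1 x0 y - gap \<nu>2 x0 y" for y
  assume "\<not> ?thesis"
  then have fx: "0 < f x" by (simp add: f_def)
  have cont: "continuous_on A f" for A
    unfolding f_def by (intro continuous_intros continuous_on_gap[OF \<nu>1] continuous_on_gap[OF \<nu>2])
  have lim: "(f \<longlongrightarrow> 0) at_top" "(f \<longlongrightarrow> 0) at_bot"
    unfolding f_def using tendsto_diff[OF gap_tendsto_0(1)[OF \<nu>1] gap_tendsto_0(1)[OF \<nu>2]]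
      tendsto_diff[OF gap_tendsto_0(2)[OF \<nu>1] gap_tendsto_0(2)[OF \<nu>2]] by auto
  \<comment> \<open>\<open>f\<close> tends to 0 in both directions, so it attains its positive
    maximum, and all points of maximum lie in \<open>[a, b]\<close>.\<close>
  obtain b where b: "\<And>y. b \<le> y \<Longrightarrow> f y < f x"
    using order_tendstoD(2)[OF lim(1) fx] by (auto simp: eventually_at_top_linorder)
  obtain a where a: "\<And>y. y \<le> a \<Longrightarrow> f y < f x"
    using order_tendstoD(2)[OF lim(2) fx] by (auto simp: eventually_at_bot_linorder)
  have "x \<in> {a..b}" using a[of x] b[of x] by (auto simp: not_less[symmetric] intro: ccontr)
  then obtain z0 where z0: "z0 \<in> {a..b}" "\<And>y. y \<in> {a..b} \<Longrightarrow> f y \<le> f z0"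
    using continuous_attains_sup[of "{a..b}" f] cont by auto
  have max: "f y \<le> f z0" for y
    using z0(2)[of y] z0(2)[OF \<open>x \<in> {a..b}\<close>] a[of y] b[of y] by (cases "y \<in> {a..b}") auto
  \<comment> \<open>The rightmost point of maximum is taken, so that \<open>f\<close> is strictly
    smaller to its right; the second difference at \<open>z\<close> is then negative.\<close>
  let ?S = "{y \<in> {a..b}. f y = f z0}"
  have "closed ?S" by (intro continuous_closed_preimage_constant[OF cont]) auto
  then have "compact ?S" by (auto simp: compact_eq_bounded_closed intro: bounded_subset[of "{a..b}"])
  moreover have "?S \<noteq> {}" using z0 by auto
  ultimately obtain z where z: "z \<in> ?S" "\<And>y. y \<in> ?S \<Longrightarrow> y \<le> z"
    using compact_attains_sup[of ?S] by auto
  have fz: "f z = f z0" "0 < f z" using z(1) z0(2)[OF \<open>x \<in> {a..b}\<close>] fx by auto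
  have "z \<in> I" using outside[of z] fz by (auto simp: f_def)
  have "open (I \<inter> {y. 0 < f y})"
    using I cont[of UNIV] by (intro open_Int open_Collect_less) (auto simp: continuous_on_const)
  then obtain e where e: "0 < e" "ball z e \<subseteq> I \<inter> {y. 0 < f y}"
    using \<open>z \<in> I\<close> fz(2) by (elim openE[where x=z]) auto
  define h where "h = e / 2"
  have h: "0 < h" "{z - h..z + h} \<subseteq> ball z e" using e(1) by (auto simp: h_def dist_real_def)
  have "f (z + h) < f z"
  proof (rule ccontr)
    assume "\<not> ?thesis"
    then have "f (z + h) = f z0" using max[of "z + h"] fz by simp
    moreover from this have "z + h \<in> {a..b}" using a[of "z + h"] b[of "z + h"] z0(2)[OF \<open>x \<in> {a..b}\<close>]
      by (auto simp: not_less[symmetric] intro: ccontr)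
    ultimately show False using z(2)[of "z + h"] h(1) by auto
  qed
  moreover have "f (z - h) \<le> f z" using max fz by simp
  moreover have "(\<integral>y. tent z h y \<partial>\<nu>2) \<le> (\<integral>y. tent z h y \<partial>\<nu>1)"
  proof (rule convex[OF h(1)])
    show "{z - h..z + h} \<subseteq> I" using h(2) e(2) by auto
    fix y assume "y \<in> {z - h..z + h}"
    then have "0 < f y" using h(2) e(2) by auto
    then show "gap \<nu>2 x0 y < gap \<nu>1 x0 y" by (simp add: f_def)
  qed
  \<comment> \<open>The terms \<open>\<bar>y - x0\<bar>\<close> cancel in the difference of the two
    gaps, so the tent inequality is an inequality for second differences of
    \<open>f\<close>.\<close>
  then have "2 * f z \<le> f (z + h) + f (z - h)"
    using h(1) by (simp add: integral_tent[OF \<nu>1] integral_tent[OF \<nu>2] f_def gap_def field_simps)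
  ultimately show False by simp
qed

text \<open>The right derivative of the potential determines the distribution function:
  \<open>r a k\<close> is an affine function of the difference quotient of
  \<open>\<lambda>a. \<bar>a - y\<bar>\<close> with step \<open>1 / Suc k\<close>, scaled to take
  values in \<open>[0, 1]\<close> and to tend to the indicator of \<open>{a<..}\<close>.\<close>

lemma gap_determines_law:
  assumes \<nu>1: "centred_law \<nu>1 x0" and \<nu>2: "centred_law \<nu>2 x0" and eq: "\<And>x. gap \<nu>1 x0 x = gap \<nu>2 x0 x"
  shows "\<nu>1 = \<nu>2"
proof -
  interpret p1: prob_space \<nu>1 using \<nu>1 by (rule centred_lawD)
  interpret p2: prob_space \<nu>2 using \<nu>2 by (rule centred_lawD)
  have pot: "potential \<nu>1 x = potential \<nu>2 x" for x using eq[of x] by (simp add: gap_def)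
  define r where "r a k y = (\<bar>a - y\<bar> - \<bar>(a + 1 / real (Suc k)) - y\<bar>) * real (Suc k) / 2 + 1/2" for a y :: real and k
  have cdf: "(\<lambda>k. \<integral>y. r a k y \<partial>\<nu>) \<longlonglongrightarrow> 1 - measure \<nu> {..a}" if \<nu>: "centred_law \<nu> x0" for \<nu> a
  proof -
    interpret prob_space \<nu> using \<nu> by (rule centred_lawD)
    have [measurable_cong]: "sets \<nu> = sets borel" by (rule centred_lawD(2)[OF \<nu>])
    have r01: "0 \<le> r a k y \<and> r a k y \<le> 1" for k y
    proof -
      have "\<bar>\<bar>a - y\<bar> - \<bar>(a + 1 / real (Suc k)) - y\<bar>\<bar> \<le> 1 / real (Suc k)"
      proof -
        have "0 < 1 / real (Suc k)" by simp
        then show ?thesis by linarith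
      qed
      then have "\<bar>(\<bar>a - y\<bar> - \<bar>(a + 1 / real (Suc k)) - y\<bar>) * real (Suc k)\<bar> \<le> 1"
        by (simp only: abs_mult abs_of_nat pos_le_divide_eq of_nat_0_less_iff zero_less_Suc)
      moreover have "0 \<le> X / 2 + 1/2 \<and> X / 2 + 1/2 \<le> 1" if "\<bar>X\<bar> \<le> 1" for X :: real using that by linarith
      ultimately show ?thesis unfolding r_def by blast
    qed
    have "(\<lambda>k. \<integral>y. r a k y \<partial>\<nu>) \<longlonglongrightarrow> (\<integral>y. indicator {a<..} y \<partial>\<nu>)"
    proof (rule integral_dominated_convergence[where w="\<lambda>y. 1"])
      show "AE y in \<nu>. (\<lambda>k. r a k y) \<longlonglongrightarrow> indicator {a<..} y"
      proof (intro AE_I2)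
        fix y
        show "(\<lambda>k. r a k y) \<longlonglongrightarrow> indicator {a<..} y"
        proof (cases "a < y")
          case False
          have "r a k y = 0" for k
          proof -
            have "\<bar>a - y\<bar> = a - y" "\<bar>(a + 1 / real (Suc k)) - y\<bar> = (a + 1 / real (Suc k)) - y"
            proof -
              have "0 < 1 / real (Suc k)" by simp
              then show "\<bar>a - y\<bar> = a - y" "\<bar>(a + 1 / real (Suc k)) - y\<bar> = (a + 1 / real (Suc k)) - y"
                using False by linarith+
            qed
            then have "\<bar>a - y\<bar> - \<bar>(a + 1 / real (Suc k)) - y\<bar> = - (1 / real (Suc k))" by linarith
            then show ?thesis by (simp add: r_def del: of_nat_Suc)
          qed
          then show ?thesis using False by simp
        next
          case True
          have "eventually (\<lambda>k. 1 / real (Suc k) < y - a) sequentially"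
            using LIMSEQ_Suc[OF lim_1_over_n[where 'a=real]] True by (intro order_tendstoD) auto
          then have "eventually (\<lambda>k. r a k y = 1) sequentially"
          proof eventually_elim
            case (elim k)
            then have "\<bar>a - y\<bar> - \<bar>(a + 1 / real (Suc k)) - y\<bar> = 1 / real (Suc k)" using True by (simp del: of_nat_Suc)
            then show ?case by (simp add: r_def del: of_nat_Suc)
          qed
          then show ?thesis using True by (simp add: tendsto_eventually)
        qed
      qed
      show "AE y in \<nu>. norm (r a k y) \<le> 1" for k using r01 by (intro AE_I2) auto
      show "r a k \<in> borel_measurable \<nu>" for k unfolding r_def by measurable
    qed auto
    also have "(\<integral>y. indicator {a<..} y \<partial>\<nu>) = measure \<nu> {a<..}"
      using centred_lawD(5)[OF \<nu>] by simp
    also have "\<dots> = 1 - measure \<nu> {..a}"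
    proof -
      have "{a<..} = space \<nu> - {..a}" using centred_lawD(5)[OF \<nu>] by auto
      then show ?thesis using prob_compl[of "{..a}"] by simp
    qed
    finally show ?thesis .
  qed
  have r_int: "(\<integral>y. r a k y \<partial>\<nu>) = (potential \<nu> a - potential \<nu> (a + 1 / real (Suc k))) * real (Suc k) / 2 + 1/2"
    if \<nu>: "centred_law \<nu> x0" for \<nu> a k
  proof -
    interpret prob_space \<nu> using \<nu> by (rule centred_lawD)
    show ?thesis unfolding r_def potential_def
      using centred_law_integrable(1)[OF \<nu>, of a] centred_law_integrable(1)[OF \<nu>, of "a + 1 / real (Suc k)"]
      by (simp add: prob_space del: of_nat_Suc)
  qed
  have "measure \<nu>1 {..a} = measure \<nu>2 {..a}" for a
  proof -
    have "(\<lambda>k. \<integral>y. r a k y \<partial>\<nu>1) \<longlonglongrightarrow> 1 - measure \<nu>2 {..a}"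
      using cdf[OF \<nu>2, of a] by (simp add: r_int[OF \<nu>1] r_int[OF \<nu>2] pot)
    then have "1 - measure \<nu>1 {..a} = 1 - measure \<nu>2 {..a}"
      using cdf[OF \<nu>1] by (rule LIMSEQ_unique[rotated])
    then show ?thesis by simp
  qed
  then have "cdf \<nu>1 = cdf \<nu>2" by (auto simp: cdf_def)
  moreover have "real_distribution \<nu>1" "real_distribution \<nu>2"
    using centred_lawD(2)[OF \<nu>1] centred_lawD(2)[OF \<nu>2] p1.prob_space_axioms p2.prob_space_axioms
    by (auto simp: real_distribution_def real_distribution_axioms_def)
  ultimately show ?thesis by (intro cdf_unique)
qed

lemma excess_integral_mono_gap:
  assumes \<nu>1: "centred_law \<nu>1 x0" and \<nu>2: "centred_law \<nu>2 x0" and le: "\<And>x. gap \<nu>1 x0 x \<le> gap \<nu>2 x0 x" and K: "0 \<le> K"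
  shows "(\<integral>x. excess K x \<partial>\<nu>1) \<le> (\<integral>x. excess K x \<partial>\<nu>2)"
proof -
  have eq: "(\<integral>x. excess K x \<partial>\<nu>) = (potential \<nu> K + potential \<nu> (- K)) / 2 - K" if \<nu>: "centred_law \<nu> x0" for \<nu>
  proof -
    interpret prob_space \<nu> using \<nu> by (rule centred_lawD)
    note i = centred_law_integrable(1)[OF \<nu>]
    have "(\<integral>x. excess K x \<partial>\<nu>) = (\<integral>x. (\<bar>K - x\<bar> + \<bar>(- K) - x\<bar>) / 2 - K \<partial>\<nu>)"
      using K by (intro Bochner_Integration.integral_cong) (auto simp: excess_eq_potential abs_minus_commute)
    also have "\<dots> = (potential \<nu> K + potential \<nu> (- K)) / 2 - K"
      unfolding potential_def using i[of K] i[of "- K"] by (simp add: prob_space)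
    finally show ?thesis .
  qed
  show ?thesis using le[of K] le[of "- K"] by (simp add: eq[OF \<nu>1] eq[OF \<nu>2] gap_def)
qed

section \<open>The open interval spanned by the support (gaps included), its finite ends, and the
  target law\<close>

definition support_interior :: "real measure \<Rightarrow> real set" where
  "support_interior \<mu> = {x. supp_lower \<mu> < ereal x \<and> ereal x < supp_upper \<mu>}"

definition support_ends :: "real measure \<Rightarrow> real set" where
  "support_ends \<mu> = {x. ereal x = supp_lower \<mu> \<or> ereal x = supp_upper \<mu>}"

lemma finite_support_ends: "finite (support_ends \<mu>)"
proof -
  have "support_ends \<mu> \<subseteq> {real_of_ereal (supp_lower \<mu>), real_of_ereal (supp_upper \<mu>)}"
  proof
    fix x assume "x \<in> support_ends \<mu>"
    then have "x = real_of_ereal (supp_lower \<mu>) \<or> x = real_of_ereal (supp_upper \<mu>)"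
      unfolding support_ends_def by (metis (mono_tags, lifting) mem_Collect_eq real_of_ereal.simps(1))
    then show "x \<in> {real_of_ereal (supp_lower \<mu>), real_of_ereal (supp_upper \<mu>)}" by auto
  qed
  then show ?thesis by (rule finite_subset) auto
qed

lemma open_support_interior: "open (support_interior \<mu>)"
  unfolding support_interior_def by (intro open_Collect_conj open_Collect_less continuous_intros) 

lemma support_interior_interval:
  "a \<in> support_interior \<mu> \<Longrightarrow> b \<in> support_interior \<mu> \<Longrightarrow> {a..b} \<subseteq> support_interior \<mu>"
  unfolding support_interior_def by (auto; meson ereal_less_eq(3) le_less_trans less_le_trans)

lemma emeasure_above_supp_pos:
  assumes "ereal x < supp_upper \<mu>" shows "0 < emeasure \<mu> {x<..}"
proof -
  obtain y where "y \<in> measure_support \<mu>" "x < y"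
    using assms unfolding supp_upper_def less_SUP_iff by auto
  then show ?thesis unfolding measure_support_def by auto
qed

lemma emeasure_below_supp_pos:
  assumes "supp_lower \<mu> < ereal x" shows "0 < emeasure \<mu> {..<x}"
proof -
  obtain y where "y \<in> measure_support \<mu>" "y < x"
    using assms unfolding supp_lower_def INF_less_iff by auto
  then show ?thesis unfolding measure_support_def by auto
qed

text \<open>The complement of the support is covered by those members of a countable basis that have
  measure 0.\<close>

lemma AE_measure_support:
  assumes "sets \<mu> = sets borel" shows "AE x in \<mu>. x \<in> measure_support \<mu>"
proof -
  obtain \<B> :: "real set set" where \<B>: "countable \<B>" "topological_basis \<B>"
    using ex_countable_basis by auto
  let ?N = "\<Union>{U \<in> \<B>. emeasure \<mu> U = 0}"
  have "(\<Union>U\<in>{U \<in> \<B>. emeasure \<mu> U = 0}. U) \<in> null_sets \<mu>"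
  proof (rule null_sets_UN')
    show "countable {U \<in> \<B>. emeasure \<mu> U = 0}" using \<B>(1) by auto
    fix U assume "U \<in> {U \<in> \<B>. emeasure \<mu> U = 0}"
    then show "U \<in> null_sets \<mu>"
      using topological_basis_open[OF \<B>(2), of U] assms by auto
  qed
  then have "?N \<in> null_sets \<mu>" by simp
  moreover have "{x \<in> space \<mu>. x \<notin> measure_support \<mu>} \<subseteq> ?N"
  proof
    fix x assume "x \<in> {x \<in> space \<mu>. x \<notin> measure_support \<mu>}"
    then obtain U where U: "open U" "x \<in> U" "emeasure \<mu> U = 0"
      by (auto simp: measure_support_def)
    then obtain V where V: "V \<in> \<B>" "x \<in> V" "V \<subseteq> U"
      using topological_basisE[OF \<B>(2)] by metis
    have "emeasure \<mu> V \<le> emeasure \<mu> U"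
      using U(1) V(3) assms by (intro emeasure_mono) auto
    then show "x \<in> ?N" using U V by auto
  qed
  ultimately show ?thesis by (rule AE_I')
qed

lemma AE_supp_bounds:
  assumes "sets \<mu> = sets borel" shows "AE x in \<mu>. supp_lower \<mu> \<le> ereal x \<and> ereal x \<le> supp_upper \<mu>"
  using AE_measure_support[OF assms]
  by eventually_elim (auto simp: supp_lower_def supp_upper_def intro: INF_lower SUP_upper)

lemma gap_eq_0_outside:
  assumes \<nu>: "centred_law \<nu> x0" and bounds: "AE x in \<nu>. l \<le> ereal x \<and> ereal x \<le> u"
    and lx0: "l < ereal x0" "ereal x0 < u" and x: "ereal x \<le> l \<or> u \<le> ereal x"
  shows "gap \<nu> x0 x = 0"
  using x
proof
  assume x: "u \<le> ereal x"
  have "x0 \<le> x" using less_le_trans[OF lx0(2) x] by simp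
  moreover have "(\<integral>y. max 0 (y - x) \<partial>\<nu>) = 0"
  proof (rule integral_eq_zero_AE)
    show "AE y in \<nu>. max 0 (y - x) = 0" using bounds
    proof eventually_elim
      case (elim y)
      then have "ereal y \<le> ereal x" using x by (meson order_trans)
      then show ?case by simp
    qed
  qed
  ultimately show ?thesis using gap_eq(1)[OF \<nu>, of x] by simp
next
  assume x: "ereal x \<le> l"
  have "x \<le> x0" using le_less_trans[OF x lx0(1)] by simp
  moreover have "(\<integral>y. max 0 (x - y) \<partial>\<nu>) = 0"
  proof (rule integral_eq_zero_AE)
    show "AE y in \<nu>. max 0 (x - y) = 0" using bounds
    proof eventually_elim
      case (elim y)
      then have "ereal x \<le> ereal y" using x by (meson order_trans)
      then show ?case by simp
    qed
  qed
  ultimately show ?thesis using gap_eq(2)[OF \<nu>, of x] by simp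
qed

locale target_law =
  fixes \<mu> :: "real measure" and x0 :: real
  assumes centred: "centred_law \<mu> x0" and not_point_mass: "\<And>a. \<mu> \<noteq> return borel a"
begin

sublocale \<mu>: prob_space \<mu> using centred by (rule centred_lawD)

lemma sets_\<mu> [measurable_cong]: "sets \<mu> = sets borel" using centred by (rule centred_lawD)

lemma space_\<mu> [simp]: "space \<mu> = UNIV" using centred by (rule centred_lawD)

lemma \<mu>_not_concentrated: "\<not> (AE x in \<mu>. x = x0)"
proof
  assume ae: "AE x in \<mu>. x = x0"
  have "\<mu> = return borel x0"
  proof (rule measure_eqI)
    fix A assume "A \<in> sets \<mu>"
    then have A: "A \<in> sets borel" by (simp add: sets_\<mu>)
    have "emeasure \<mu> A = (\<integral>\<^sup>+x. indicator A x \<partial>\<mu>)" using A by (simp add: sets_\<mu>)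
    also have "\<dots> = (\<integral>\<^sup>+x. indicator A x0 \<partial>\<mu>)" using ae by (intro nn_integral_cong_AE) auto
    also have "\<dots> = indicator A x0" by (simp add: \<mu>.emeasure_space_1[simplified])
    finally show "emeasure \<mu> A = emeasure (return borel x0) A" using A by simp
  qed (simp add: sets_\<mu>)
  then show False using not_point_mass by auto
qed

text \<open>Otherwise \<open>x - x0\<close> would have constant sign under \<open>\<mu>\<close>
  while having mean 0, which would concentrate \<open>\<mu>\<close> at \<open>x0\<close>.\<close>

lemma x0_interior: "x0 \<in> support_interior \<mu>"
proof -
  note i = centred_lawD(3)[OF centred]
  have *: False if "AE x in \<mu>. 0 \<le> c * (x - x0)" "c \<noteq> 0" for c :: real
  proof -
    have "integrable \<mu> (\<lambda>x. c * (x - x0))" using i by simp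
    moreover have "(\<integral>x. c * (x - x0) \<partial>\<mu>) = 0"
      using i centred_lawD(4)[OF centred] \<mu>.prob_space by simp
    ultimately have "AE x in \<mu>. c * (x - x0) = 0"
      using that(1) by (subst integral_nonneg_eq_0_iff_AE[symmetric]) auto
    then show False using \<mu>_not_concentrated that(2) by simp
  qed
  have "supp_lower \<mu> < ereal x0"
  proof (rule ccontr)
    assume "\<not> ?thesis"
    then have le: "ereal x0 \<le> supp_lower \<mu>" by (simp add: not_less)
    have "AE x in \<mu>. 0 \<le> 1 * (x - x0)" using AE_supp_bounds[OF sets_\<mu>]
    proof eventually_elim
      case (elim x)
      then have "ereal x0 \<le> ereal x" using le by (meson order_trans)
      then show ?case by simp
    qed
    then show False using *[of 1] by simp
  qed
  moreover have "ereal x0 < supp_upper \<mu>"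
  proof (rule ccontr)
    assume "\<not> ?thesis"
    then have le: "supp_upper \<mu> \<le> ereal x0" by (simp add: not_less)
    have "AE x in \<mu>. 0 \<le> (-1) * (x - x0)" using AE_supp_bounds[OF sets_\<mu>]
    proof eventually_elim
      case (elim x)
      then have "ereal x \<le> ereal x0" using le by (meson order_trans)
      then show ?case by simp
    qed
    then show False using *[of "-1"] by simp
  qed
  ultimately show ?thesis by (simp add: support_interior_def)
qed

text \<open>\<open>\<mu>\<close> charges the half-line beyond \<open>x\<close>, away from
  \<open>x0\<close>, so the positive part in \<open>gap_eq\<close> is not almost surely 0. Hence the
  reciprocal \<open>1 / w\<close> that defines the speed measure is a genuine one on the open
  interval.\<close>

lemma gap_pos:
  assumes x: "x \<in> support_interior \<mu>" shows "0 < gap \<mu> x0 x"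
proof -
  have pos: "0 < (\<integral>y. max 0 (c * (y - x)) \<partial>\<mu>)"
    if "0 < emeasure \<mu> {y. 0 < c * (y - x)}" for c
  proof -
    have "integrable \<mu> (\<lambda>y. max 0 (c * (y - x)))"
      using centred_lawD(3)[OF centred] by (intro Bochner_Integration.integrable_max) auto
    moreover have "\<not> (AE y in \<mu>. max 0 (c * (y - x)) = 0)"
    proof
      assume "AE y in \<mu>. max 0 (c * (y - x)) = 0"
      then have "AE y in \<mu>. \<not> 0 < c * (y - x)" by eventually_elim (auto simp: max_def split: if_splits)
      moreover have "{y. 0 < c * (y - x)} \<in> sets \<mu>" by measurable
      ultimately have "emeasure \<mu> {y. 0 < c * (y - x)} = 0"
        by (subst (asm) AE_iff_measurable[where N="{y. 0 < c * (y - x)}"]) auto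
      then show False using that by simp
    qed
    ultimately have "(\<integral>y. max 0 (c * (y - x)) \<partial>\<mu>) \<noteq> 0"
      by (subst integral_nonneg_eq_0_iff_AE) auto
    moreover have "0 \<le> (\<integral>y. max 0 (c * (y - x)) \<partial>\<mu>)" by (intro integral_nonneg_AE) auto
    ultimately show ?thesis by linarith
  qed
  show ?thesis
  proof (cases "x0 \<le> x")
    case True
    have "{y. 0 < 1 * (y - x)} = {x<..}" by auto
    then show ?thesis using pos[of 1] emeasure_above_supp_pos[of x \<mu>] x True
      by (simp add: gap_eq(1)[OF centred True] support_interior_def)
  next
    case False
    have "{y. 0 < (-1) * (y - x)} = {..<x}" by auto
    then show ?thesis using pos[of "-1"] emeasure_below_supp_pos[of \<mu> x] x False
      by (simp add: gap_eq(2)[OF centred] support_interior_def)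
  qed
qed

end

section \<open>The additive functional\<close>

locale embedding = brownian_local_time_space M F B L x0 + target_law \<mu> x0
  for M :: "'a measure" and F B L x0 and \<mu> :: "real measure" +
  fixes T :: "'a \<Rightarrow> real"
  assumes T_F0: "T \<in> borel_measurable (F 0)"
    and T_nonneg: "\<And>\<omega>. \<omega> \<in> space M \<Longrightarrow> 0 \<le> T \<omega>"
    and T_exponential: "distributed M lborel T (exponential_density 1)"
begin

abbreviation "I \<equiv> support_interior \<mu>"
abbreviation "ends \<equiv> support_ends \<mu>"
abbreviation "w \<equiv> gap \<mu> x0"

lemma w_continuous: "continuous_on A w"
  by (rule continuous_on_gap[OF centred])

lemma w_measurable [measurable]: "w \<in> borel_measurable borel"
  by (rule borel_measurable_continuous_onI[OF w_continuous])

lemma I_borel [measurable]: "I \<in> sets borel"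
  using open_support_interior by auto

lemma ends_not_interior: "e \<in> ends \<Longrightarrow> e \<notin> I"
  by (auto simp: support_ends_def support_interior_def)

definition rate :: "real \<Rightarrow> ennreal" where
  "rate x = indicator I x * ennreal (1 / w x)"

lemma rate_measurable [measurable]: "rate \<in> borel_measurable borel"
  unfolding rate_def by measurable

text \<open>A version of the additive functional of any speed measure for \<open>\<mu>\<close>, independent of how the
  infinite mass outside of the support is distributed.\<close>

definition clock :: "real \<Rightarrow> 'a \<Rightarrow> ennreal" where
  "clock t \<omega> = (\<integral>\<^sup>+x. rate x * ennreal (L x t \<omega>) \<partial>\<mu>) + (\<Sum>e\<in>ends. \<infinity> * ennreal (L e t \<omega>))"

lemma clock_mono: "\<omega> \<in> space M \<Longrightarrow> s \<le> t \<Longrightarrow> clock s \<omega> \<le> clock t \<omega>"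
  unfolding clock_def
  by (intro add_mono nn_integral_mono mult_left_mono sum_mono ennreal_leI L_mono) auto

lemma clock_start: "t \<le> 0 \<Longrightarrow> clock t \<omega> = 0"
  by (simp add: clock_def L_start)

lemma L_space_measurable [measurable]:
  "\<omega> \<in> space M \<Longrightarrow> (\<lambda>x. L x t \<omega>) \<in> borel_measurable borel"
  by (rule borel_measurable_continuous_onI[OF L_continuous_space])

lemma clock_adapted: "0 \<le> t \<Longrightarrow> clock t \<in> borel_measurable (F (ennreal t))"
proof -
  assume t: "0 \<le> t"
  have [measurable]: "(\<lambda>(x, \<omega>). L x t \<omega>) \<in> borel_measurable (borel \<Otimes>\<^sub>M F (ennreal t))"
    by (rule measurable_continuous_process) (auto intro: L_adapted[OF t] L_continuous_space simp: space_F)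
  have [measurable]: "L e t \<in> borel_measurable (F (ennreal t))" for e by (rule L_adapted[OF t])
  show ?thesis unfolding clock_def by measurable
qed

lemma clock_measurable [measurable]: "clock t \<in> borel_measurable M"
proof (cases "0 \<le> t")
  case True then show ?thesis by (intro F_measurable_M[OF clock_adapted])
next
  case False
  then have "clock t = (\<lambda>\<omega>. 0)" by (auto simp: clock_start)
  then show ?thesis by simp
qed

text \<open>\<open>clock\<close> is a functional of the path only up to a null set, through
  \<open>path_local_time\<close>; under the integral the exchange is harmless.\<close>

lemma exponential_min_clock:
  assumes s: "0 \<le> s" and t: "0 \<le> t" and g [measurable]: "g \<in> borel_measurable borel"
  shows "(\<integral>\<^sup>+\<omega>. ennreal (g (B s \<omega>)) * min (ennreal (T \<omega>)) (clock t \<omega>) \<partial>M)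
       = (\<integral>\<^sup>+\<omega>. ennreal (g (B s \<omega>)) * indicator {\<omega>. ennreal (T \<omega>) < clock t \<omega>} \<omega> \<partial>M)"
proof -
  define \<Phi> where "\<Phi> \<omega> = (\<integral>\<^sup>+x. rate x * path_local_time x t \<omega> \<partial>\<mu>) + (\<Sum>e\<in>ends. \<infinity> * path_local_time e t \<omega>)" for \<omega>
  have [measurable]: "(\<lambda>(x, \<omega>). path_local_time x t \<omega>) \<in> borel_measurable (borel \<Otimes>\<^sub>M path_sigma {0..})"
    by (rule path_local_time_measurable)
  have [measurable]: "\<Phi> \<in> borel_measurable (path_sigma {0..})" unfolding \<Phi>_def by measurable
  have Bs[measurable]: "B s \<in> borel_measurable (path_sigma {0..})" using s by (intro measurable_path_sigma) auto
  have ae: "AE \<omega> in M. clock t \<omega> = \<Phi> \<omega>"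
    using path_local_time_eq by eventually_elim (use t in \<open>simp add: clock_def \<Phi>_def\<close>)
  have "(\<integral>\<^sup>+\<omega>. ennreal (g (B s \<omega>)) * min (ennreal (T \<omega>)) (clock t \<omega>) \<partial>M)
      = (\<integral>\<^sup>+\<omega>. ennreal (g (B s \<omega>)) * min (ennreal (T \<omega>)) (\<Phi> \<omega>) \<partial>M)"
    using ae by (intro nn_integral_cong_AE) auto
  also have "\<dots> = (\<integral>\<^sup>+\<omega>. ennreal (g (B s \<omega>)) * indicator {\<omega>. ennreal (T \<omega>) < \<Phi> \<omega>} \<omega> \<partial>M)"
    by (rule exponential_min_path[OF T_F0 T_exponential]) measurable
  also have "\<dots> = (\<integral>\<^sup>+\<omega>. ennreal (g (B s \<omega>)) * indicator {\<omega>. ennreal (T \<omega>) < clock t \<omega>} \<omega> \<partial>M)"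
    using ae by (intro nn_integral_cong_AE) (auto simp: indicator_def)
  finally show ?thesis .
qed

text \<open>\<open>B\<close> starts in \<open>I\<close>, so if it is found outside, the bound on
  that side is finite and was reached on the way, by the intermediate value theorem.\<close>

lemma hits_end:
  assumes \<omega>: "\<omega> \<in> space M" and r: "0 \<le> r" "B r \<omega> \<notin> I"
  obtains r' where "0 \<le> r'" "r' \<le> r" "B r' \<omega> \<in> ends"
proof -
  have cont: "continuous_on {0..r} (\<lambda>t. B t \<omega>)" by (rule continuous_on_subset[OF B_continuous[OF \<omega>]]) auto
  have x0: "supp_lower \<mu> < ereal x0" "ereal x0 < supp_upper \<mu>" using x0_interior by (auto simp: support_interior_def)
  have B0: "B 0 \<omega> = x0" by (simp add: B_start)
  consider "supp_upper \<mu> \<le> ereal (B r \<omega>)" | "ereal (B r \<omega>) \<le> supp_lower \<mu>"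
    using r(2) by (auto simp: support_interior_def not_less)
  then show ?thesis
  proof cases
    case 1
    then obtain u where u: "supp_upper \<mu> = ereal u" using x0 by (cases "supp_upper \<mu>") auto
    have "\<exists>r'\<ge>0. r' \<le> r \<and> B r' \<omega> = u"
      using 1 x0 u B0 r(1) by (intro IVT' cont) auto
    then show ?thesis using that u by (auto simp: support_ends_def)
  next
    case 2
    then obtain u where u: "supp_lower \<mu> = ereal u" using x0 by (cases "supp_lower \<mu>") auto
    have "\<exists>r'\<ge>0. r' \<le> r \<and> B r' \<omega> = u"
      using 2 x0 u B0 r(1) by (intro IVT2' cont) auto
    then show ?thesis using that u by (auto simp: support_ends_def)
  qed
qed

text \<open>While no local time has accumulated at the ends, the path stays in the closed interval
  and does not move after reaching an end. Local times are inspected strictly before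
  \<open>s\<close>, since the clock is controlled directly only before a value of the time
  change.\<close>

definition confined :: "'a \<Rightarrow> bool" where
  "confined \<omega> \<longleftrightarrow> (\<forall>s. (\<forall>e\<in>ends. \<forall>q\<in>{0..<s}. L e q \<omega> = 0) \<longrightarrow>
     (\<forall>r\<in>{0..s}. B r \<omega> \<in> I \<union> ends \<and> (B r \<omega> \<notin> I \<longrightarrow> B s \<omega> = B r \<omega>)))"

lemma AE_confined: "AE \<omega> in M. confined \<omega>"
proof -
  have "AE \<omega> in M. \<forall>e\<in>ends. \<forall>s r. 0 \<le> r \<longrightarrow> r \<le> s \<longrightarrow> (\<forall>q\<in>{0..<s}. L e q \<omega> = 0) \<longrightarrow> B r \<omega> = e \<longrightarrow> B s \<omega> = e"
    using finite_support_ends by (intro AE_ball_countable' absorbed_until_local_time) (auto intro: countable_finite)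
  then show ?thesis using AE_space
  proof eventually_elim
    case (elim \<omega>)
    show ?case unfolding confined_def
    proof (intro allI impI ballI)
      fix s r assume L0: "\<forall>e\<in>ends. \<forall>q\<in>{0..<s}. L e q \<omega> = 0" and r: "r \<in> {0..s}"
      have abs: "B t \<omega> = B r' \<omega>" if "B r' \<omega> \<in> ends" "0 \<le> r'" "r' \<le> t" "t \<le> s" for t r'
      proof -
        have "\<forall>q\<in>{0..<t}. L (B r' \<omega>) q \<omega> = 0" using L0 that by auto
        then show ?thesis using bspec[OF elim(1) that(1)] that(2,3) by blast
      qed
      have "B r \<omega> \<in> ends" if out: "B r \<omega> \<notin> I"
      proof -
        obtain r' where "0 \<le> r'" "r' \<le> r" "B r' \<omega> \<in> ends" using hits_end[OF elim(2) _ out] r by auto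
        then show ?thesis using abs[of r' r] r by auto
      qed
      then show "B r \<omega> \<in> I \<union> ends \<and> (B r \<omega> \<notin> I \<longrightarrow> B s \<omega> = B r \<omega>)"
        using abs[of r s] r by auto
    qed
  qed
qed

lemma clock_finite_ends:
  assumes "\<omega> \<in> space M" "clock q \<omega> < \<infinity>" "e \<in> ends" shows "L e q \<omega> = 0"
proof (rule ccontr)
  assume "L e q \<omega> \<noteq> 0"
  then have "0 < ennreal (L e q \<omega>)" using L_nonneg[OF assms(1), of e q] by simp
  then have "\<infinity> * ennreal (L e q \<omega>) = \<infinity>" by (simp add: ennreal_top_mult)
  moreover have "\<infinity> * ennreal (L e q \<omega>) \<le> (\<Sum>e\<in>ends. \<infinity> * ennreal (L e q \<omega>))"
    using finite_support_ends assms(3) by (intro member_le_sum) auto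
  moreover have "\<dots> \<le> clock q \<omega>" unfolding clock_def by simp
  ultimately show False using assms(2) by (simp add: top_unique)
qed

lemma confinedD:
  assumes \<omega>: "\<omega> \<in> space M" "confined \<omega>" and s: "\<And>q. 0 \<le> q \<Longrightarrow> q < s \<Longrightarrow> clock q \<omega> < \<infinity>" and r: "0 \<le> r" "r \<le> s"
  shows "B r \<omega> \<in> I \<union> ends" "B r \<omega> \<notin> I \<Longrightarrow> B s \<omega> = B r \<omega>"
proof -
  have "\<forall>e\<in>ends. \<forall>q\<in>{0..<s}. L e q \<omega> = 0" using clock_finite_ends[OF \<omega>(1) s] by auto
  then show "B r \<omega> \<in> I \<union> ends" "B r \<omega> \<notin> I \<Longrightarrow> B s \<omega> = B r \<omega>"
    using \<omega>(2) r unfolding confined_def by auto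
qed

lemma w_bounded_below:
  assumes "{a..b} \<subseteq> I" obtains c where "0 < c" "\<And>x. x \<in> {a..b} \<Longrightarrow> c \<le> w x"
proof (cases "a \<le> b")
  case True
  obtain x where x: "x \<in> {a..b}" "\<And>y. y \<in> {a..b} \<Longrightarrow> w x \<le> w y"
    using continuous_attains_inf[of "{a..b}" w] True w_continuous by auto
  have "0 < w x" using gap_pos assms x(1) by auto
  then show ?thesis using that[of "w x"] x(2) by auto
qed (use that[of 1] in auto)

section \<open>Speed measures for the target, and the clock\<close>

context
  fixes m :: "real measure" assumes m: "speed_measure_for \<mu> x0 m"
begin

lemma sets_m [measurable_cong]: "sets m = sets borel"
  using m by (simp add: speed_measure_for_def)

lemma space_m [simp]: "space m = UNIV"
  using sets_eq_imp_space_eq[OF sets_m] by simp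

lemma speed_measure_interior:
  assumes h[measurable]: "h \<in> borel_measurable borel"
  shows "(\<integral>\<^sup>+x. indicator I x * h x \<partial>m) = (\<integral>\<^sup>+x. rate x * h x \<partial>\<mu>)"
proof -
  have "density m (indicator I) = density \<mu> rate"
  proof (rule measure_eqI)
    show "sets (density m (indicator I)) = sets (density \<mu> rate)" by (simp add: sets_m sets_\<mu>)
    fix D assume "D \<in> sets (density m (indicator I))"
    then have D[measurable]: "D \<in> sets borel" by (simp add: sets_m)
    have "emeasure (density m (indicator I)) D = (\<integral>\<^sup>+x. indicator I x * indicator D x \<partial>m)"
      by (rule emeasure_density) (auto simp: sets_m)
    also have "\<dots> = (\<integral>\<^sup>+x. indicator (D \<inter> I) x \<partial>m)"
      by (intro nn_integral_cong) (auto simp: indicator_def)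
    also have "\<dots> = emeasure m (D \<inter> I)" by simp
    also have "\<dots> = emeasure (density \<mu> (\<lambda>x. ennreal (1 / (potential \<mu> x - \<bar>x - x0\<bar>)))) (D \<inter> I)"
      using m D I_borel unfolding speed_measure_for_def support_interior_def
      by (metis (no_types, lifting) Int_lower2 sets.Int support_interior_def I_borel)
    also have "\<dots> = emeasure (density \<mu> (\<lambda>x. ennreal (1 / w x))) (D \<inter> I)"
      by (simp add: gap_def)
    also have "\<dots> = emeasure (density \<mu> rate) D"
      by (subst (1 2) emeasure_density) (auto intro!: nn_integral_cong simp: indicator_def rate_def)
    finally show "emeasure (density m (indicator I)) D = emeasure (density \<mu> rate) D" .
  qed
  then have "(\<integral>\<^sup>+x. h x \<partial>density m (indicator I)) = (\<integral>\<^sup>+x. h x \<partial>density \<mu> rate)" by simp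
  then show ?thesis by (subst (asm) (1 2) nn_integral_density) auto
qed

lemma speed_measure_compact:
  assumes "{a..b} \<subseteq> I" shows "emeasure m {a..b} < \<infinity>"
proof -
  obtain c where c: "0 < c" "\<And>x. x \<in> {a..b} \<Longrightarrow> c \<le> w x" using w_bounded_below[OF assms] by blast
  have "emeasure m {a..b} = (\<integral>\<^sup>+x. indicator {a..b} x \<partial>m)"
    by (simp add: sets_m)
  also have "\<dots> = (\<integral>\<^sup>+x. indicator I x * indicator {a..b} x \<partial>m)"
    using assms by (intro nn_integral_cong) (auto simp: indicator_def)
  also have "\<dots> = (\<integral>\<^sup>+x. rate x * indicator {a..b} x \<partial>\<mu>)" by (rule speed_measure_interior) auto
  also have "\<dots> \<le> (\<integral>\<^sup>+x. ennreal (1 / c) \<partial>\<mu>)"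
  proof (rule nn_integral_mono)
    fix x
    show "rate x * indicator {a..b} x \<le> ennreal (1 / c)"
    proof (cases "x \<in> {a..b}")
      case True
      have "1 / w x \<le> 1 / c" using c(1) c(2)[OF True] by (intro divide_left_mono) auto
      then show ?thesis using True assms by (auto simp: rate_def intro!: ennreal_leI)
    qed simp
  qed
  also have "\<dots> < \<infinity>" using \<mu>.emeasure_space_1 by (simp add: ennreal_mult_less_top)
  finally show ?thesis .
qed

lemma ell_bounds: "ell_plus m x0 = supp_upper \<mu>" "ell_minus m x0 = supp_lower \<mu>"
proof -
  have x0: "supp_lower \<mu> < ereal x0" "ereal x0 < supp_upper \<mu>" using x0_interior by (auto simp: support_interior_def)
  show "ell_plus m x0 = supp_upper \<mu>" unfolding ell_plus_def
  proof (intro antisym Sup_least)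
    fix z assume "z \<in> {ereal x |x. x0 \<le> x \<and> emeasure m {x0..x} < \<infinity>}"
    then obtain x where "z = ereal x" "emeasure m {x0..x} < \<infinity>" by auto
    then show "z \<le> supp_upper \<mu>" using m unfolding speed_measure_for_def by (metis less_irrefl linear)
  next
    show "supp_upper \<mu> \<le> Sup {ereal x |x. x0 \<le> x \<and> emeasure m {x0..x} < \<infinity>}"
    proof (rule dense_le_bounded[OF x0(2)])
      fix z assume z: "ereal x0 < z" "z < supp_upper \<mu>"
      then obtain x where x: "z = ereal x" by (cases z) auto
      then have "x \<in> I" using z less_trans[OF x0(1) z(1)] by (simp add: support_interior_def)
      then have "emeasure m {x0..x} < \<infinity>" by (intro speed_measure_compact support_interior_interval x0_interior)
      then show "z \<le> Sup {ereal x |x. x0 \<le> x \<and> emeasure m {x0..x} < \<infinity>}" using x z(1) by (intro Sup_upper) auto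
    qed
  qed
  show "ell_minus m x0 = supp_lower \<mu>" unfolding ell_minus_def
  proof (intro antisym Inf_greatest)
    fix z assume "z \<in> {ereal y |y. y \<le> x0 \<and> emeasure m {y..<x0} < \<infinity>}"
    then obtain x where "z = ereal x" "emeasure m {x..<x0} < \<infinity>" by auto
    then show "supp_lower \<mu> \<le> z" using m unfolding speed_measure_for_def by (metis less_irrefl linear)
  next
    show "Inf {ereal y |y. y \<le> x0 \<and> emeasure m {y..<x0} < \<infinity>} \<le> supp_lower \<mu>"
    proof (rule dense_ge_bounded[OF x0(1)])
      fix z assume z: "supp_lower \<mu> < z" "z < ereal x0"
      then obtain x where x: "z = ereal x" by (cases z) auto
      then have "x \<in> I" using z less_trans[OF z(2) x0(2)] by (simp add: support_interior_def)
      then have "emeasure m {x..x0} < \<infinity>" by (intro speed_measure_compact support_interior_interval x0_interior)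
      moreover have "emeasure m {x..<x0} \<le> emeasure m {x..x0}" by (intro emeasure_mono) auto
      ultimately have "emeasure m {x..<x0} < \<infinity>" by (rule le_less_trans[rotated])
      then show "Inf {ereal y |y. y \<le> x0 \<and> emeasure m {y..<x0} < \<infinity>} \<le> z" using x z(2) by (intro Inf_lower) auto
    qed
  qed
qed

text \<open>\<open>m\<close> gives infinite mass to the interval between \<open>x0\<close> and
  \<open>e\<close>, but finite mass to compact subintervals of \<open>I\<close>; so the infinite
  mass accumulates at \<open>e\<close>.\<close>

lemma speed_measure_end:
  assumes e: "e \<in> ends" and \<delta>: "0 < \<delta>" shows "emeasure m {e - \<delta><..<e + \<delta>} = \<infinity>"
proof -
  have x0: "supp_lower \<mu> < ereal x0" "ereal x0 < supp_upper \<mu>" using x0_interior by (auto simp: support_interior_def)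
  have *: "emeasure m {e - \<delta><..<e + \<delta>} = \<infinity>" if "emeasure m J = \<infinity>" "J \<in> sets borel"
    "J \<subseteq> {e - \<delta><..<e + \<delta>} \<union> {a..b}" "{a..b} \<subseteq> I" for J a b
  proof (rule ccontr)
    assume "emeasure m {e - \<delta><..<e + \<delta>} \<noteq> \<infinity>"
    then have "emeasure m {e - \<delta><..<e + \<delta>} + emeasure m {a..b} < \<infinity>"
      using speed_measure_compact[OF that(4)] by (simp add: less_top)
    moreover have "emeasure m J \<le> emeasure m ({e - \<delta><..<e + \<delta>} \<union> {a..b})"
      using that by (intro emeasure_mono) (auto simp: sets_m)
    moreover have "\<dots> \<le> emeasure m {e - \<delta><..<e + \<delta>} + emeasure m {a..b}"
      by (intro emeasure_subadditive) (auto simp: sets_m)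
    ultimately have "emeasure m J < \<infinity>" by (meson le_less_trans order_trans)
    then show False using that(1) by simp
  qed
  consider "ereal e = supp_upper \<mu>" | "ereal e = supp_lower \<mu>" using e by (auto simp: support_ends_def)
  then show ?thesis
  proof cases
    case 1
    have inf: "emeasure m {x0..e} = \<infinity>" using m 1 by (auto simp: speed_measure_for_def)
    have lt: "x0 < e" using x0(2) 1 by (metis less_ereal.simps(1))
    have "max x0 (e - \<delta> / 2) \<in> I"
    proof -
      have "x0 \<le> max x0 (e - \<delta> / 2)" "max x0 (e - \<delta> / 2) < e" using lt \<delta> by auto
      then have "ereal x0 \<le> ereal (max x0 (e - \<delta> / 2))" "ereal (max x0 (e - \<delta> / 2)) < ereal e"
        by (simp_all only: ereal_less_eq less_ereal.simps)
      then show ?thesis unfolding support_interior_def mem_Collect_eq using x0(1) 1 less_le_trans by metis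
    qed
    then show ?thesis
      using \<delta> by (intro *[OF inf _ _ support_interior_interval[OF x0_interior]]) auto
  next
    case 2
    have inf: "emeasure m {e..<x0} = \<infinity>" using m 2 by (auto simp: speed_measure_for_def)
    have lt: "e < x0" using x0(1) 2 by (metis less_ereal.simps(1))
    have "min x0 (e + \<delta> / 2) \<in> I"
    proof -
      have "min x0 (e + \<delta> / 2) \<le> x0" "e < min x0 (e + \<delta> / 2)" using lt \<delta> by auto
      then have "ereal (min x0 (e + \<delta> / 2)) \<le> ereal x0" "ereal e < ereal (min x0 (e + \<delta> / 2))"
        by (simp_all only: ereal_less_eq less_ereal.simps)
      then show ?thesis unfolding support_interior_def mem_Collect_eq using x0(2) 2 le_less_trans by metis
    qed
    then show ?thesis
      using \<delta> by (intro *[OF inf _ _ support_interior_interval[OF _ x0_interior]]) auto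
  qed
qed

text \<open>Without local time at the ends the path has stayed in the closed interval, so the local
  time vanishes off \<open>I\<close>, and on \<open>I\<close> the measures \<open>m\<close> and
  \<open>density \<mu> rate\<close> agree. With positive local time at an end \<open>e\<close> it is
  bounded below near \<open>e\<close> by continuity, and \<open>m\<close> has infinite mass there,
  so both sides are \<open>\<infinity>\<close>.\<close>

lemma additive_functional_eq_clock:
  assumes \<omega>: "\<omega> \<in> space M" "confined \<omega>" and t: "0 \<le> t"
  shows "additive_functional m L t \<omega> = clock t \<omega>"
proof -
  have Lm[measurable]: "(\<lambda>x. L x t \<omega>) \<in> borel_measurable borel" by (rule L_space_measurable[OF \<omega>(1)])
  show ?thesis
  proof (cases "\<forall>e\<in>ends. L e t \<omega> = 0")
    case True
    have "L e q \<omega> = 0" if "e \<in> ends" "q \<in> {0..<t}" for e q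
      using True that L_mono[OF \<omega>(1), of q t e] L_nonneg[OF \<omega>(1), of e q] by auto
    then have conf: "B r \<omega> \<in> I \<union> ends" if "r \<in> {0..t}" for r
      using \<omega>(2) that unfolding confined_def by blast
    have "L x t \<omega> = 0" if "x \<notin> I" for x
    proof (cases "x \<in> ends")
      case False
      then have "\<forall>r\<in>{0..t}. B r \<omega> \<noteq> x" using conf that by blast
      from L_support[OF \<omega>(1) t this] show ?thesis by (simp add: L_start)
    qed (use True in simp)
    then have "additive_functional m L t \<omega> = (\<integral>\<^sup>+x. indicator I x * ennreal (L x t \<omega>) \<partial>m)"
      unfolding additive_functional_def by (intro nn_integral_cong) (auto simp: indicator_def)
    also have "\<dots> = (\<integral>\<^sup>+x. rate x * ennreal (L x t \<omega>) \<partial>\<mu>)" by (rule speed_measure_interior) measurable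
    also have "\<dots> = clock t \<omega>" using True by (simp add: clock_def)
    finally show ?thesis .
  next
    case False
    then obtain e where e: "e \<in> ends" "L e t \<omega> \<noteq> 0" by auto
    have pos: "0 < L e t \<omega>" using e(2) L_nonneg[OF \<omega>(1), of e t] by simp
    have "isCont (\<lambda>x. L x t \<omega>) e"
      using L_continuous_space[OF \<omega>(1), of t] by (simp add: continuous_on_eq_continuous_at)
    then have "((\<lambda>x. L x t \<omega>) \<longlongrightarrow> L e t \<omega>) (nhds e)"
      using tendsto_at_iff_tendsto_nhds[of "\<lambda>x. L x t \<omega>" e] by (simp add: continuous_at)
    then have "eventually (\<lambda>x. L e t \<omega> / 2 < L x t \<omega>) (nhds e)"
      using pos by (intro order_tendstoD(1)) auto
    then obtain \<delta> where \<delta>: "0 < \<delta>" "\<And>x. dist x e < \<delta> \<Longrightarrow> L e t \<omega> / 2 < L x t \<omega>"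
      by (auto simp: eventually_nhds_metric)
    have "\<infinity> = ennreal (L e t \<omega> / 2) * emeasure m {e - \<delta><..<e + \<delta>}"
      using pos by (simp add: speed_measure_end[OF e(1) \<delta>(1)] ennreal_mult_top)
    also have "\<dots> = (\<integral>\<^sup>+x. ennreal (L e t \<omega> / 2) * indicator {e - \<delta><..<e + \<delta>} x \<partial>m)"
      by (subst nn_integral_cmult_indicator) (auto simp: sets_m)
    also have "\<dots> \<le> additive_functional m L t \<omega>"
      unfolding additive_functional_def
    proof (rule nn_integral_mono)
      fix x
      show "ennreal (L e t \<omega> / 2) * indicator {e - \<delta><..<e + \<delta>} x \<le> ennreal (L x t \<omega>)"
      proof (cases "x \<in> {e - \<delta><..<e + \<delta>}")
        case True
        then have "dist x e < \<delta>" by (auto simp: dist_real_def abs_if)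
        then have "L e t \<omega> / 2 \<le> L x t \<omega>" using \<delta>(2) by (auto intro: less_imp_le)
        then show ?thesis using True by (simp only: indicator_simps mult_1_right ennreal_leI)
      qed simp
    qed
    finally have "additive_functional m L t \<omega> = \<infinity>" by (simp add: top_unique)
    moreover have "clock t \<omega> = \<infinity>"
      using clock_finite_ends[OF \<omega>(1) _ e(1), of t] e(2) by (cases "clock t \<omega>") auto
    ultimately show ?thesis by simp
  qed
qed

end

lemma measurable_\<mu>: "f \<in> measurable borel N \<Longrightarrow> f \<in> measurable \<mu> N"
  by (simp add: measurable_cong_sets[OF sets_\<mu> refl])

section \<open>The stopping time with a finite horizon\<close>

definition \<tau> :: "real \<Rightarrow> 'a \<Rightarrow> real" where
  "\<tau> n = debut n (\<lambda>t \<omega>. ennreal (T \<omega>) < clock t \<omega>)"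

lemma T_measurable [measurable]: "T \<in> borel_measurable M"
  by (rule F_measurable_M[OF T_F0])

text \<open>The case \<open>a = \<infinity>\<close> of \<open>exponential_min\<close>: the mean of
  \<open>T\<close> is the probability that \<open>T\<close> is finite.\<close>

lemma T_integrable: "integrable M T"
proof (rule integrableI_bounded)
  have "(\<integral>\<^sup>+\<omega>. ennreal (norm (T \<omega>)) \<partial>M) = (\<integral>\<^sup>+\<omega>. min (ennreal (T \<omega>)) \<infinity> \<partial>M)"
    using T_nonneg by (intro nn_integral_cong) simp
  also have "\<dots> = (\<integral>\<^sup>+\<omega>. indicator {\<omega>. ennreal (T \<omega>) < \<infinity>} \<omega> \<partial>M)" by (rule exponential_min[OF T_exponential])
  also have "\<dots> \<le> (\<integral>\<^sup>+\<omega>. 1 \<partial>M)" by (intro nn_integral_mono) (simp add: indicator_def)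
  also have "\<dots> < \<infinity>" by (simp add: emeasure_space_1)
  finally show "(\<integral>\<^sup>+\<omega>. ennreal (norm (T \<omega>)) \<partial>M) < \<infinity>" .
qed measurable

lemma clock_exceeds_adapted: "0 \<le> t \<Longrightarrow> {\<omega>\<in>space M. ennreal (T \<omega>) < clock t \<omega>} \<in> sets (F (ennreal t))"
proof -
  assume t: "0 \<le> t"
  have [measurable]: "T \<in> borel_measurable (F (ennreal t))" by (rule F_measurable_mono[OF T_F0]) simp
  have [measurable]: "clock t \<in> borel_measurable (F (ennreal t))" by (rule clock_adapted[OF t])
  have "{\<omega>\<in>space (F (ennreal t)). ennreal (T \<omega>) < clock t \<omega>} \<in> sets (F (ennreal t))" by measurable
  then show ?thesis by (simp add: space_F)
qed

lemma \<tau>_optional: "0 \<le> n \<Longrightarrow> optional_time M F n (\<tau> n)"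
  unfolding \<tau>_def
proof (rule optional_time_debut)
  fix \<omega> and s t :: real assume "\<omega> \<in> space M" "0 \<le> s" "s < t" "ennreal (T \<omega>) < clock s \<omega>"
  then show "\<exists>q\<in>\<rat>. s \<le> q \<and> q < t \<and> ennreal (T \<omega>) < clock q \<omega>"
    using Rats_dense_in_real[of s t] clock_mono[of \<omega> s] by (meson less_imp_le less_le_trans)
qed (use clock_exceeds_adapted in auto)

lemma \<tau>_measurable [measurable]: "0 \<le> n \<Longrightarrow> \<tau> n \<in> borel_measurable M"
  by (rule optional_time_measurable[OF \<tau>_optional])

lemma \<tau>_nonneg: "0 \<le> n \<Longrightarrow> 0 \<le> \<tau> n \<omega>"
  unfolding \<tau>_def by (rule debut_nonneg)

lemma \<tau>_le: "\<tau> n \<omega> \<le> n"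
  unfolding \<tau>_def by (rule debut_le)

lemma clock_before_\<tau>: "t < \<tau> n \<omega> \<Longrightarrow> clock t \<omega> \<le> ennreal (T \<omega>)"
  using not_before_debut[of t n "\<lambda>t \<omega>. ennreal (T \<omega>) < clock t \<omega>" \<omega>] clock_start[of t \<omega>]
  by (cases "0 \<le> t") (auto simp: \<tau>_def not_less)

lemma clock_after_\<tau>:
  assumes "\<omega> \<in> space M" "\<tau> n \<omega> < t" "t \<le> n" shows "ennreal (T \<omega>) < clock t \<omega>"
proof -
  obtain r where "ennreal (T \<omega>) < clock r \<omega>" "r < t"
    using assms(2,3) unfolding \<tau>_def debut_less_iff by auto
  then show ?thesis using clock_mono[OF assms(1), of r t] by (meson less_imp_le less_le_trans)
qed

lemma clock_finite_before_\<tau>: "t < \<tau> n \<omega> \<Longrightarrow> clock t \<omega> < \<infinity>"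
  using clock_before_\<tau>[of t n \<omega>] by (metis ennreal_less_top infinity_ennreal_def le_less_trans)

text \<open>Fatou's lemma along times increasing to \<open>\<tau> n\<close>, at which the clock is
  at most \<open>T\<close>. The terms of the ends vanish at these times and, because local times are
  continuous in time, also in the limit.\<close>

lemma clock_at_\<tau>_le:
  assumes \<omega>: "\<omega> \<in> space M" and n: "0 \<le> n" shows "clock (\<tau> n \<omega>) \<omega> \<le> ennreal (T \<omega>)"
proof (cases "\<tau> n \<omega> = 0")
  case False
  define s where "s = \<tau> n \<omega>"
  have s: "0 < s" using \<tau>_nonneg[OF n, of \<omega>] False by (simp add: s_def)
  define q where "q k = s - s / real (Suc k)" for k
  have q: "q k < s" for k using s by (simp add: q_def)
  have q_lim: "q \<longlonglongrightarrow> s"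
  proof -
    have "(\<lambda>k. s - s * (1 / real (Suc k))) \<longlonglongrightarrow> s - s * 0"
      by (intro tendsto_intros LIMSEQ_Suc lim_1_over_n)
    then show ?thesis by (simp add: q_def[abs_def])
  qed
  have L_lim: "(\<lambda>k. L x (q k) \<omega>) \<longlonglongrightarrow> L x s \<omega>" for x
    by (rule continuous_on_tendsto_compose[OF L_continuous_time[OF \<omega>] q_lim]) auto
  have "L e s \<omega> = 0" if "e \<in> ends" for e
  proof -
    have "L e (q k) \<omega> = 0" for k
    proof (rule clock_finite_ends[OF \<omega> _ that])
      show "clock (q k) \<omega> < \<infinity>" using q[of k] unfolding s_def by (rule clock_finite_before_\<tau>)
    qed
    then show ?thesis using L_lim[of e] by (simp add: LIMSEQ_const_iff)
  qed
  then have "clock s \<omega> = (\<integral>\<^sup>+x. rate x * ennreal (L x s \<omega>) \<partial>\<mu>)" by (simp add: clock_def)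
  also have "\<dots> = (\<integral>\<^sup>+x. liminf (\<lambda>k. rate x * ennreal (L x (q k) \<omega>)) \<partial>\<mu>)"
  proof (rule nn_integral_cong)
    fix x
    have "rate x \<noteq> \<infinity>" by (simp add: rate_def indicator_def)
    then have "(\<lambda>k. rate x * ennreal (L x (q k) \<omega>)) \<longlonglongrightarrow> rate x * ennreal (L x s \<omega>)"
      by (intro ennreal_tendsto_cmult tendsto_ennrealI L_lim) (simp add: less_top)
    then show "rate x * ennreal (L x s \<omega>) = liminf (\<lambda>k. rate x * ennreal (L x (q k) \<omega>))"
      by (simp add: lim_imp_Liminf)
  qed
  also have "\<dots> \<le> liminf (\<lambda>k. \<integral>\<^sup>+x. rate x * ennreal (L x (q k) \<omega>) \<partial>\<mu>)"
  proof (rule nn_integral_liminf, rule measurable_\<mu>)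
    fix k
    have [measurable]: "(\<lambda>x. L x (q k) \<omega>) \<in> borel_measurable borel" by (rule L_space_measurable[OF \<omega>])
    show "(\<lambda>x. rate x * ennreal (L x (q k) \<omega>)) \<in> borel_measurable borel" by measurable
  qed
  also have "\<dots> \<le> liminf (\<lambda>k. ennreal (T \<omega>))"
  proof (intro Liminf_mono always_eventually allI)
    fix k
    have "(\<integral>\<^sup>+x. rate x * ennreal (L x (q k) \<omega>) \<partial>\<mu>) \<le> clock (q k) \<omega>" by (simp add: clock_def)
    also have "\<dots> \<le> ennreal (T \<omega>)" using q by (intro clock_before_\<tau>) (simp add: s_def)
    finally show "(\<integral>\<^sup>+x. rate x * ennreal (L x (q k) \<omega>) \<partial>\<mu>) \<le> ennreal (T \<omega>)" .
  qed
  also have "\<dots> = ennreal (T \<omega>)" by (simp add: Liminf_const)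
  finally show ?thesis by (simp add: s_def)
qed (simp add: clock_start)

lemma clock_upto_\<tau>:
  assumes "\<omega> \<in> space M" "0 \<le> n" "t \<le> \<tau> n \<omega>"
  shows "clock t \<omega> \<le> ennreal (T \<omega>)" "clock t \<omega> < \<infinity>"
proof -
  show "clock t \<omega> \<le> ennreal (T \<omega>)"
    using clock_mono[OF assms(1,3)] clock_at_\<tau>_le[OF assms(1,2)] by simp
  then show "clock t \<omega> < \<infinity>" by (metis ennreal_less_top infinity_ennreal_def le_less_trans)
qed

lemma ends_zero_upto_\<tau>:
  assumes "\<omega> \<in> space M" "0 \<le> n" "t \<le> \<tau> n \<omega>" "e \<in> ends" shows "L e t \<omega> = 0"
  by (rule clock_finite_ends[OF assms(1) clock_upto_\<tau>(2)[OF assms(1-3)] assms(4)])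

lemma clock_eq_upto_\<tau>:
  assumes "\<omega> \<in> space M" "0 \<le> n" "t \<le> \<tau> n \<omega>"
  shows "clock t \<omega> = (\<integral>\<^sup>+x. rate x * ennreal (L x t \<omega>) \<partial>\<mu>)"
  using ends_zero_upto_\<tau>[OF assms] by (simp add: clock_def)

text \<open>Inside the support the clock is right-continuous; at an end it may jump from below \<open>T\<close> to \<open>\<infinity>\<close>.\<close>

lemma clock_at_\<tau>:
  assumes \<omega>: "\<omega> \<in> space M" and n: "0 \<le> n" and lt: "\<tau> n \<omega> < n" and BI: "B (\<tau> n \<omega>) \<omega> \<in> I"
  shows "clock (\<tau> n \<omega>) \<omega> = ennreal (T \<omega>)"
proof (rule antisym)
  show "clock (\<tau> n \<omega>) \<omega> \<le> ennreal (T \<omega>)" by (rule clock_at_\<tau>_le[OF \<omega> n])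
  define s where "s = \<tau> n \<omega>"
  obtain \<epsilon> where \<epsilon>: "0 < \<epsilon>" "cball (B s \<omega>) \<epsilon> \<subseteq> I"
    using open_support_interior[of \<mu>] BI open_contains_cball[of I] by (auto simp: s_def)
  define c d where "c = B s \<omega> - \<epsilon>" and "d = B s \<omega> + \<epsilon>"
  have cd: "{c..d} \<subseteq> I" using \<epsilon>(2) by (auto simp: c_def d_def cball_def dist_real_def subset_eq abs_le_iff)
  have "((\<lambda>t. B t \<omega>) \<longlongrightarrow> B s \<omega>) (at_right s)"
    using B_continuous[OF \<omega>] by (auto simp: continuous_on_def intro: tendsto_within_subset)
  then have "eventually (\<lambda>t. dist (B t \<omega>) (B s \<omega>) < \<epsilon>) (at_right s)" using \<epsilon>(1) by (rule tendstoD)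
  then obtain b where b: "s < b" "\<And>t. s < t \<Longrightarrow> t < b \<Longrightarrow> dist (B t \<omega>) (B s \<omega>) < \<epsilon>"
    by (auto simp: eventually_at_right_field)
  \<comment> \<open>Up to \<open>t0\<close> the path stays in the compact interval
    \<open>[c, d]\<close> inside \<open>I\<close>, where \<open>w\<close> is bounded below. As
    \<open>t0\<close> is before the horizon, the clock exceeds \<open>T\<close> at all times after
    \<open>s\<close> and up to \<open>t0\<close>.\<close>
  define t0 where "t0 = (s + min b n) / 2"
  have t0: "s < t0" "t0 < b" "t0 < n" using b(1) lt by (auto simp: t0_def s_def min_def)
  have near: "B r \<omega> \<in> {c..d}" if "s \<le> r" "r \<le> t0" for r
    using b(2)[of r] that t0 \<epsilon>(1) by (cases "r = s") (auto simp: c_def d_def dist_real_def abs_if split: if_splits)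
  have out: "L x t \<omega> = L x s \<omega>" if "s \<le> t" "t \<le> t0" "x \<notin> {c..d}" for x t
    using L_support[OF \<omega> that(1), of x] near that by fastforce
  obtain c' where c': "0 < c'" "\<And>x. x \<in> {c..d} \<Longrightarrow> c' \<le> w x" using w_bounded_below[OF cd] by blast
  have "bounded ((\<lambda>x. L x t0 \<omega>) ` {c..d})"
    by (intro compact_imp_bounded compact_continuous_image continuous_on_subset[OF L_continuous_space[OF \<omega>]]) auto
  then obtain l where "\<forall>y\<in>(\<lambda>x. L x t0 \<omega>) ` {c..d}. norm y \<le> l" unfolding bounded_iff by blast
  then have l: "\<bar>L x t0 \<omega>\<bar> \<le> l" if "x \<in> {c..d}" for x using that by auto
  define q where "q k = s + (t0 - s) / real (Suc k)" for k
  have q: "s < q k" "q k \<le> t0" for k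
  proof -
    show "s < q k" using t0 by (simp add: q_def)
    have "(t0 - s) / real (Suc k) \<le> (t0 - s) / 1" using t0 by (intro divide_left_mono) auto
    then show "q k \<le> t0" by (simp add: q_def)
  qed
  have q_lim: "q \<longlonglongrightarrow> s"
  proof -
    have "(\<lambda>k. s + (t0 - s) * (1 / real (Suc k))) \<longlonglongrightarrow> s + (t0 - s) * 0"
      by (intro tendsto_intros LIMSEQ_Suc lim_1_over_n)
    then show ?thesis by (simp add: q_def[abs_def])
  qed
  have Ls[measurable]: "(\<lambda>x. L x t \<omega>) \<in> borel_measurable borel" for t by (rule L_space_measurable[OF \<omega>])
  have rate_fin: "rate x < \<infinity>" for x by (simp add: rate_def indicator_def)
  \<comment> \<open>Domination: at levels outside \<open>[c, d]\<close> the local time does not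
    change between \<open>s\<close> and \<open>t0\<close>; at levels inside it is at most
    \<open>l\<close>, and the rate is at most \<open>1 / c'\<close>.\<close>
  have "(\<lambda>k. \<integral>\<^sup>+x. rate x * ennreal (L x (q k) \<omega>) \<partial>\<mu>) \<longlonglongrightarrow> (\<integral>\<^sup>+x. rate x * ennreal (L x s \<omega>) \<partial>\<mu>)"
  proof (rule nn_integral_dominated_convergence[where w="\<lambda>x. rate x * ennreal (L x s \<omega>) + ennreal (l / c')"])
    show "AE x in \<mu>. rate x * ennreal (L x (q k) \<omega>) \<le> rate x * ennreal (L x s \<omega>) + ennreal (l / c')" for k
    proof (intro AE_I2)
      fix x
      show "rate x * ennreal (L x (q k) \<omega>) \<le> rate x * ennreal (L x s \<omega>) + ennreal (l / c')"
      proof (cases "x \<in> {c..d}")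
        case True
        have "L x (q k) \<omega> \<le> l" using L_mono[OF \<omega> q(2), of x k] l[OF True] by linarith
        moreover have "1 / w x \<le> 1 / c'" using c'(1) c'(2)[OF True] by (intro divide_left_mono) auto
        moreover have "0 < w x" using c'(1) c'(2)[OF True] by simp
        ultimately have "(1 / w x) * L x (q k) \<omega> \<le> (1 / c') * l"
          using L_nonneg[OF \<omega>] c'(1) by (intro mult_mono) auto
        then have "rate x * ennreal (L x (q k) \<omega>) \<le> ennreal (l / c')"
          using True cd \<open>0 < w x\<close> L_nonneg[OF \<omega>, of x "q k"]
          by (auto simp: rate_def subset_eq ennreal_mult[symmetric] intro!: ennreal_leI)
        then show ?thesis by (meson add_increasing zero_le)
      next
        case False
        then show ?thesis using out[of "q k" x] q[of k] by simp
      qed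
    qed
    have "(\<integral>\<^sup>+x. rate x * ennreal (L x s \<omega>) + ennreal (l / c') \<partial>\<mu>) = clock s \<omega> + ennreal (l / c') * emeasure \<mu> (space \<mu>)"
    proof (subst nn_integral_add)
      show "(\<lambda>x. rate x * ennreal (L x s \<omega>)) \<in> borel_measurable \<mu>" by (rule measurable_\<mu>) measurable
    qed (use clock_eq_upto_\<tau>[OF \<omega> n, of s] in \<open>auto simp: s_def\<close>)
    also have "\<dots> < \<infinity>"
      using clock_upto_\<tau>(2)[OF \<omega> n, of s] \<mu>.emeasure_space_1 by (simp add: s_def ennreal_mult_less_top)
    finally show "(\<integral>\<^sup>+x. rate x * ennreal (L x s \<omega>) + ennreal (l / c') \<partial>\<mu>) < \<infinity>" .
    show "AE x in \<mu>. (\<lambda>k. rate x * ennreal (L x (q k) \<omega>)) \<longlonglongrightarrow> rate x * ennreal (L x s \<omega>)"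
    proof (intro AE_I2 ennreal_tendsto_cmult tendsto_ennrealI)
      fix x show "(\<lambda>k. L x (q k) \<omega>) \<longlonglongrightarrow> L x s \<omega>"
        by (rule continuous_on_tendsto_compose[OF L_continuous_time[OF \<omega>] q_lim]) auto
      show "rate x < \<top>" using rate_fin[of x] by simp
    qed
  qed (rule measurable_\<mu>, measurable)+
  moreover have "clock (q k) \<omega> = (\<integral>\<^sup>+x. rate x * ennreal (L x (q k) \<omega>) \<partial>\<mu>)" for k
  proof -
    have "L e (q k) \<omega> = 0" if "e \<in> ends" for e
    proof -
      have "e \<notin> {c..d}" using ends_not_interior[OF that] cd by auto
      from out[OF less_imp_le[OF q(1)] q(2) this] have "L e (q k) \<omega> = L e s \<omega>" .
      then show ?thesis using ends_zero_upto_\<tau>[OF \<omega> n _ that, of s] by (simp add: s_def)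
    qed
    then show ?thesis by (simp add: clock_def)
  qed
  ultimately have "(\<lambda>k. clock (q k) \<omega>) \<longlonglongrightarrow> clock s \<omega>"
    using clock_eq_upto_\<tau>[OF \<omega> n, of s] by (simp add: s_def)
  moreover have "ennreal (T \<omega>) \<le> clock (q k) \<omega>" for k
    using clock_after_\<tau>[OF \<omega>, of n "q k"] q[of k] t0 by (auto simp: s_def intro: less_imp_le)
  ultimately show "ennreal (T \<omega>) \<le> clock (\<tau> n \<omega>) \<omega>"
    unfolding s_def[symmetric] by (intro tendsto_lowerbound[where F=sequentially]) auto
qed

definition law :: "real \<Rightarrow> real measure" where
  "law n = distr M borel (\<lambda>\<omega>. B (\<tau> n \<omega>) \<omega>)"

lemma law_centred: "0 \<le> n \<Longrightarrow> centred_law (law n) x0"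
proof -
  assume n: "0 \<le> n"
  note st = stopped[OF \<tau>_optional[OF n]]
  have [measurable]: "(\<lambda>\<omega>. B (\<tau> n \<omega>) \<omega>) \<in> borel_measurable M" using st(1) by simp
  show ?thesis unfolding centred_law_def law_def
    using st(1,2) by (auto intro!: prob_space_distr simp: integrable_distr_eq integral_distr)
qed

lemma gap_law: "0 \<le> n \<Longrightarrow> gap (law n) x0 x = (\<integral>\<omega>. L x (\<tau> n \<omega>) \<omega> \<partial>M)"
proof -
  assume n: "0 \<le> n"
  note st = stopped[OF \<tau>_optional[OF n]]
  have [measurable]: "(\<lambda>\<omega>. B (\<tau> n \<omega>) \<omega>) \<in> borel_measurable M" using st(1) by simp
  have "potential (law n) x = (\<integral>\<omega>. \<bar>B (\<tau> n \<omega>) \<omega> - x\<bar> \<partial>M)"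
    unfolding potential_def law_def by (subst integral_distr) (auto simp: abs_minus_commute)
  then show ?thesis using st(4)[of x] by (simp add: gap_def abs_minus_commute)
qed

section \<open>Compensation of the stopping event by the clock\<close>

definition elapsed :: "real \<Rightarrow> 'a \<Rightarrow> real" where
  "elapsed t \<omega> = enn2real (min (ennreal (T \<omega>)) (clock t \<omega>))"

text \<open>\<open>elapsed\<close> acts as the compensator of this jump process: by independence of
  \<open>T\<close> and the path, both have equal expectations under weights that depend on the
  path.\<close>

definition rung :: "real \<Rightarrow> 'a \<Rightarrow> real" where
  "rung t \<omega> = indicator {\<omega>. ennreal (T \<omega>) < clock t \<omega>} \<omega>"

lemma ennreal_elapsed: "ennreal (elapsed t \<omega>) = min (ennreal (T \<omega>)) (clock t \<omega>)"
  unfolding elapsed_def by (intro ennreal_enn2real) (simp add: min_less_iff_disj)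

lemma elapsed_nonneg: "0 \<le> elapsed t \<omega>"
  by (simp add: elapsed_def)

lemma elapsed_le: "\<omega> \<in> space M \<Longrightarrow> elapsed t \<omega> \<le> T \<omega>"
proof -
  assume "\<omega> \<in> space M"
  have "ennreal (elapsed t \<omega>) \<le> ennreal (T \<omega>)" unfolding ennreal_elapsed by simp
  then show "elapsed t \<omega> \<le> T \<omega>" using T_nonneg[OF \<open>\<omega> \<in> space M\<close>] by (simp add: ennreal_le_iff)
qed

lemma elapsed_measurable [measurable]: "elapsed t \<in> borel_measurable M"
  unfolding elapsed_def by measurable

lemma rung_measurable [measurable]: "rung t \<in> borel_measurable M"
  unfolding rung_def by measurable

lemma rung_bounds: "0 \<le> rung t \<omega>" "rung t \<omega> \<le> 1"
  by (auto simp: rung_def indicator_def)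

text \<open>The real form of \<open>exponential_min_clock\<close>. The weight may be read at a time
  \<open>s\<close> before or after \<open>t\<close>, since \<open>T\<close> is independent of the
  whole path; so increments over a grid interval can be weighted by the position at its left
  end.\<close>

lemma elapsed_rung:
  assumes "0 \<le> s" "0 \<le> t" "0 \<le> h"
  shows "integrable M (\<lambda>\<omega>. tent z h (B s \<omega>) * elapsed t \<omega>)" "integrable M (\<lambda>\<omega>. tent z h (B s \<omega>) * rung t \<omega>)"
    "(\<integral>\<omega>. tent z h (B s \<omega>) * elapsed t \<omega> \<partial>M) = (\<integral>\<omega>. tent z h (B s \<omega>) * rung t \<omega> \<partial>M)"
proof -
  show "integrable M (\<lambda>\<omega>. tent z h (B s \<omega>) * elapsed t \<omega>)"
  proof (rule Bochner_Integration.integrable_bound)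
    show "integrable M (\<lambda>\<omega>. h * T \<omega>)" using T_integrable by simp
    show "AE \<omega> in M. norm (tent z h (B s \<omega>) * elapsed t \<omega>) \<le> norm (h * T \<omega>)"
      using elapsed_nonneg elapsed_le T_nonneg tent_nonneg tent_le[OF assms(3)] assms(3)
      by (intro AE_I2) (simp add: abs_mult mult_mono)
  qed measurable
  show "integrable M (\<lambda>\<omega>. tent z h (B s \<omega>) * rung t \<omega>)"
  proof (rule integrable_const_bound[where B="h * 1"])
    show "AE \<omega> in M. norm (tent z h (B s \<omega>) * rung t \<omega>) \<le> h * 1"
      unfolding real_norm_def abs_mult
      using rung_bounds tent_nonneg tent_le[OF assms(3)] assms(3)
      by (intro AE_I2 mult_mono) auto
  qed measurable
  have "(\<integral>\<omega>. tent z h (B s \<omega>) * elapsed t \<omega> \<partial>M) = enn2real (\<integral>\<^sup>+\<omega>. ennreal (tent z h (B s \<omega>)) * min (ennreal (T \<omega>)) (clock t \<omega>) \<partial>M)"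
    by (subst integral_eq_nn_integral) (auto simp: tent_nonneg elapsed_nonneg ennreal_mult ennreal_elapsed)
  also have "\<dots> = enn2real (\<integral>\<^sup>+\<omega>. ennreal (tent z h (B s \<omega>)) * indicator {\<omega>. ennreal (T \<omega>) < clock t \<omega>} \<omega> \<partial>M)"
    using assms by (subst exponential_min_clock) auto
  also have "\<dots> = enn2real (\<integral>\<^sup>+\<omega>. ennreal (tent z h (B s \<omega>) * rung t \<omega>) \<partial>M)"
    by (intro arg_cong[where f=enn2real] nn_integral_cong) (auto simp: rung_def indicator_def tent_nonneg)
  also have "\<dots> = (\<integral>\<omega>. tent z h (B s \<omega>) * rung t \<omega> \<partial>M)"
    by (subst integral_eq_nn_integral) (auto simp: tent_nonneg rung_bounds)
  finally show "(\<integral>\<omega>. tent z h (B s \<omega>) * elapsed t \<omega> \<partial>M) = (\<integral>\<omega>. tent z h (B s \<omega>) * rung t \<omega> \<partial>M)" .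
qed

definition rrate :: "real \<Rightarrow> real" where
  "rrate x = indicator I x / w x"

lemma rrate_nonneg: "0 \<le> rrate x"
  unfolding rrate_def by (intro divide_nonneg_nonneg gap_nonneg[OF centred]) auto

lemma ennreal_rrate: "ennreal (rrate x) = rate x"
  by (simp add: rrate_def rate_def indicator_def)

lemma rrate_measurable [measurable]: "rrate \<in> borel_measurable borel"
  unfolding rrate_def by measurable

text \<open>Formally the integral of \<open>tent z h (B u)\<close> over \<open>u \<le> t\<close>
  against the increments of the clock, because the local time at \<open>x\<close> grows only while
  \<open>B\<close> is at \<open>x\<close>. Writing it with local times avoids pathwise Stieltjes
  integrals.\<close>

definition weighted :: "real \<Rightarrow> real \<Rightarrow> real \<Rightarrow> 'a \<Rightarrow> real" where
  "weighted z h t \<omega> = (\<integral>x. tent z h x * (rrate x * L x t \<omega>) \<partial>\<mu>)"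

lemma rrate_L_integrable:
  assumes "\<omega> \<in> space M" "0 \<le> n" "t \<le> \<tau> n \<omega>"
  shows "integrable \<mu> (\<lambda>x. rrate x * L x t \<omega>)" "(\<integral>x. rrate x * L x t \<omega> \<partial>\<mu>) = elapsed t \<omega>"
proof -
  have [measurable]: "(\<lambda>x. L x t \<omega>) \<in> borel_measurable borel" by (rule L_space_measurable[OF assms(1)])
  have meas: "(\<lambda>x. rrate x * L x t \<omega>) \<in> borel_measurable \<mu>" by (rule measurable_\<mu>) measurable
  have eq: "(\<integral>\<^sup>+x. ennreal (rrate x * L x t \<omega>) \<partial>\<mu>) = clock t \<omega>"
    unfolding clock_eq_upto_\<tau>[OF assms]
    by (simp add: ennreal_mult rrate_nonneg L_nonneg[OF assms(1)] ennreal_rrate)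
  show "integrable \<mu> (\<lambda>x. rrate x * L x t \<omega>)"
    by (rule integrableI_bounded[OF meas])
      (use eq clock_upto_\<tau>(2)[OF assms] in \<open>auto simp: rrate_nonneg L_nonneg[OF assms(1)]\<close>)
  have "(\<integral>x. rrate x * L x t \<omega> \<partial>\<mu>) = enn2real (clock t \<omega>)"
    unfolding eq[symmetric]
    by (rule integral_eq_nn_integral[OF meas]) (auto simp: rrate_nonneg L_nonneg[OF assms(1)])
  then show "(\<integral>x. rrate x * L x t \<omega> \<partial>\<mu>) = elapsed t \<omega>"
    using clock_upto_\<tau>(1)[OF assms] by (simp add: elapsed_def min_absorb2)
qed

lemma tent_rrate_L_integrable:
  assumes "\<omega> \<in> space M" "0 \<le> n" "t \<le> \<tau> n \<omega>" "0 \<le> h"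
  shows "integrable \<mu> (\<lambda>x. tent z h x * (rrate x * L x t \<omega>))"
proof (rule Bochner_Integration.integrable_bound)
  show "integrable \<mu> (\<lambda>x. h * (rrate x * L x t \<omega>))" using rrate_L_integrable(1)[OF assms(1-3)] by simp
  show "AE x in \<mu>. norm (tent z h x * (rrate x * L x t \<omega>)) \<le> norm (h * (rrate x * L x t \<omega>))"
    using assms(4) by (intro AE_I2) (simp add: abs_mult mult_right_mono tent_nonneg tent_le)
  have [measurable]: "(\<lambda>x. L x t \<omega>) \<in> borel_measurable borel" by (rule L_space_measurable[OF assms(1)])
  show "(\<lambda>x. tent z h x * (rrate x * L x t \<omega>)) \<in> borel_measurable \<mu>" by (rule measurable_\<mu>) measurable
qed

text \<open>The local time at \<open>x\<close> grows between \<open>s\<close> and \<open>t\<close>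
  only if the path visits \<open>x\<close> in between; then \<open>x\<close> is within
  \<open>d\<close> of \<open>b\<close>, and so is \<open>tent z h x\<close> of
  \<open>tent z h b\<close>, since tents are 1-Lipschitz.\<close>

lemma weighted_increment:
  assumes \<omega>: "\<omega> \<in> space M" and n: "0 \<le> n" and h: "0 \<le> h" and st: "s \<le> t" "t \<le> \<tau> n \<omega>"
    and osc: "\<And>u. s \<le> u \<Longrightarrow> u \<le> t \<Longrightarrow> \<bar>B u \<omega> - b\<bar> \<le> d"
  shows "\<bar>weighted z h t \<omega> - weighted z h s \<omega> - tent z h b * (elapsed t \<omega> - elapsed s \<omega>)\<bar>
     \<le> d * (elapsed t \<omega> - elapsed s \<omega>)"
proof -
  have s: "s \<le> \<tau> n \<omega>" using st by simp
  note i = rrate_L_integrable[OF \<omega> n st(2)] rrate_L_integrable[OF \<omega> n s]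
  note j = tent_rrate_L_integrable[OF \<omega> n st(2) h, of z] tent_rrate_L_integrable[OF \<omega> n s h, of z]
  define f where "f x = (tent z h x - tent z h b) * (rrate x * L x t \<omega> - rrate x * L x s \<omega>)" for x
  have f_eq: "f x = tent z h x * (rrate x * L x t \<omega>) - tent z h x * (rrate x * L x s \<omega>)
          - tent z h b * (rrate x * L x t \<omega> - rrate x * L x s \<omega>)" for x
    by (simp add: f_def algebra_simps)
  have f_int: "integrable \<mu> f" unfolding f_eq[abs_def] using i(1,3) j by simp
  have eq: "weighted z h t \<omega> - weighted z h s \<omega> - tent z h b * (elapsed t \<omega> - elapsed s \<omega>) = (\<integral>x. f x \<partial>\<mu>)"
    unfolding f_eq weighted_def i(2)[symmetric] i(4)[symmetric] using i(1,3) j by simp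
  have "\<bar>\<integral>x. f x \<partial>\<mu>\<bar> \<le> (\<integral>x. \<bar>f x\<bar> \<partial>\<mu>)" by (rule integral_abs_bound)
  also have "\<dots> \<le> (\<integral>x. d * (rrate x * L x t \<omega> - rrate x * L x s \<omega>) \<partial>\<mu>)"
  proof (rule integral_mono)
    fix x
    show "\<bar>f x\<bar> \<le> d * (rrate x * L x t \<omega> - rrate x * L x s \<omega>)"
    proof (cases "L x s \<omega> = L x t \<omega>")
      case False
      then obtain u where u: "u \<in> {s..t}" "B u \<omega> = x" using L_support[OF \<omega> st(1), of x] by blast
      then have "\<bar>tent z h x - tent z h b\<bar> \<le> d" using tent_lipschitz[of z h x b] osc[of u] by auto
      moreover have nn: "0 \<le> rrate x * L x t \<omega> - rrate x * L x s \<omega>"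
        using L_mono[OF \<omega> st(1), of x] rrate_nonneg[of x] by (simp add: mult_left_mono)
      ultimately show ?thesis unfolding f_def abs_mult abs_of_nonneg[OF nn] by (rule mult_right_mono)
    qed (simp add: f_def)
  qed (use i(1,3) f_int in auto)
  also have "\<dots> = d * (elapsed t \<omega> - elapsed s \<omega>)" using i by simp
  finally show ?thesis unfolding eq .
qed

text \<open>On intervals that end by \<open>\<tau> n\<close> this is
  \<open>weighted_increment\<close>, and after \<open>\<tau> n\<close> nothing changes. On the
  interval that contains \<open>\<tau> n\<close>, \<open>elapsed\<close> may jump up to
  \<open>T\<close> at an end, which \<open>weighted\<close> does not see; the tent is small
  there.\<close>

lemma weighted_step:
  assumes \<omega>: "\<omega> \<in> space M" "confined \<omega>" and n: "0 \<le> n" and h: "0 \<le> h" and zh: "{z - h..z + h} \<subseteq> I"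
    and st: "s \<le> t" "t \<le> n" and osc: "\<And>u. s \<le> u \<Longrightarrow> u \<le> t \<Longrightarrow> \<bar>B u \<omega> - B s \<omega>\<bar> \<le> d"
  shows "\<bar>weighted z h (min t (\<tau> n \<omega>)) \<omega> - weighted z h (min s (\<tau> n \<omega>)) \<omega> - tent z h (B s \<omega>) * (elapsed t \<omega> - elapsed s \<omega>)\<bar>
     \<le> d * (elapsed t \<omega> - elapsed s \<omega>)"
proof -
  have after: "elapsed r \<omega> = T \<omega>" if "\<tau> n \<omega> < r" "r \<le> n" for r
    using clock_after_\<tau>[OF \<omega>(1) that] T_nonneg[OF \<omega>(1)] by (simp add: elapsed_def min_absorb1)
  consider "t \<le> \<tau> n \<omega>" | "\<tau> n \<omega> < s" | "s \<le> \<tau> n \<omega>" "\<tau> n \<omega> < t" by linarith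
  then show ?thesis
  proof cases
    case 1
    then show ?thesis using weighted_increment[OF \<omega>(1) n h st(1) 1 osc] st(1) by (simp add: min_absorb1)
  next
    case 2
    then show ?thesis using st by (simp add: min_absorb2 after)
  next
    case 3
    let ?r = "\<tau> n \<omega>"
    have inc: "\<bar>weighted z h ?r \<omega> - weighted z h s \<omega> - tent z h (B s \<omega>) * (elapsed ?r \<omega> - elapsed s \<omega>)\<bar>
      \<le> d * (elapsed ?r \<omega> - elapsed s \<omega>)"
      by (rule weighted_increment[OF \<omega>(1) n h 3(1) order_refl osc]) (use 3 in auto)
    have le: "elapsed ?r \<omega> \<le> elapsed t \<omega>" using elapsed_le[OF \<omega>(1)] after[OF 3(2) st(2)] by simp
    have "tent z h (B s \<omega>) * (elapsed t \<omega> - elapsed ?r \<omega>) \<le> d * (elapsed t \<omega> - elapsed ?r \<omega>)"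
    \<comment> \<open>In \<open>I\<close> the clock equals \<open>T\<close> at
      \<open>\<tau> n\<close>, so nothing is left to account for. Otherwise the tent vanishes at
      \<open>B (\<tau> n)\<close>, and by the bound on the oscillation it is at most
      \<open>d\<close> at \<open>B s\<close>.\<close>
    proof (cases "B ?r \<omega> \<in> I")
      case True
      have "elapsed ?r \<omega> = T \<omega>"
        using clock_at_\<tau>[OF \<omega>(1) n _ True] 3(2) st(2) T_nonneg[OF \<omega>(1)] by (simp add: elapsed_def)
      then show ?thesis using after[OF 3(2) st(2)] by simp
    next
      case False
      then have "tent z h (B ?r \<omega>) = 0" using zh by (intro tent_eq_0) auto
      then have "tent z h (B s \<omega>) \<le> d"
        using tent_lipschitz[of z h "B ?r \<omega>" "B s \<omega>"] osc[of ?r] 3 by auto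
      then show ?thesis using le by (intro mult_right_mono) auto
    qed
    moreover have "0 \<le> tent z h (B s \<omega>) * (elapsed t \<omega> - elapsed ?r \<omega>)" using le tent_nonneg by simp
    ultimately show ?thesis using inc 3 by (simp add: min_absorb1 min_absorb2 right_diff_distrib abs_le_iff)
  qed
qed

text \<open>An increase of \<open>rung\<close> between \<open>s\<close> and \<open>t\<close> places
  \<open>\<tau> n\<close> in \<open>[s, t]\<close>, where the path is within \<open>d\<close> of
  \<open>B s\<close>.\<close>

lemma rung_step:
  assumes \<omega>: "\<omega> \<in> space M" and n: "0 \<le> n" and st: "s \<le> t" "t \<le> n"
    and osc: "\<And>u. s \<le> u \<Longrightarrow> u \<le> t \<Longrightarrow> \<bar>B u \<omega> - B s \<omega>\<bar> \<le> d"
  shows "\<bar>tent z h (B (\<tau> n \<omega>) \<omega>) * (rung t \<omega> - rung s \<omega>) - tent z h (B s \<omega>) * (rung t \<omega> - rung s \<omega>)\<bar>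
    \<le> d * (rung t \<omega> - rung s \<omega>)"
proof (cases "rung t \<omega> = rung s \<omega>")
  case False
  then have r: "rung t \<omega> = 1" "rung s \<omega> = 0"
    using clock_mono[OF \<omega> st(1)] by (auto simp: rung_def indicator_def of_bool_def dest: less_le_trans split: if_splits)
  have "s \<le> \<tau> n \<omega>" using clock_after_\<tau>[OF \<omega>, of n s] r(2) st by (force simp: rung_def)
  moreover have "\<tau> n \<omega> \<le> t"
  proof -
    have "\<not> t < \<tau> n \<omega>" using clock_before_\<tau>[of t n \<omega>] r(1) by (auto simp: rung_def indicator_def split: if_splits)
    then show ?thesis by simp
  qed
  ultimately have "\<bar>tent z h (B (\<tau> n \<omega>) \<omega>) - tent z h (B s \<omega>)\<bar> \<le> d"
    using tent_lipschitz[of z h "B (\<tau> n \<omega>) \<omega>" "B s \<omega>"] osc[of "\<tau> n \<omega>"] by auto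
  then show ?thesis using r by simp
qed simp

end

lemma tendsto_of_approx:
  fixes S :: "nat \<Rightarrow> real"
  assumes "0 \<le> K" and "\<And>d. 0 < d \<Longrightarrow> \<forall>\<^sub>F N in sequentially. \<bar>x - S N\<bar> \<le> d * K"
  shows "S \<longlonglongrightarrow> x"
proof (rule tendstoI)
  fix e :: real assume "0 < e"
  then have "\<forall>\<^sub>F N in sequentially. \<bar>x - S N\<bar> \<le> (e / (2 * (K + 1))) * K" using assms(1) by (intro assms(2)) auto
  then show "\<forall>\<^sub>F N in sequentially. dist (S N) x < e"
  proof eventually_elim
    case (elim N)
    have "(e / (2 * (K + 1))) * K \<le> (e / (2 * (K + 1))) * (K + 1)" using \<open>0 < e\<close> assms(1) by (intro mult_left_mono) auto
    also have "\<dots> = e / 2" using assms(1) by (simp add: field_simps)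
    also have "\<dots> < e" using \<open>0 < e\<close> by simp
    finally show ?case using elim by (simp add: dist_real_def abs_minus_commute)
  qed
qed

text \<open>The error of a Riemann-Stieltjes sum: local errors proportional to the increments of the
  integrator add up to its total increment.\<close>

lemma telescoping_approx:
  fixes W C b :: "nat \<Rightarrow> real"
  assumes "\<And>k. k < N \<Longrightarrow> \<bar>W (Suc k) - W k - b k * (C (Suc k) - C k)\<bar> \<le> d * (C (Suc k) - C k)"
  shows "\<bar>W N - W 0 - (\<Sum>k<N. b k * (C (Suc k) - C k))\<bar> \<le> d * (C N - C 0)"
proof -
  have "W N - W 0 - (\<Sum>k<N. b k * (C (Suc k) - C k)) = (\<Sum>k<N. W (Suc k) - W k - b k * (C (Suc k) - C k))"
    by (simp only: sum_subtractf[symmetric] sum_lessThan_telescope[symmetric])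
  also have "\<bar>\<dots>\<bar> \<le> (\<Sum>k<N. d * (C (Suc k) - C k))"
    by (intro order_trans[OF sum_abs] sum_mono assms) auto
  also have "\<dots> = d * (C N - C 0)" by (simp add: sum_distrib_left[symmetric] sum_lessThan_telescope)
  finally show ?thesis .
qed

context embedding
begin

lemma elapsed_start: "t \<le> 0 \<Longrightarrow> elapsed t \<omega> = 0"
  by (simp add: elapsed_def clock_start)

lemma rung_start: "t \<le> 0 \<Longrightarrow> rung t \<omega> = 0"
  by (simp add: rung_def clock_start)

lemma elapsed_mono: "\<omega> \<in> space M \<Longrightarrow> s \<le> t \<Longrightarrow> elapsed s \<omega> \<le> elapsed t \<omega>"
  unfolding elapsed_def by (intro enn2real_mono min.mono clock_mono) (auto simp: min_less_iff_disj)

lemma rung_mono: "\<omega> \<in> space M \<Longrightarrow> s \<le> t \<Longrightarrow> rung s \<omega> \<le> rung t \<omega>"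
  using clock_mono[of \<omega> s t] by (auto simp: rung_def indicator_def of_bool_def dest: less_le_trans)

lemma B_uniformly_continuous:
  assumes "\<omega> \<in> space M" "0 < n" "0 < d"
  shows "\<forall>\<^sub>F N in sequentially. \<forall>k<Suc N. \<forall>u. n * real k / real (Suc N) \<le> u \<longrightarrow> u \<le> n * real (Suc k) / real (Suc N) \<longrightarrow>
    \<bar>B u \<omega> - B (n * real k / real (Suc N)) \<omega>\<bar> \<le> d"
proof -
  have "uniformly_continuous_on {0..n} (\<lambda>t. B t \<omega>)"
    by (intro compact_uniformly_continuous continuous_on_subset[OF B_continuous[OF assms(1)]]) auto
  then obtain e where e: "0 < e" "\<And>s t. s \<in> {0..n} \<Longrightarrow> t \<in> {0..n} \<Longrightarrow> dist t s < e \<Longrightarrow> dist (B t \<omega>) (B s \<omega>) < d"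
    using assms(3) unfolding uniformly_continuous_on_def by metis
  have "(\<lambda>N. n * (1 / real (Suc N))) \<longlonglongrightarrow> n * 0"
    by (intro tendsto_intros LIMSEQ_Suc lim_1_over_n)
  then have "\<forall>\<^sub>F N in sequentially. n * (1 / real (Suc N)) < e" using e(1) by (intro order_tendstoD) auto
  then show ?thesis
  proof eventually_elim
    case (elim N)
    show ?case
    proof (intro allI impI)
      fix k u assume k: "k < Suc N" and u: "n * real k / real (Suc N) \<le> u" "u \<le> n * real (Suc k) / real (Suc N)"
      have "n * real (Suc k) / real (Suc N) = n * real k / real (Suc N) + n * (1 / real (Suc N))"
        by (simp add: add_divide_distrib distrib_left del: of_nat_Suc) (simp add: add_divide_distrib distrib_left)
      moreover have "n * real (Suc k) / real (Suc N) \<le> n * real (Suc N) / real (Suc N)"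
        using k assms(2) by (intro divide_right_mono mult_left_mono) auto
      then have "n * real (Suc k) / real (Suc N) \<le> n" by simp
      moreover have "0 \<le> n * real k / real (Suc N)" using assms(2) by simp
      ultimately have "dist (B u \<omega>) (B (n * real k / real (Suc N)) \<omega>) < d"
        using u elim by (intro e(2)) (auto simp: dist_real_def)
      then show "\<bar>B u \<omega> - B (n * real k / real (Suc N)) \<omega>\<bar> \<le> d" by (simp add: dist_real_def)
    qed
  qed
qed

text \<open>By independence, given the path of \<open>B\<close> the conditional hazard of stopping is the increase of
  the clock. A sum over a fine time grid turns this into the statement that the part of \<open>law n\<close>
  inside the support has density \<open>rrate * gap (law n)\<close> with respect to \<open>\<mu>\<close>.\<close>

lemma tent_identity:
  assumes n: "0 < n" and h: "0 \<le> h" and zh: "{z - h..z + h} \<subseteq> I"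
  shows "(\<integral>\<omega>. tent z h (B (\<tau> n \<omega>) \<omega>) * rung n \<omega> \<partial>M) = (\<integral>x. tent z h x * (rrate x * gap (law n) x0 x) \<partial>\<mu>)"
proof -
  have n0: "0 \<le> n" using n by simp
  note [measurable] = \<tau>_measurable[OF n0]
  define s where "s N k = n * real k / real (Suc N)" for N k
  \<comment> \<open>The sum with left end points that approximates the integral of
    \<open>tent z h (B u)\<close> against the increments of \<open>C\<close>, for \<open>C\<close>
    the compensator \<open>elapsed\<close> or the jump process \<open>rung\<close>.\<close>
  define S where "S C N \<omega> = (\<Sum>k<Suc N. tent z h (B (s N k) \<omega>) * (C (s N (Suc k)) \<omega> - C (s N k) \<omega>))"
    for C :: "real \<Rightarrow> 'a \<Rightarrow> real" and N \<omega>
  have s0: "s N 0 = 0" and sN: "s N (Suc N) = n" for N by (auto simp: s_def)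
  have s_nn: "0 \<le> s N k" for N k using n by (simp add: s_def)
  have s_mono: "s N k \<le> s N (Suc k)" for N k
    unfolding s_def using n by (intro divide_right_mono mult_left_mono) auto
  have s_le: "s N k \<le> n" if "k \<le> Suc N" for N k
  proof -
    have "s N k \<le> s N (Suc N)" unfolding s_def using n that by (intro divide_right_mono mult_left_mono) auto
    then show ?thesis by (simp add: sN)
  qed
  have S_lim1: "(\<lambda>N. S elapsed N \<omega>) \<longlonglongrightarrow> weighted z h (\<tau> n \<omega>) \<omega>" if \<omega>: "\<omega> \<in> space M" "confined \<omega>" for \<omega>
  proof (rule tendsto_of_approx[OF T_nonneg[OF \<omega>(1)]])
    fix d :: real assume d: "0 < d"
    show "\<forall>\<^sub>F N in sequentially. \<bar>weighted z h (\<tau> n \<omega>) \<omega> - S elapsed N \<omega>\<bar> \<le> d * T \<omega>"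
      using B_uniformly_continuous[OF \<omega>(1) n d]
    proof eventually_elim
      case (elim N)
      have "\<bar>weighted z h (min (s N (Suc N)) (\<tau> n \<omega>)) \<omega> - weighted z h (min (s N 0) (\<tau> n \<omega>)) \<omega>
          - (\<Sum>k<Suc N. tent z h (B (s N k) \<omega>) * (elapsed (s N (Suc k)) \<omega> - elapsed (s N k) \<omega>))\<bar>
          \<le> d * (elapsed (s N (Suc N)) \<omega> - elapsed (s N 0) \<omega>)"
      proof (rule telescoping_approx)
        fix k assume k: "k < Suc N"
        show "\<bar>weighted z h (min (s N (Suc k)) (\<tau> n \<omega>)) \<omega> - weighted z h (min (s N k) (\<tau> n \<omega>)) \<omega>
           - tent z h (B (s N k) \<omega>) * (elapsed (s N (Suc k)) \<omega> - elapsed (s N k) \<omega>)\<bar>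
           \<le> d * (elapsed (s N (Suc k)) \<omega> - elapsed (s N k) \<omega>)"
          using elim k by (intro weighted_step[OF \<omega> n0 h zh s_mono s_le]) (auto simp: s_def simp del: of_nat_Suc)
      qed
      moreover have "weighted z h (min (s N 0) (\<tau> n \<omega>)) \<omega> = 0"
        using \<tau>_nonneg[OF n0, of \<omega>] by (simp add: s0 weighted_def L_start)
      moreover have "min (s N (Suc N)) (\<tau> n \<omega>) = \<tau> n \<omega>" using \<tau>_le[of n \<omega>] by (simp add: sN)
      moreover have "d * (elapsed (s N (Suc N)) \<omega> - elapsed (s N 0) \<omega>) \<le> d * T \<omega>"
        using d elapsed_le[OF \<omega>(1), of n] by (intro mult_left_mono) (auto simp: s0 sN elapsed_start)
      ultimately show ?case unfolding S_def by simp
    qed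
  qed
  have S_lim2: "(\<lambda>N. S rung N \<omega>) \<longlonglongrightarrow> tent z h (B (\<tau> n \<omega>) \<omega>) * rung n \<omega>" if \<omega>: "\<omega> \<in> space M" for \<omega>
  proof (rule tendsto_of_approx[of 1])
    fix d :: real assume d: "0 < d"
    show "\<forall>\<^sub>F N in sequentially. \<bar>tent z h (B (\<tau> n \<omega>) \<omega>) * rung n \<omega> - S rung N \<omega>\<bar> \<le> d * 1"
      using B_uniformly_continuous[OF \<omega> n d]
    proof eventually_elim
      case (elim N)
      let ?b = "tent z h (B (\<tau> n \<omega>) \<omega>)"
      have "\<bar>?b * rung (s N (Suc N)) \<omega> - ?b * rung (s N 0) \<omega>
          - (\<Sum>k<Suc N. tent z h (B (s N k) \<omega>) * (rung (s N (Suc k)) \<omega> - rung (s N k) \<omega>))\<bar>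
          \<le> d * (rung (s N (Suc N)) \<omega> - rung (s N 0) \<omega>)"
      proof (rule telescoping_approx)
        fix k assume k: "k < Suc N"
        have "\<bar>?b * (rung (s N (Suc k)) \<omega> - rung (s N k) \<omega>) - tent z h (B (s N k) \<omega>) * (rung (s N (Suc k)) \<omega> - rung (s N k) \<omega>)\<bar>
           \<le> d * (rung (s N (Suc k)) \<omega> - rung (s N k) \<omega>)"
          using elim k by (intro rung_step[OF \<omega> n0 s_mono s_le]) (auto simp: s_def simp del: of_nat_Suc)
        then show "\<bar>?b * rung (s N (Suc k)) \<omega> - ?b * rung (s N k) \<omega> - tent z h (B (s N k) \<omega>) * (rung (s N (Suc k)) \<omega> - rung (s N k) \<omega>)\<bar>
           \<le> d * (rung (s N (Suc k)) \<omega> - rung (s N k) \<omega>)" by (simp only: right_diff_distrib)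
      qed
      moreover have "d * (rung (s N (Suc N)) \<omega> - rung (s N 0) \<omega>) \<le> d * 1"
        using d rung_bounds[of n \<omega>] by (intro mult_left_mono) (auto simp: s0 sN rung_start)
      ultimately show ?case unfolding S_def by (simp add: s0 sN rung_start)
    qed
  qed simp
  have S_nn: "0 \<le> S C N \<omega>" and S_le: "S C N \<omega> \<le> h * (C n \<omega> - C 0 \<omega>)"
    if "\<And>s t. s \<le> t \<Longrightarrow> C s \<omega> \<le> C t \<omega>" for C :: "real \<Rightarrow> 'a \<Rightarrow> real" and N \<omega>
  proof -
    show "0 \<le> S C N \<omega>" unfolding S_def using that[OF s_mono] by (intro sum_nonneg mult_nonneg_nonneg tent_nonneg) simp
    have "S C N \<omega> \<le> (\<Sum>k<Suc N. h * (C (s N (Suc k)) \<omega> - C (s N k) \<omega>))"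
      unfolding S_def using that[OF s_mono] tent_le[OF h] by (intro sum_mono mult_right_mono) auto
    also have "\<dots> = h * (\<Sum>k<Suc N. C (s N (Suc k)) \<omega> - C (s N k) \<omega>)" by (rule sum_distrib_left[symmetric])
    also have "\<dots> = h * (C n \<omega> - C 0 \<omega>)"
      using sum_lessThan_telescope[of "\<lambda>k. C (s N k) \<omega>" "Suc N"] by (simp only: s0 sN)
    finally show "S C N \<omega> \<le> h * (C n \<omega> - C 0 \<omega>)" .
  qed
  \<comment> \<open>By \<open>elapsed_rung\<close> the two sums have equal expectations term by
    term, as each weight is a function of \<open>B\<close> at one fixed time.\<close>
  have S_eq: "(\<integral>\<omega>. S elapsed N \<omega> \<partial>M) = (\<integral>\<omega>. S rung N \<omega> \<partial>M)" for N
  proof -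
    note er = elapsed_rung[OF s_nn s_nn h]
    have "(\<integral>\<omega>. S elapsed N \<omega> \<partial>M) = (\<Sum>k<Suc N. (\<integral>\<omega>. tent z h (B (s N k) \<omega>) * elapsed (s N (Suc k)) \<omega> \<partial>M) - (\<integral>\<omega>. tent z h (B (s N k) \<omega>) * elapsed (s N k) \<omega> \<partial>M))"
      unfolding S_def right_diff_distrib using er(1)
      by (subst Bochner_Integration.integral_sum) (auto intro!: sum.cong simp del: sum.lessThan_Suc)
    also have "\<dots> = (\<Sum>k<Suc N. (\<integral>\<omega>. tent z h (B (s N k) \<omega>) * rung (s N (Suc k)) \<omega> \<partial>M) - (\<integral>\<omega>. tent z h (B (s N k) \<omega>) * rung (s N k) \<omega> \<partial>M))"
      unfolding er(3) ..
    also have "\<dots> = (\<integral>\<omega>. S rung N \<omega> \<partial>M)"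
      unfolding S_def right_diff_distrib using er(2)
      by (subst Bochner_Integration.integral_sum) (auto intro!: sum.cong simp del: sum.lessThan_Suc)
    finally show ?thesis .
  qed
  have S_meas[measurable]: "S elapsed N \<in> borel_measurable M" "S rung N \<in> borel_measurable M" for N
    unfolding S_def by measurable
  have L_joint_\<tau>: "(\<lambda>(x, \<omega>). L x (\<tau> n \<omega>) \<omega>) \<in> borel_measurable (borel \<Otimes>\<^sub>M M)"
  proof (rule measurable_continuous_process)
    show "(\<lambda>\<omega>. L x (\<tau> n \<omega>) \<omega>) \<in> borel_measurable M" for x by measurable
  qed (rule L_continuous_space)
  then have joint: "(\<lambda>(x, \<omega>). L x (\<tau> n \<omega>) \<omega>) \<in> borel_measurable (\<mu> \<Otimes>\<^sub>M M)"
    by (simp add: measurable_cong_sets[OF sets_pair_measure_cong[OF sets_\<mu> refl] refl])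
  have joint2: "(\<lambda>(x, \<omega>). tent z h x * (rrate x * L x (\<tau> n \<omega>) \<omega>)) \<in> borel_measurable (\<mu> \<Otimes>\<^sub>M M)"
  proof -
    have "(\<lambda>p. tent z h (fst p) * (rrate (fst p) * (case p of (x, \<omega>) \<Rightarrow> L x (\<tau> n \<omega>) \<omega>))) \<in> borel_measurable (\<mu> \<Otimes>\<^sub>M M)"
      by (intro borel_measurable_times joint measurable_compose[OF measurable_fst] measurable_\<mu>) measurable
    then show ?thesis by (simp add: case_prod_beta)
  qed
  interpret P: pair_sigma_finite \<mu> M ..
  have nn: "0 \<le> tent z h x * (rrate x * L x (\<tau> n \<omega>) \<omega>)" if "\<omega> \<in> space M" for x \<omega>
    using tent_nonneg rrate_nonneg L_nonneg[OF that] by simp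
  have W_meas: "(\<lambda>\<omega>. weighted z h (\<tau> n \<omega>) \<omega>) \<in> borel_measurable M"
    unfolding weighted_def
    using joint2 by (intro \<mu>.borel_measurable_lebesgue_integral) (simp add: case_prod_beta measurable_pair_swap_iff[of _ \<mu> M])
  have "(\<integral>\<omega>. weighted z h (\<tau> n \<omega>) \<omega> \<partial>M) = (\<integral>\<omega>. tent z h (B (\<tau> n \<omega>) \<omega>) * rung n \<omega> \<partial>M)"
  proof (rule LIMSEQ_unique)
    show "(\<lambda>N. \<integral>\<omega>. S elapsed N \<omega> \<partial>M) \<longlonglongrightarrow> (\<integral>\<omega>. weighted z h (\<tau> n \<omega>) \<omega> \<partial>M)"
    proof (rule integral_dominated_convergence[where w="\<lambda>\<omega>. h * T \<omega>"])
      show "AE \<omega> in M. (\<lambda>N. S elapsed N \<omega>) \<longlonglongrightarrow> weighted z h (\<tau> n \<omega>) \<omega>"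
        using AE_confined AE_space by eventually_elim (rule S_lim1)
      show "AE \<omega> in M. norm (S elapsed N \<omega>) \<le> h * T \<omega>" for N
      proof (rule AE_I2)
        fix \<omega> assume \<omega>: "\<omega> \<in> space M"
        have "S elapsed N \<omega> \<le> h * (elapsed n \<omega> - elapsed 0 \<omega>)" by (rule S_le[of elapsed, OF elapsed_mono[OF \<omega>]])
        also have "\<dots> \<le> h * T \<omega>" using elapsed_le[OF \<omega>, of n] h by (intro mult_left_mono) (auto simp: elapsed_start)
        finally show "norm (S elapsed N \<omega>) \<le> h * T \<omega>" using S_nn[of elapsed, OF elapsed_mono[OF \<omega>]] by simp
      qed
    qed (use T_integrable W_meas in auto)
    have "(\<lambda>N. \<integral>\<omega>. S rung N \<omega> \<partial>M) \<longlonglongrightarrow> (\<integral>\<omega>. tent z h (B (\<tau> n \<omega>) \<omega>) * rung n \<omega> \<partial>M)"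
    proof (rule integral_dominated_convergence[where w="\<lambda>\<omega>. h"])
      show "AE \<omega> in M. norm (S rung N \<omega>) \<le> h" for N
      proof (rule AE_I2)
        fix \<omega> assume \<omega>: "\<omega> \<in> space M"
        have "S rung N \<omega> \<le> h * (rung n \<omega> - rung 0 \<omega>)" by (rule S_le[of rung, OF rung_mono[OF \<omega>]])
        also have "\<dots> \<le> h * 1" using rung_bounds[of n \<omega>] h by (intro mult_left_mono) (auto simp: rung_start)
        finally show "norm (S rung N \<omega>) \<le> h" using S_nn[of rung, OF rung_mono[OF \<omega>]] by simp
      qed
    qed (use S_lim2 in auto)
    then show "(\<lambda>N. \<integral>\<omega>. S elapsed N \<omega> \<partial>M) \<longlonglongrightarrow> (\<integral>\<omega>. tent z h (B (\<tau> n \<omega>) \<omega>) * rung n \<omega> \<partial>M)"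
      by (simp only: S_eq)
  qed
  \<comment> \<open>Exchanging the expectation with the integral over \<open>x\<close> turns the
    local time at \<open>\<tau> n\<close> into \<open>gap (law n) x0\<close>.\<close>
  moreover have "(\<integral>\<omega>. weighted z h (\<tau> n \<omega>) \<omega> \<partial>M) = (\<integral>x. tent z h x * (rrate x * gap (law n) x0 x) \<partial>\<mu>)"
  proof -
    have "(\<integral>\<omega>. weighted z h (\<tau> n \<omega>) \<omega> \<partial>M) = enn2real (\<integral>\<^sup>+\<omega>. ennreal (weighted z h (\<tau> n \<omega>) \<omega>) \<partial>M)"
      using W_meas nn by (intro integral_eq_nn_integral) (auto simp: weighted_def intro!: integral_nonneg_AE)
    also have "(\<integral>\<^sup>+\<omega>. ennreal (weighted z h (\<tau> n \<omega>) \<omega>) \<partial>M) = (\<integral>\<^sup>+\<omega>. (\<integral>\<^sup>+x. ennreal (tent z h x * (rrate x * L x (\<tau> n \<omega>) \<omega>)) \<partial>\<mu>) \<partial>M)"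
    proof (rule nn_integral_cong)
      fix \<omega> assume \<omega>: "\<omega> \<in> space M"
      show "ennreal (weighted z h (\<tau> n \<omega>) \<omega>) = (\<integral>\<^sup>+x. ennreal (tent z h x * (rrate x * L x (\<tau> n \<omega>) \<omega>)) \<partial>\<mu>)"
        unfolding weighted_def using nn[OF \<omega>]
        by (intro nn_integral_eq_integral[symmetric] tent_rrate_L_integrable[OF \<omega> n0 order_refl h]) auto
    qed
    also have "\<dots> = (\<integral>\<^sup>+x. (\<integral>\<^sup>+\<omega>. ennreal (tent z h x * (rrate x * L x (\<tau> n \<omega>) \<omega>)) \<partial>M) \<partial>\<mu>)"
      using joint2 by (intro P.Fubini') (simp add: case_prod_beta)
    also have "\<dots> = (\<integral>\<^sup>+x. ennreal (tent z h x * (rrate x * gap (law n) x0 x)) \<partial>\<mu>)"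
    proof (rule nn_integral_cong)
      fix x
      have i: "integrable M (\<lambda>\<omega>. L x (\<tau> n \<omega>) \<omega>)" by (rule stopped(3)[OF \<tau>_optional[OF n0]])
      have "(\<integral>\<^sup>+\<omega>. ennreal (tent z h x * (rrate x * L x (\<tau> n \<omega>) \<omega>)) \<partial>M) = ennreal (\<integral>\<omega>. tent z h x * (rrate x * L x (\<tau> n \<omega>) \<omega>) \<partial>M)"
        using i nn by (intro nn_integral_eq_integral) auto
      also have "(\<integral>\<omega>. tent z h x * (rrate x * L x (\<tau> n \<omega>) \<omega>) \<partial>M) = tent z h x * (rrate x * gap (law n) x0 x)"
        using i by (simp add: gap_law[OF n0])
      finally show "(\<integral>\<^sup>+\<omega>. ennreal (tent z h x * (rrate x * L x (\<tau> n \<omega>) \<omega>)) \<partial>M) = ennreal (tent z h x * (rrate x * gap (law n) x0 x))" .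
    qed
    also have "enn2real \<dots> = (\<integral>x. tent z h x * (rrate x * gap (law n) x0 x) \<partial>\<mu>)"
    proof (rule integral_eq_nn_integral[symmetric])
      have [measurable]: "gap (law n) x0 \<in> borel_measurable borel"
        by (rule borel_measurable_continuous_onI[OF continuous_on_gap[OF law_centred[OF n0]]])
      show "(\<lambda>x. tent z h x * (rrate x * gap (law n) x0 x)) \<in> borel_measurable \<mu>" by (rule measurable_\<mu>) measurable
    qed (simp add: tent_nonneg rrate_nonneg gap_nonneg[OF law_centred[OF n0]])
    finally show ?thesis .
  qed
  ultimately show ?thesis by simp
qed

lemma tent_rrate_integrable:
  assumes zh: "{z - h..z + h} \<subseteq> I" and v: "continuous_on UNIV v"
  shows "integrable \<mu> (\<lambda>x. tent z h x * (rrate x * v x))"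
proof -
  have "continuous_on {z - h..z + h} (\<lambda>x. tent z h x * (v x / w x))"
  proof (intro continuous_intros continuous_on_tent w_continuous continuous_on_subset[OF v] subset_UNIV ballI)
    fix x assume "x \<in> {z - h..z + h}" then show "w x \<noteq> 0" using gap_pos[of x] zh by auto
  qed
  then have "bounded ((\<lambda>x. tent z h x * (v x / w x)) ` {z - h..z + h})"
    by (intro compact_imp_bounded compact_continuous_image) auto
  then obtain K where K: "\<forall>y\<in>(\<lambda>x. tent z h x * (v x / w x)) ` {z - h..z + h}. norm y \<le> K" unfolding bounded_iff by blast
  have [measurable]: "v \<in> borel_measurable borel" by (rule borel_measurable_continuous_onI[OF v])
  show ?thesis
  proof (rule \<mu>.integrable_const_bound[where B="max 0 K"])
    show "AE x in \<mu>. norm (tent z h x * (rrate x * v x)) \<le> max 0 K"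
    proof (rule AE_I2)
      fix x
      show "norm (tent z h x * (rrate x * v x)) \<le> max 0 K"
      proof (cases "x \<in> {z - h..z + h}")
        case True
        then have "tent z h x * (rrate x * v x) = tent z h x * (v x / w x)" using zh by (auto simp: rrate_def)
        then show ?thesis using K True by (auto simp: le_max_iff_disj)
      next
        case False then show ?thesis by (simp add: tent_eq_0)
      qed
    qed
    show "(\<lambda>x. tent z h x * (rrate x * v x)) \<in> borel_measurable \<mu>" by (rule measurable_\<mu>) measurable
  qed
qed

text \<open>On \<open>I\<close> the product \<open>rrate x * w x\<close> is 1, that is,
  \<open>\<mu>\<close> is \<open>w\<close> times the speed measure. This is the reason for the
  density \<open>1 / w\<close>: it makes the target satisfy the equation that the limit law must
  satisfy.\<close>

lemma tent_rrate_gap: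
  assumes zh: "{z - h..z + h} \<subseteq> I"
  shows "(\<integral>x. tent z h x * (rrate x * w x) \<partial>\<mu>) = (\<integral>x. tent z h x \<partial>\<mu>)"
proof (rule Bochner_Integration.integral_cong[OF refl])
  fix x
  show "tent z h x * (rrate x * w x) = tent z h x"
  proof (cases "x \<in> {z - h..z + h}")
    case True
    then have "x \<in> I" using zh by auto
    then show ?thesis using gap_pos[of x] by (simp add: rrate_def)
  qed (simp add: tent_eq_0)
qed

lemma tent_rrate_mono:
  assumes zh: "{z - h..z + h} \<subseteq> I" and v: "continuous_on UNIV v" "continuous_on UNIV v'"
    and le: "\<And>x. x \<in> {z - h..z + h} \<Longrightarrow> v x \<le> v' x"
  shows "(\<integral>x. tent z h x * (rrate x * v x) \<partial>\<mu>) \<le> (\<integral>x. tent z h x * (rrate x * v' x) \<partial>\<mu>)"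
proof (rule integral_mono[OF tent_rrate_integrable[OF zh v(1)] tent_rrate_integrable[OF zh v(2)]])
  fix x
  show "tent z h x * (rrate x * v x) \<le> tent z h x * (rrate x * v' x)"
    using le[of x] by (cases "x \<in> {z - h..z + h}") (auto intro!: mult_left_mono simp: tent_nonneg rrate_nonneg tent_eq_0)
qed

section \<open>Domination by the potential of the target\<close>

lemma gap_eq_0_confined:
  assumes \<nu>: "centred_law \<nu> x0" and conf: "AE x in \<nu>. x \<in> I \<union> ends" and x: "x \<notin> I"
  shows "gap \<nu> x0 x = 0"
proof (rule gap_eq_0_outside[OF \<nu>])
  show "AE x in \<nu>. supp_lower \<mu> \<le> ereal x \<and> ereal x \<le> supp_upper \<mu>"
    using conf
  proof eventually_elim
    case (elim x)
    have "supp_lower \<mu> < supp_upper \<mu>"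
      using x0_interior less_trans[of "supp_lower \<mu>" "ereal x0" "supp_upper \<mu>"] by (simp add: support_interior_def)
    then show ?case using elim by (auto simp: support_interior_def support_ends_def)
  qed
  show "supp_lower \<mu> < ereal x0" "ereal x0 < supp_upper \<mu>" using x0_interior by (auto simp: support_interior_def)
  show "ereal x \<le> supp_lower \<mu> \<or> supp_upper \<mu> \<le> ereal x" using x by (auto simp: support_interior_def not_less)
qed

lemma gap_law_le:
  assumes n: "0 < n" shows "gap (law n) x0 x \<le> w x"
proof (rule gap_comparison[OF law_centred centred open_support_interior])
  show "0 \<le> n" using n by simp
  then have n0: "0 \<le> n" .
  note [measurable] = \<tau>_measurable[OF n0]
  \<comment> \<open>The path is confined until \<open>\<tau> n\<close>, so \<open>law n\<close>
    lives on \<open>I\<close> and its ends; hence its gap vanishes off \<open>I\<close>.\<close>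
  have conf: "AE x in law n. x \<in> I \<union> ends"
    unfolding law_def
  proof (subst AE_distr_iff)
    show "{x \<in> space borel. x \<in> I \<union> ends} \<in> sets borel"
    proof -
      have "{x \<in> space borel. x \<in> I \<union> ends} = I \<union> ends" by auto
      then show ?thesis by (simp only: sets.Un[OF I_borel borel_closed[OF finite_imp_closed[OF finite_support_ends]]])
    qed
    show "AE \<omega> in M. B (\<tau> n \<omega>) \<omega> \<in> I \<union> ends"
      using AE_confined AE_space
    proof eventually_elim
      case (elim \<omega>)
      show ?case
        using confinedD(1)[OF elim(2,1) clock_finite_before_\<tau> \<tau>_nonneg[OF n0] order_refl] by simp
    qed
  qed measurable
  show "gap (law n) x0 x \<le> w x" if "x \<notin> I" for x
    using gap_eq_0_confined[OF law_centred[OF n0] conf that] gap_nonneg[OF centred] by simp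
  fix z h :: real assume h: "0 < h" and zh: "{z - h..z + h} \<subseteq> I"
    and lt: "\<And>y. y \<in> {z - h..z + h} \<Longrightarrow> w y < gap (law n) x0 y"
  have h0: "0 \<le> h" using h by simp
  have "(\<integral>y. tent z h y \<partial>\<mu>) = (\<integral>x. tent z h x * (rrate x * w x) \<partial>\<mu>)" by (rule tent_rrate_gap[OF zh, symmetric])
  also have "\<dots> \<le> (\<integral>x. tent z h x * (rrate x * gap (law n) x0 x) \<partial>\<mu>)"
    by (rule tent_rrate_mono[OF zh w_continuous continuous_on_gap[OF law_centred[OF n0]]]) (auto intro: less_imp_le[OF lt])
  also have "\<dots> = (\<integral>\<omega>. tent z h (B (\<tau> n \<omega>) \<omega>) * rung n \<omega> \<partial>M)" by (rule tent_identity[OF n h0 zh, symmetric])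
  \<comment> \<open>Paths that reach the horizon \<open>n\<close> with the clock still at most
    \<open>T\<close> are counted on the right-hand side only; they increase the tent integral of
    \<open>law n\<close>, which is the favourable direction.\<close>
  also have "\<dots> \<le> (\<integral>\<omega>. tent z h (B (\<tau> n \<omega>) \<omega>) \<partial>M)"
  proof (rule integral_mono)
    show i: "integrable M (\<lambda>\<omega>. tent z h (B (\<tau> n \<omega>) \<omega>))"
      using tent_nonneg tent_le[OF h0] by (intro integrable_const_bound[where B=h]) auto
    show "tent z h (B (\<tau> n \<omega>) \<omega>) * rung n \<omega> \<le> tent z h (B (\<tau> n \<omega>) \<omega>)" for \<omega>
      using mult_left_mono[OF rung_bounds(2) tent_nonneg] by simp
    show "integrable M (\<lambda>\<omega>. tent z h (B (\<tau> n \<omega>) \<omega>) * rung n \<omega>)"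
    proof (rule Bochner_Integration.integrable_bound[OF i])
      show "AE \<omega> in M. norm (tent z h (B (\<tau> n \<omega>) \<omega>) * rung n \<omega>) \<le> norm (tent z h (B (\<tau> n \<omega>) \<omega>))"
        using mult_left_mono[OF rung_bounds(2) tent_nonneg] rung_bounds(1) tent_nonneg by (intro AE_I2) (simp add: abs_mult)
    qed measurable
  qed
  also have "\<dots> = (\<integral>y. tent z h y \<partial>law n)"
    unfolding law_def by (rule integral_distr[symmetric]) measurable
  finally show "(\<integral>y. tent z h y \<partial>\<mu>) \<le> (\<integral>y. tent z h y \<partial>law n)" .
qed

text \<open>Local times increase with time, so stopping at any optional time before
  \<open>\<tau> n\<close> gives a gap that is at most the gap of \<open>law n\<close>.\<close>

lemma stopped_gap_le:
  assumes n: "0 < n" and \<sigma>: "optional_time M F c \<sigma>" and le: "\<And>\<omega>. \<omega> \<in> space M \<Longrightarrow> \<sigma> \<omega> \<le> \<tau> n \<omega>"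
  shows "centred_law (distr M borel (\<lambda>\<omega>. B (\<sigma> \<omega>) \<omega>)) x0" "gap (distr M borel (\<lambda>\<omega>. B (\<sigma> \<omega>) \<omega>)) x0 x \<le> w x"
proof -
  have n0: "0 \<le> n" using n by simp
  note st = stopped[OF \<sigma>]
  note st' = stopped[OF \<tau>_optional[OF n0]]
  have [measurable]: "(\<lambda>\<omega>. B (\<sigma> \<omega>) \<omega>) \<in> borel_measurable M" using st(1) by simp
  show "centred_law (distr M borel (\<lambda>\<omega>. B (\<sigma> \<omega>) \<omega>)) x0"
    unfolding centred_law_def using st(1,2) by (auto intro!: prob_space_distr simp: integrable_distr_eq integral_distr)
  have "potential (distr M borel (\<lambda>\<omega>. B (\<sigma> \<omega>) \<omega>)) x = (\<integral>\<omega>. \<bar>B (\<sigma> \<omega>) \<omega> - x\<bar> \<partial>M)"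
    unfolding potential_def by (subst integral_distr) (auto simp: abs_minus_commute)
  then have "gap (distr M borel (\<lambda>\<omega>. B (\<sigma> \<omega>) \<omega>)) x0 x = (\<integral>\<omega>. L x (\<sigma> \<omega>) \<omega> \<partial>M)"
    using st(4)[of x] by (simp add: gap_def abs_minus_commute)
  also have "\<dots> \<le> (\<integral>\<omega>. L x (\<tau> n \<omega>) \<omega> \<partial>M)"
    using le by (intro integral_mono st(3) st'(3) L_mono) auto
  also have "\<dots> = gap (law n) x0 x" by (simp add: gap_law[OF n0])
  also have "\<dots> \<le> w x" by (rule gap_law_le[OF n])
  finally show "gap (distr M borel (\<lambda>\<omega>. B (\<sigma> \<omega>) \<omega>)) x0 x \<le> w x" .
qed

lemma stopped_excess_le:
  assumes n: "0 < n" and \<sigma>: "optional_time M F c \<sigma>" and le: "\<And>\<omega>. \<omega> \<in> space M \<Longrightarrow> \<sigma> \<omega> \<le> \<tau> n \<omega>" and K: "0 \<le> K"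
  shows "(\<integral>\<omega>. excess K (B (\<sigma> \<omega>) \<omega>) \<partial>M) \<le> (\<integral>x. excess K x \<partial>\<mu>)"
proof -
  have [measurable]: "(\<lambda>\<omega>. B (\<sigma> \<omega>) \<omega>) \<in> borel_measurable M" using stopped(1)[OF \<sigma>] by simp
  have "(\<integral>\<omega>. excess K (B (\<sigma> \<omega>) \<omega>) \<partial>M) = (\<integral>x. excess K x \<partial>(distr M borel (\<lambda>\<omega>. B (\<sigma> \<omega>) \<omega>)))"
    by (subst integral_distr) auto
  also have "\<dots> \<le> (\<integral>x. excess K x \<partial>\<mu>)"
    by (rule excess_integral_mono_gap[OF stopped_gap_le(1)[OF n \<sigma> le] centred stopped_gap_le(2)[OF n \<sigma> le] K])
  finally show ?thesis .
qed

text \<open>The density of \<open>B n - x0\<close> is at most \<open>1 / sqrt n\<close>, so the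
  probability of a fixed bounded set vanishes as \<open>n\<close> grows.\<close>

lemma prob_B_small:
  assumes n: "0 < n" and K: "0 \<le> K"
  shows "prob {\<omega>\<in>space M. \<bar>B n \<omega>\<bar> \<le> K} \<le> 2 * K / sqrt n"
proof -
  have D: "distributed M lborel (\<lambda>\<omega>. B n \<omega> - B 0 \<omega>) (normal_density 0 (sqrt n))"
    using B_normal[of 0 n] n by simp
  let ?J = "{- K - x0..K - x0}"
  have "{\<omega>\<in>space M. \<bar>B n \<omega>\<bar> \<le> K} = (\<lambda>\<omega>. B n \<omega> - B 0 \<omega>) -` ?J \<inter> space M"
    by (auto simp: B_start)
  then have "ennreal (prob {\<omega>\<in>space M. \<bar>B n \<omega>\<bar> \<le> K}) = (\<integral>\<^sup>+x. ennreal (normal_density 0 (sqrt n) x) * indicator ?J x \<partial>lborel)"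
    using distributed_emeasure[OF D, of ?J] by (simp add: emeasure_eq_measure)
  also have "\<dots> \<le> (\<integral>\<^sup>+x. ennreal (1 / sqrt n) * indicator ?J x \<partial>lborel)"
  proof (intro nn_integral_mono mult_right_mono ennreal_leI)
    fix x
    have "normal_density 0 (sqrt n) x = 1 / sqrt (2 * pi * n) * exp (- x\<^sup>2 / (2 * n))"
      using n by (simp add: normal_density_def)
    also have "\<dots> \<le> 1 / sqrt n * 1"
    proof (intro mult_mono)
      have "1 \<le> 2 * pi" using pi_gt3 by simp
      then have "n \<le> 2 * pi * n" using n by simp
      then show "1 / sqrt (2 * pi * n) \<le> 1 / sqrt n" using n by (intro divide_left_mono) auto
    qed (use n in auto)
    finally show "normal_density 0 (sqrt n) x \<le> 1 / sqrt n" by simp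
  qed simp
  also have "\<dots> = ennreal (1 / sqrt n * (2 * K))"
    using n K by (subst nn_integral_cmult_indicator) (auto simp: ennreal_mult[symmetric])
  finally show ?thesis using n K by (simp add: ennreal_le_iff mult.commute)
qed

text \<open>The stopped process is bounded in \<open>L\<^sup>1\<close> while \<open>B\<close> itself is not.\<close>

lemma AE_clock_exceeds: "AE \<omega> in M. \<exists>k::nat. ennreal (T \<omega>) < clock (real k) \<omega>"
proof -
  define N where "N k = {\<omega>\<in>space M. clock (real k) \<omega> \<le> ennreal (T \<omega>)}" for k :: nat
  have N[measurable]: "N k \<in> sets M" for k unfolding N_def by measurable
  \<comment> \<open>\<open>C\<close> bounds the mean of \<open>\<bar>B\<bar>\<close> at every
    \<open>\<tau> k\<close> with positive \<open>k\<close>: this mean is the potential of the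
    stopped law at 0, and \<open>gap_law_le\<close> compares it with that of
    \<open>\<mu>\<close>.\<close>
  define C where "C = potential \<mu> 0"
  have C: "0 \<le> C" unfolding C_def potential_def by (intro integral_nonneg_AE) auto
  have bound: "prob (N k) \<le> C / K + 2 * K / sqrt (real k)" if k: "0 < k" and K: "0 < K" for k :: nat and K
  proof -
    have k0: "0 < real k" "0 \<le> real k" using k by auto
    note st = stopped[OF \<tau>_optional[OF k0(2)]]
    have [measurable]: "(\<lambda>\<omega>. B (\<tau> k \<omega>) \<omega>) \<in> borel_measurable M" using st(1) by simp
    \<comment> \<open>On \<open>N k\<close> there is no stopping before \<open>k\<close>, so
      \<open>B (\<tau> k)\<close> is \<open>B k\<close>. Large values are rare by Markov's
      inequality, small ones by \<open>prob_B_small\<close>.\<close>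
    have "N k \<subseteq> {\<omega>\<in>space M. K \<le> \<bar>B (\<tau> k \<omega>) \<omega>\<bar>} \<union> {\<omega>\<in>space M. \<bar>B k \<omega>\<bar> \<le> K}"
    proof
      fix \<omega> assume \<omega>: "\<omega> \<in> N k"
      then have "\<not> \<tau> k \<omega> < real k"
        using clock_after_\<tau>[of \<omega> "real k" "real k"] by (auto simp: N_def not_less[symmetric])
      then have "\<tau> k \<omega> = real k" using \<tau>_le[of "real k" \<omega>] by simp
      then show "\<omega> \<in> {\<omega>\<in>space M. K \<le> \<bar>B (\<tau> k \<omega>) \<omega>\<bar>} \<union> {\<omega>\<in>space M. \<bar>B k \<omega>\<bar> \<le> K}"
        using \<omega> by (auto simp: N_def)
    qed
    then have "prob (N k) \<le> prob ({\<omega>\<in>space M. K \<le> \<bar>B (\<tau> k \<omega>) \<omega>\<bar>} \<union> {\<omega>\<in>space M. \<bar>B k \<omega>\<bar> \<le> K})"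
      by (intro finite_measure_mono) measurable
    also have "\<dots> \<le> prob {\<omega>\<in>space M. K \<le> \<bar>B (\<tau> k \<omega>) \<omega>\<bar>} + prob {\<omega>\<in>space M. \<bar>B k \<omega>\<bar> \<le> K}"
      by (intro measure_Un_le) measurable
    also have "prob {\<omega>\<in>space M. K \<le> \<bar>B (\<tau> k \<omega>) \<omega>\<bar>} \<le> (\<integral>\<omega>. \<bar>B (\<tau> k \<omega>) \<omega>\<bar> \<partial>M) / K"
      using st(1) K by (intro integral_Markov_inequality_measure[where A="{}"]) auto
    also have "(\<integral>\<omega>. \<bar>B (\<tau> k \<omega>) \<omega>\<bar> \<partial>M) \<le> C"
      using gap_law_le[OF k0(1), of 0, unfolded gap_law[OF k0(2)]] st(4)[of 0] by (simp add: gap_def C_def)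
    also have "prob {\<omega>\<in>space M. \<bar>B k \<omega>\<bar> \<le> K} \<le> 2 * K / sqrt (real k)"
      by (rule prob_B_small[OF k0(1)]) (use K in simp)
    finally show ?thesis using K by (simp add: divide_right_mono)
  qed
  have le0: "prob (\<Inter>k. N k) \<le> 0"
  proof (rule field_le_epsilon)
    fix e :: real assume e: "0 < e"
    \<comment> \<open>Chosen such that \<open>C / K \<le> e / 2\<close>; adding 1 keeps
      \<open>K\<close> positive when \<open>C = 0\<close>.\<close>
    define K where "K = 2 * (C + 1) / e"
    have K: "0 < K" using e C by (simp add: K_def)
    have "(\<lambda>k. 2 * K / sqrt (real k)) \<longlonglongrightarrow> 0"
      by (intro tendsto_divide_0[OF tendsto_const] filterlim_at_top_imp_at_infinity filterlim_compose[OF sqrt_at_top filterlim_real_sequentially])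
    then have "\<forall>\<^sub>F k in sequentially. 2 * K / sqrt (real k) < e / 2" using e by (intro order_tendstoD) auto
    from eventually_happens'[OF sequentially_bot eventually_conj[OF eventually_gt_at_top[of 0] this]]
    obtain k where k: "0 < k" "2 * K / sqrt (real k) < e / 2" by auto
    have "prob (\<Inter>k. N k) \<le> prob (N k)" by (intro finite_measure_mono) auto
    also have "\<dots> \<le> C / K + 2 * K / sqrt (real k)" by (rule bound[OF k(1) K])
    also have "C / K \<le> e / 2" using C e by (simp add: K_def field_simps)
    finally show "prob (\<Inter>k. N k) \<le> 0 + e" using k(2) by simp
  qed
  have "prob (\<Inter>k. N k) = 0" using le0 measure_nonneg[of M "\<Inter>k. N k"] by linarith
  then have "(\<Inter>k. N k) \<in> null_sets M" by (intro null_setsI) (auto simp: emeasure_eq_measure)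
  then have "AE \<omega> in M. \<omega> \<notin> (\<Inter>k. N k)" by (rule AE_not_in)
  then show ?thesis using AE_space
    by eventually_elim (auto simp: N_def not_le)
qed

text \<open>Almost surely the sequence is eventually constant; on the remaining null set \<^const>\<open>lim\<close> is arbitrary.\<close>

definition stop :: "'a \<Rightarrow> real" where
  "stop \<omega> = lim (\<lambda>k. \<tau> (real k) \<omega>)"

section \<open>Removing the horizon\<close>

lemma \<tau>_eq_min:
  assumes k: "0 \<le> k" "ennreal (T \<omega>) < clock k \<omega>" and n: "0 \<le> n"
  shows "\<tau> n \<omega> = min n (\<tau> k \<omega>)"
proof -
  let ?S = "{r. 0 \<le> r \<and> ennreal (T \<omega>) < clock r \<omega>}"
  have S: "?S \<noteq> {}" "bdd_below ?S" "k \<in> ?S" using k by (auto intro!: bdd_belowI[of _ 0])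
  have eq: "\<tau> n \<omega> = min n (Inf ?S)" for n
    unfolding \<tau>_def debut_def using cInf_insert[OF S(1,2), of n] by (simp only: inf_min)
  have "Inf ?S \<le> k" by (rule cInf_lower[OF S(3,2)])
  then show ?thesis unfolding eq by simp
qed

lemma stop_eq_\<tau>:
  assumes k: "0 \<le> k" "ennreal (T \<omega>) < clock k \<omega>" and n: "0 \<le> n"
  shows "stop \<omega> = \<tau> k \<omega>" "\<tau> n \<omega> = min n (stop \<omega>)"
proof -
  have "\<forall>\<^sub>F n in sequentially. \<tau> (real n) \<omega> = \<tau> k \<omega>"
    using eventually_ge_at_top[of "nat \<lceil>k\<rceil>"]
  proof eventually_elim
    case (elim n)
    then have "k \<le> real n" by linarith
    then show ?case using \<tau>_eq_min[OF k, of "real n"] \<tau>_le[of k \<omega>] by simp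
  qed
  then have "(\<lambda>n. \<tau> (real n) \<omega>) \<longlonglongrightarrow> \<tau> k \<omega>" by (rule tendsto_eventually)
  then show "stop \<omega> = \<tau> k \<omega>" unfolding stop_def by (rule limI)
  then show "\<tau> n \<omega> = min n (stop \<omega>)" using \<tau>_eq_min[OF k n] by simp
qed

lemma stop_measurable [measurable]: "stop \<in> borel_measurable M"
  unfolding stop_def by (intro borel_measurable_lim_metric \<tau>_measurable) simp

lemma AE_stop: "AE \<omega> in M. 0 \<le> stop \<omega> \<and> (\<forall>n\<ge>0. \<tau> n \<omega> = min n (stop \<omega>)) \<and> (\<forall>\<^sub>F n in sequentially. ennreal (T \<omega>) < clock (real n) \<omega>)"
  using AE_clock_exceeds AE_space
proof eventually_elim
  case (elim \<omega>)
  then obtain k :: nat where k: "ennreal (T \<omega>) < clock (real k) \<omega>" by auto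
  have "\<forall>\<^sub>F n in sequentially. ennreal (T \<omega>) < clock (real n) \<omega>"
    using eventually_ge_at_top[of k]
    by eventually_elim (use k clock_mono[OF elim(2)] in \<open>meson less_le_trans of_nat_le_iff\<close>)
  then show ?case using stop_eq_\<tau>[OF of_nat_0_le_iff k] \<tau>_nonneg[of "real k" \<omega>] by auto
qed

lemma AE_stop_eventually: "AE \<omega> in M. \<forall>\<^sub>F n in sequentially. \<tau> (real n) \<omega> = stop \<omega>"
  using AE_stop
proof eventually_elim
  case (elim \<omega>)
  show ?case using eventually_ge_at_top[of "nat \<lceil>stop \<omega>\<rceil>"]
  proof eventually_elim
    case (elim n)
    then have "stop \<omega> \<le> real n" by linarith
    then show ?case using \<open>0 \<le> stop \<omega> \<and> _\<close> by simp
  qed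
qed

lemma excess_uniform:
  assumes "0 < \<epsilon>" obtains K where "0 \<le> K" "(\<integral>x. excess K x \<partial>\<mu>) \<le> \<epsilon>"
  using excess_integral_small[OF centred_lawD(3)[OF centred] assms] by auto

text \<open>The passage to infinite horizon. By \<open>stopped_excess_le\<close> the excesses of all
  \<open>B (\<sigma> n)\<close> are bounded by that of \<open>\<mu>\<close>, so Vitali's theorem
  applies to a sequence that is almost surely eventually constant. Horizons are \<open>Suc n\<close>
  because \<open>gap_law_le\<close> is about positive ones.\<close>

lemma stopped_limit:
  assumes \<sigma>: "\<And>n. optional_time M F (c n) (\<sigma> n)" and le: "\<And>n \<omega>. \<omega> \<in> space M \<Longrightarrow> \<sigma> n \<omega> \<le> \<tau> (real (Suc n)) \<omega>"
    and lim: "AE \<omega> in M. \<forall>\<^sub>F n in sequentially. B (\<sigma> n \<omega>) \<omega> = Y \<omega>" and Y[measurable]: "Y \<in> borel_measurable M"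
  shows "integrable M Y" "(\<integral>\<omega>. Y \<omega> \<partial>M) = x0" "(\<lambda>n. \<integral>\<omega>. \<bar>B (\<sigma> n \<omega>) \<omega> - Y \<omega>\<bar> \<partial>M) \<longlonglongrightarrow> 0"
    "0 \<le> K \<Longrightarrow> (\<integral>\<omega>. excess K (Y \<omega>) \<partial>M) \<le> (\<integral>x. excess K x \<partial>\<mu>)"
proof -
  note st = stopped[OF \<sigma>]
  note ex = stopped_excess_le[OF _ \<sigma> le]
  have ui: "\<exists>K\<ge>0. \<forall>n. (\<integral>\<omega>. excess K (B (\<sigma> n \<omega>) \<omega>) \<partial>M) \<le> \<epsilon>" if \<epsilon>: "0 < \<epsilon>" for \<epsilon>
  proof -
    obtain K where K: "0 \<le> K" "(\<integral>x. excess K x \<partial>\<mu>) \<le> \<epsilon>" by (rule excess_uniform[OF \<epsilon>])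
    have "(\<integral>\<omega>. excess K (B (\<sigma> n \<omega>) \<omega>) \<partial>M) \<le> \<epsilon>" for n
      using ex[of n K] K by (meson of_nat_0_less_iff order_trans zero_less_Suc)
    then show ?thesis using K(1) by auto
  qed
  have lim': "AE \<omega> in M. (\<lambda>n. B (\<sigma> n \<omega>) \<omega>) \<longlonglongrightarrow> Y \<omega>"
    using lim by eventually_elim (rule tendsto_eventually)
  note V = vitali_excess[of "\<lambda>n \<omega>. B (\<sigma> n \<omega>) \<omega>" Y, OF st(1) Y lim' ui]
  show iY: "integrable M Y" by (rule V(1))
  show l1: "(\<lambda>n. \<integral>\<omega>. \<bar>B (\<sigma> n \<omega>) \<omega> - Y \<omega>\<bar> \<partial>M) \<longlonglongrightarrow> 0" by (rule V(2))
  have "(\<lambda>n. \<integral>\<omega>. B (\<sigma> n \<omega>) \<omega> * indicator (space M) \<omega> \<partial>M) \<longlonglongrightarrow> (\<integral>\<omega>. Y \<omega> * indicator (space M) \<omega> \<partial>M)"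
    by (rule L1_tendsto_integral_indicator[OF st(1) iY sets.top l1])
  moreover have "(\<integral>\<omega>. g \<omega> * indicator (space M) \<omega> \<partial>M) = (\<integral>\<omega>. g \<omega> \<partial>M)" for g :: "'a \<Rightarrow> real"
    by (intro Bochner_Integration.integral_cong) auto
  ultimately show "(\<integral>\<omega>. Y \<omega> \<partial>M) = x0" by (simp add: st(2) LIMSEQ_const_iff)
  assume K: "0 \<le> K"
  have "(\<lambda>n. (\<integral>\<omega>. excess K (B (\<sigma> n \<omega>) \<omega>) \<partial>M) - (\<integral>\<omega>. excess K (Y \<omega>) \<partial>M)) \<longlonglongrightarrow> 0"
  proof (rule Lim_null_comparison[OF always_eventually l1], intro allI)
    fix n
    have "norm ((\<integral>\<omega>. excess K (B (\<sigma> n \<omega>) \<omega>) \<partial>M) - (\<integral>\<omega>. excess K (Y \<omega>) \<partial>M)) = norm (\<integral>\<omega>. excess K (B (\<sigma> n \<omega>) \<omega>) - excess K (Y \<omega>) \<partial>M)"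
      using integrable_excess[OF st(1) K] integrable_excess[OF iY K] by simp
    also have "\<dots> \<le> (\<integral>\<omega>. \<bar>excess K (B (\<sigma> n \<omega>) \<omega>) - excess K (Y \<omega>)\<bar> \<partial>M)"
      using integral_norm_bound[of M "\<lambda>\<omega>. excess K (B (\<sigma> n \<omega>) \<omega>) - excess K (Y \<omega>)"] by simp
    also have "\<dots> \<le> (\<integral>\<omega>. \<bar>B (\<sigma> n \<omega>) \<omega> - Y \<omega>\<bar> \<partial>M)"
    proof (rule integral_mono)
      show "\<bar>excess K (B (\<sigma> n \<omega>) \<omega>) - excess K (Y \<omega>)\<bar> \<le> \<bar>B (\<sigma> n \<omega>) \<omega> - Y \<omega>\<bar>" for \<omega>
        by (rule excess_lipschitz)
      show "integrable M (\<lambda>\<omega>. \<bar>excess K (B (\<sigma> n \<omega>) \<omega>) - excess K (Y \<omega>)\<bar>)"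
        by (intro integrable_abs Bochner_Integration.integrable_diff integrable_excess st(1) iY K)
      show "integrable M (\<lambda>\<omega>. \<bar>B (\<sigma> n \<omega>) \<omega> - Y \<omega>\<bar>)"
        by (intro integrable_abs Bochner_Integration.integrable_diff st(1) iY)
    qed
    finally show "norm ((\<integral>\<omega>. excess K (B (\<sigma> n \<omega>) \<omega>) \<partial>M) - (\<integral>\<omega>. excess K (Y \<omega>) \<partial>M)) \<le> (\<integral>\<omega>. \<bar>B (\<sigma> n \<omega>) \<omega> - Y \<omega>\<bar> \<partial>M)" .
  qed
  then have "(\<lambda>n. \<integral>\<omega>. excess K (B (\<sigma> n \<omega>) \<omega>) \<partial>M) \<longlonglongrightarrow> (\<integral>\<omega>. excess K (Y \<omega>) \<partial>M)" by (simp add: LIM_zero_iff)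
  then show "(\<integral>\<omega>. excess K (Y \<omega>) \<partial>M) \<le> (\<integral>x. excess K x \<partial>\<mu>)"
    by (rule LIMSEQ_le_const2) (use ex K in auto)
qed

lemma AE_stop_eventually_Suc: "AE \<omega> in M. \<forall>\<^sub>F n in sequentially. \<tau> (real (Suc n)) \<omega> = stop \<omega>"
  using AE_stop_eventually by eventually_elim (rule eventually_sequentially_Suc[THEN iffD2])

lemma B_stop_limit:
  "integrable M (\<lambda>\<omega>. B (stop \<omega>) \<omega>)" "(\<integral>\<omega>. B (stop \<omega>) \<omega> \<partial>M) = x0"
  "(\<lambda>n. \<integral>\<omega>. \<bar>B (\<tau> (real (Suc n)) \<omega>) \<omega> - B (stop \<omega>) \<omega>\<bar> \<partial>M) \<longlonglongrightarrow> 0"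
proof -
  have "AE \<omega> in M. \<forall>\<^sub>F n in sequentially. B (\<tau> (real (Suc n)) \<omega>) \<omega> = B (stop \<omega>) \<omega>"
    using AE_stop_eventually_Suc by eventually_elim (auto elim: eventually_mono)
  note S = stopped_limit[OF \<tau>_optional[OF of_nat_0_le_iff] order_refl this measurable_B_at[OF stop_measurable]]
  show "integrable M (\<lambda>\<omega>. B (stop \<omega>) \<omega>)" "(\<integral>\<omega>. B (stop \<omega>) \<omega> \<partial>M) = x0"
    "(\<lambda>n. \<integral>\<omega>. \<bar>B (\<tau> (real (Suc n)) \<omega>) \<omega> - B (stop \<omega>) \<omega>\<bar> \<partial>M) \<longlonglongrightarrow> 0" by (rule S)+
qed

theorem law_stop: "distr M borel (\<lambda>\<omega>. B (stop \<omega>) \<omega>) = \<mu>"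
proof -
  let ?\<nu> = "distr M borel (\<lambda>\<omega>. B (stop \<omega>) \<omega>)"
  have \<nu>: "centred_law ?\<nu> x0"
    unfolding centred_law_def using B_stop_limit(1,2) by (auto intro!: prob_space_distr simp: integrable_distr_eq integral_distr)
  have pot\<nu>: "potential ?\<nu> x = (\<integral>\<omega>. \<bar>B (stop \<omega>) \<omega> - x\<bar> \<partial>M)" for x
    unfolding potential_def by (subst integral_distr) (auto simp: abs_minus_commute)
  have Suc_pos: "0 < real (Suc n)" "0 \<le> real (Suc n)" for n by auto
  note st = stopped[OF \<tau>_optional[OF Suc_pos(2)]]
  have lim: "(\<lambda>n. gap (law (real (Suc n))) x0 x) \<longlonglongrightarrow> gap ?\<nu> x0 x" for x
  proof -
    have "(\<lambda>n. (\<integral>\<omega>. \<bar>B (\<tau> (real (Suc n)) \<omega>) \<omega> - x\<bar> \<partial>M) - (\<integral>\<omega>. \<bar>B (stop \<omega>) \<omega> - x\<bar> \<partial>M)) \<longlonglongrightarrow> 0"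
    proof (rule Lim_null_comparison[OF always_eventually B_stop_limit(3)], intro allI)
      fix n
      have i: "integrable M (\<lambda>\<omega>. \<bar>B (\<tau> (real (Suc n)) \<omega>) \<omega> - x\<bar>)" "integrable M (\<lambda>\<omega>. \<bar>B (stop \<omega>) \<omega> - x\<bar>)"
        by (intro integrable_abs Bochner_Integration.integrable_diff st(1) B_stop_limit(1); simp)+
      have "norm ((\<integral>\<omega>. \<bar>B (\<tau> (real (Suc n)) \<omega>) \<omega> - x\<bar> \<partial>M) - (\<integral>\<omega>. \<bar>B (stop \<omega>) \<omega> - x\<bar> \<partial>M))
        = norm (\<integral>\<omega>. \<bar>B (\<tau> (real (Suc n)) \<omega>) \<omega> - x\<bar> - \<bar>B (stop \<omega>) \<omega> - x\<bar> \<partial>M)" using i by simp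
      also have "\<dots> \<le> (\<integral>\<omega>. \<bar>\<bar>B (\<tau> (real (Suc n)) \<omega>) \<omega> - x\<bar> - \<bar>B (stop \<omega>) \<omega> - x\<bar>\<bar> \<partial>M)"
        using integral_norm_bound[of M "\<lambda>\<omega>. \<bar>B (\<tau> (real (Suc n)) \<omega>) \<omega> - x\<bar> - \<bar>B (stop \<omega>) \<omega> - x\<bar>"] by simp
      also have "\<dots> \<le> (\<integral>\<omega>. \<bar>B (\<tau> (real (Suc n)) \<omega>) \<omega> - B (stop \<omega>) \<omega>\<bar> \<partial>M)"
      proof (rule integral_mono)
        show "integrable M (\<lambda>\<omega>. \<bar>\<bar>B (\<tau> (real (Suc n)) \<omega>) \<omega> - x\<bar> - \<bar>B (stop \<omega>) \<omega> - x\<bar>\<bar>)"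
          by (intro integrable_abs Bochner_Integration.integrable_diff i)
        show "integrable M (\<lambda>\<omega>. \<bar>B (\<tau> (real (Suc n)) \<omega>) \<omega> - B (stop \<omega>) \<omega>\<bar>)"
          by (intro integrable_abs Bochner_Integration.integrable_diff st(1) B_stop_limit(1))
      qed auto
      finally show "norm ((\<integral>\<omega>. \<bar>B (\<tau> (real (Suc n)) \<omega>) \<omega> - x\<bar> \<partial>M) - (\<integral>\<omega>. \<bar>B (stop \<omega>) \<omega> - x\<bar> \<partial>M))
        \<le> (\<integral>\<omega>. \<bar>B (\<tau> (real (Suc n)) \<omega>) \<omega> - B (stop \<omega>) \<omega>\<bar> \<partial>M)" .
    qed
    then have "(\<lambda>n. (\<integral>\<omega>. \<bar>B (\<tau> (real (Suc n)) \<omega>) \<omega> - x\<bar> \<partial>M) - \<bar>x - x0\<bar>) \<longlonglongrightarrow> gap ?\<nu> x0 x"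
      unfolding gap_def pot\<nu> by (intro tendsto_diff tendsto_const) (simp add: LIM_zero_iff)
    then show ?thesis using st(4)[of _ x] by (simp add: gap_law abs_minus_commute)
  qed
  have le_w: "gap ?\<nu> x0 x \<le> w x" for x
    by (rule LIMSEQ_le_const2[OF lim]) (use gap_law_le in auto)
  have law_le: "gap (law (real (Suc n))) x0 x \<le> gap ?\<nu> x0 x" for n x
  proof (rule incseq_le[OF _ lim])
    show "incseq (\<lambda>n. gap (law (real (Suc n))) x0 x)"
    proof (rule incseq_SucI)
      fix n
      have "(\<integral>\<omega>. L x (\<tau> (real (Suc n)) \<omega>) \<omega> \<partial>M) \<le> (\<integral>\<omega>. L x (\<tau> (real (Suc (Suc n))) \<omega>) \<omega> \<partial>M)"
      proof (intro integral_mono st(3) L_mono)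
        fix \<omega>
        show "\<tau> (real (Suc n)) \<omega> \<le> \<tau> (real (Suc (Suc n))) \<omega>"
          unfolding \<tau>_def debut_def
          by (rule cInf_mono) (auto intro!: bdd_belowI[of _ 0] simp: not_le[symmetric] intro: cInf_lower)
      qed
      then show "gap (law (real (Suc n))) x0 x \<le> gap (law (real (Suc (Suc n)))) x0 x" by (simp add: gap_law)
    qed
  qed
  \<comment> \<open>The maximum principle with exchanged roles. As \<open>rung\<close> tends to 1,
    \<open>tent_identity\<close> passes to the limit: the tent integral of the limit law is at most
    the one formed with the rate and its gap, hence by \<open>le_w\<close> at most that of
    \<open>\<mu>\<close>.\<close>
  have ge_w: "w x \<le> gap ?\<nu> x0 x" for x
  proof (rule gap_comparison[OF centred \<nu> open_support_interior])
    fix x assume "x \<notin> I"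
    moreover have "AE x in \<mu>. x \<in> I \<union> ends"
      using AE_supp_bounds[OF sets_\<mu>] by eventually_elim (auto simp: support_interior_def support_ends_def le_less)
    ultimately have "w x = 0" by (intro gap_eq_0_confined[OF centred])
    then show "w x \<le> gap ?\<nu> x0 x" using gap_nonneg[OF \<nu>] by simp
  next
    fix z h :: real assume h: "0 < h" and zh: "{z - h..z + h} \<subseteq> I"
    have h0: "0 \<le> h" using h by simp
    have "(\<lambda>n. \<integral>\<omega>. tent z h (B (\<tau> (real (Suc n)) \<omega>) \<omega>) * rung (real (Suc n)) \<omega> \<partial>M) \<longlonglongrightarrow> (\<integral>\<omega>. tent z h (B (stop \<omega>) \<omega>) \<partial>M)"
    proof (rule integral_dominated_convergence[where w="\<lambda>\<omega>. h"])
      show "AE \<omega> in M. (\<lambda>n. tent z h (B (\<tau> (real (Suc n)) \<omega>) \<omega>) * rung (real (Suc n)) \<omega>) \<longlonglongrightarrow> tent z h (B (stop \<omega>) \<omega>)"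
        using AE_stop_eventually_Suc AE_stop
      proof eventually_elim
        case (elim \<omega>)
        have "\<forall>\<^sub>F n in sequentially. ennreal (T \<omega>) < clock (real (Suc n)) \<omega>"
          using elim(2) eventually_sequentially_Suc[of "\<lambda>n. ennreal (T \<omega>) < clock (real n) \<omega>"] by blast
        with elim(1) have "\<forall>\<^sub>F n in sequentially. tent z h (B (\<tau> (real (Suc n)) \<omega>) \<omega>) * rung (real (Suc n)) \<omega> = tent z h (B (stop \<omega>) \<omega>)"
          by eventually_elim (simp add: rung_def)
        then show ?case by (rule tendsto_eventually)
      qed
      show "AE \<omega> in M. norm (tent z h (B (\<tau> (real (Suc n)) \<omega>) \<omega>) * rung (real (Suc n)) \<omega>) \<le> h" for n
        using mult_mono[OF tent_le[OF h0] rung_bounds(2) h0 rung_bounds(1)] tent_nonneg rung_bounds(1)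
        by (intro AE_I2) (simp add: abs_mult)
      show "(\<lambda>\<omega>. tent z h (B (\<tau> (real (Suc n)) \<omega>) \<omega>) * rung (real (Suc n)) \<omega>) \<in> borel_measurable M" for n
        using st(1)[of n] by measurable
    qed auto
    then have "(\<integral>\<omega>. tent z h (B (stop \<omega>) \<omega>) \<partial>M) \<le> (\<integral>x. tent z h x * (rrate x * gap ?\<nu> x0 x) \<partial>\<mu>)"
    proof (rule LIMSEQ_le_const2, intro exI allI impI)
      fix n :: nat
      have "(\<integral>\<omega>. tent z h (B (\<tau> (real (Suc n)) \<omega>) \<omega>) * rung (real (Suc n)) \<omega> \<partial>M)
          = (\<integral>x. tent z h x * (rrate x * gap (law (real (Suc n))) x0 x) \<partial>\<mu>)" by (rule tent_identity[OF Suc_pos(1) h0 zh])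
      also have "\<dots> \<le> (\<integral>x. tent z h x * (rrate x * gap ?\<nu> x0 x) \<partial>\<mu>)"
        by (intro tent_rrate_mono zh continuous_on_gap[OF law_centred[OF Suc_pos(2)]] continuous_on_gap[OF \<nu>] law_le)
      finally show "(\<integral>\<omega>. tent z h (B (\<tau> (real (Suc n)) \<omega>) \<omega>) * rung (real (Suc n)) \<omega> \<partial>M) \<le> \<dots>" .
    qed
    also have "\<dots> \<le> (\<integral>x. tent z h x * (rrate x * w x) \<partial>\<mu>)"
      by (intro tent_rrate_mono zh continuous_on_gap[OF \<nu>] w_continuous le_w)
    also have "\<dots> = (\<integral>x. tent z h x \<partial>\<mu>)" by (rule tent_rrate_gap[OF zh])
    finally show "(\<integral>x. tent z h x \<partial>?\<nu>) \<le> (\<integral>x. tent z h x \<partial>\<mu>)" by (subst integral_distr) auto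
  qed
  show ?thesis
    by (rule gap_determines_law[OF \<nu> centred]) (rule antisym[OF le_w ge_w])
qed

end

text \<open>\<open>enn2real\<close> maps \<open>\<top>\<close> to 0, so this value has to be treated
  apart before the minimum is moved out.\<close>

lemma enn2real_min_finite:
  "0 \<le> n \<Longrightarrow> enn2real (min r (ennreal n)) = (if r = \<top> then n else min (enn2real r) n)"
  by (cases r) (auto simp: min_def ennreal_le_iff top_unique)

lemma min_enn2real:
  assumes "0 \<le> s" "s \<le> n"
  shows "min (enn2real (min r (ennreal n))) s = enn2real (min r (ennreal s))"
  using assms by (cases "r = \<top>") (simp_all add: enn2real_min_finite min.assoc min_absorb2)

section \<open>Stopping times up to null sets\<close>

context usual_conditions
begin

lemma F_null: "N \<in> null_sets M \<Longrightarrow> N \<in> sets (F t)"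
  using null_sets_F0 F_sets_mono[of 0 t N] by auto

lemma F_AE_eq:
  assumes C: "C \<in> sets (F t)" and D: "D \<subseteq> space M" and ae: "AE \<omega> in M. \<omega> \<in> C \<longleftrightarrow> \<omega> \<in> D"
  shows "D \<in> sets (F t)"
proof -
  let ?N = "{\<omega>\<in>space M. \<not> (\<omega> \<in> C \<longleftrightarrow> \<omega> \<in> D)}"
  have N: "?N \<in> null_sets M" using ae by (simp add: AE_iff_null_sets)
  have "D \<inter> ?N \<in> null_sets M" by (rule complete2[OF _ N]) auto
  then have "(C - ?N) \<union> (D \<inter> ?N) \<in> sets (F t)" using C F_null[OF N] F_null by blast
  also have "(C - ?N) \<union> (D \<inter> ?N) = D" using sets.sets_into_space[OF C] D by (auto simp: space_F)
  finally show ?thesis .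
qed

text \<open>All null sets belong to every \<open>F t\<close>, so a stopping time may be changed on a
  null set. This allows the passage between the time change of the given local time and that of its
  regular version.\<close>

lemma stopping_time_AE_eq:
  assumes \<rho>: "stopping_time F \<rho>" and ae: "AE \<omega> in M. \<rho>' \<omega> = \<rho> \<omega>"
  shows "stopping_time F \<rho>'" "sets (pre_sigma \<rho>') = sets (pre_sigma \<rho>)"
proof -
  show \<rho>': "stopping_time F \<rho>'"
    unfolding stopping_time_def pred_def space_F
  proof
    fix t
    have "{\<omega> \<in> space M. \<rho> \<omega> \<le> t} \<in> sets (F t)" using stopping_timeD[OF \<rho>, of t] by (simp add: pred_def space_F)
    then show "{\<omega> \<in> space M. \<rho>' \<omega> \<le> t} \<in> sets (F t)"
      by (rule F_AE_eq) (use ae in \<open>auto elim: eventually_mono\<close>)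
  qed
  have "A \<in> sets (pre_sigma \<sigma>)" if "stopping_time F \<sigma>" "stopping_time F \<sigma>'" "AE \<omega> in M. \<sigma>' \<omega> = \<sigma> \<omega>" "A \<in> sets (pre_sigma \<sigma>')" for \<sigma> \<sigma>' A
  proof (rule sets_pre_sigmaI[OF that(1)])
    fix t
    have "A \<subseteq> space M" using sets.sets_into_space[OF that(4)] by (simp add: space_pre_sigma)
    then show "{\<omega> \<in> A. \<sigma> \<omega> \<le> t} \<in> sets (F t)"
      by (intro F_AE_eq[OF sets_pre_sigmaD[OF that(2,4)]]) (use that(3) in \<open>auto elim: eventually_mono\<close>)
  qed
  note * = this
  have ae': "AE \<omega> in M. \<rho> \<omega> = \<rho>' \<omega>" using ae by eventually_elim simp
  show "sets (pre_sigma \<rho>') = sets (pre_sigma \<rho>)"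
    using *[OF \<rho> \<rho>' ae] *[OF \<rho>' \<rho> ae'] by blast
qed

lemma pre_sigma_sets_M:
  assumes "stopping_time F \<rho>" "A \<in> sets (pre_sigma \<rho>)" shows "A \<in> sets M"
proof -
  have "{\<omega> \<in> A. \<rho> \<omega> \<le> \<infinity>} \<in> sets (F \<infinity>)" by (rule sets_pre_sigmaD[OF assms])
  then show ?thesis by (intro F_sets_M[of A \<infinity>]) simp
qed

lemma stopping_time_measurable_M: "stopping_time F \<rho> \<Longrightarrow> \<rho> \<in> borel_measurable M"
  by (rule measurable_stopping_time[of F _ M]) (use F_sets_M in \<open>auto simp: space_F\<close>)

end

section \<open>Sampling the stopped process at stopping times\<close>

context embedding
begin

text \<open>The minimum is formed in \<open>ennreal\<close>, before the conversion to
  \<open>real\<close>, so that \<open>\<rho> = \<infinity>\<close> gives the value at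
  \<open>stop\<close> and not at time 0.\<close>

definition upto_stop :: "('a \<Rightarrow> ennreal) \<Rightarrow> 'a \<Rightarrow> real" where
  "upto_stop \<rho> \<omega> = B (enn2real (min (\<rho> \<omega>) (ennreal (stop \<omega>)))) \<omega>"

lemma upto_stop_measurable: "stopping_time F \<rho> \<Longrightarrow> upto_stop \<rho> \<in> borel_measurable M"
proof -
  assume "stopping_time F \<rho>"
  then have [measurable]: "\<rho> \<in> borel_measurable M" by (rule stopping_time_measurable_M)
  show ?thesis unfolding upto_stop_def by measurable
qed

text \<open>Stopping at \<open>\<rho>\<close> on \<open>A\<close> and at \<open>stop\<close> off \<open>A\<close> reduces conditioning on \<open>pre_sigma \<rho>\<close> to
  optional stopping in expectation.\<close>

lemma upto_stop_set:
  assumes \<rho>: "stopping_time F \<rho>" and A: "A \<in> sets (pre_sigma \<rho>)"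
  shows "integrable M (\<lambda>\<omega>. if \<omega> \<in> A then upto_stop \<rho> \<omega> else B (stop \<omega>) \<omega>)"
    "(\<integral>\<omega>. (if \<omega> \<in> A then upto_stop \<rho> \<omega> else B (stop \<omega>) \<omega>) \<partial>M) = x0"
    "0 \<le> K \<Longrightarrow> (\<integral>\<omega>. excess K (if \<omega> \<in> A then upto_stop \<rho> \<omega> else B (stop \<omega>) \<omega>) \<partial>M) \<le> (\<integral>x. excess K x \<partial>\<mu>)"
proof -
  have A_M[measurable]: "A \<in> sets M" by (rule pre_sigma_sets_M[OF \<rho> A])
  have A_sp: "A \<subseteq> space M" using sets.sets_into_space[OF A_M] .
  note [measurable] = upto_stop_measurable[OF \<rho>]
  \<comment> \<open>Bounded optional times below \<open>\<tau> (Suc n)\<close>, as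
    \<open>stopped_limit\<close> demands. Once \<open>stop \<le> Suc n\<close>, the cap of
    \<open>\<rho>\<close> at \<open>Suc n\<close> no longer affects the minimum.\<close>
  define \<sigma> where "\<sigma> n \<omega> = (if \<omega> \<in> A then min (enn2real (min (\<rho> \<omega>) (ennreal (real (Suc n))))) (\<tau> (real (Suc n)) \<omega>) else \<tau> (real (Suc n)) \<omega>)" for n \<omega>
  have opt: "optional_time M F (real (Suc n)) (\<sigma> n)" for n
    unfolding optional_time_def
  proof (intro conjI ballI allI impI)
    fix \<omega> assume "\<omega> \<in> space M"
    show "0 \<le> \<sigma> n \<omega>" "\<sigma> n \<omega> \<le> real (Suc n)"
      using \<tau>_nonneg[of "real (Suc n)" \<omega>] \<tau>_le[of "real (Suc n)" \<omega>] by (auto simp: \<sigma>_def min_le_iff_disj)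
  next
    fix t :: real assume t: "0 < t"
    show "{\<omega> \<in> space M. \<sigma> n \<omega> < t} \<in> sets (F (ennreal t))"
    proof (cases "real (Suc n) < t")
      case True
      have "\<sigma> n \<omega> < t" for \<omega> using \<tau>_le[of "real (Suc n)" \<omega>] True by (auto simp: \<sigma>_def min_less_iff_disj)
      then show ?thesis using sets.top[of "F (ennreal t)"] by (simp add: space_F)
    next
      case False
      have less: "enn2real (min r (ennreal (real (Suc n)))) < t \<longleftrightarrow> r < ennreal t \<or> real (Suc n) < t" for r
        using t by (cases r) (auto simp: enn2real_min_finite ennreal_less_iff min_less_iff_disj simp del: of_nat_Suc)
      \<comment> \<open>Membership of \<open>A\<close> in \<open>pre_sigma \<rho>\<close> concerns
        the events \<open>\<rho> \<le> q\<close>, hence \<open>\<rho> < t\<close> is resolved into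
        rational \<open>q < t\<close>.\<close>
      have eq: "{\<omega> \<in> space M. \<sigma> n \<omega> < t} = {\<omega> \<in> space M. \<tau> (real (Suc n)) \<omega> < t} \<union> (\<Union>q\<in>{q\<in>\<rat>. 0 \<le> q \<and> q < t}. {\<omega>\<in>A. \<rho> \<omega> \<le> ennreal q})"
      proof -
        have "\<rho> \<omega> < ennreal t \<longleftrightarrow> (\<exists>q\<in>{q\<in>\<rat>. 0 \<le> q \<and> q < t}. \<rho> \<omega> \<le> ennreal q)" for \<omega>
        proof
          assume lt: "\<rho> \<omega> < ennreal t"
          then obtain r where r: "\<rho> \<omega> = ennreal r" "0 \<le> r" "r < t" by (cases "\<rho> \<omega>") (auto simp: ennreal_less_iff)
          obtain q where "q \<in> \<rat>" "r < q" "q < t" using Rats_dense_in_real[OF r(3)] by auto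
          then show "\<exists>q\<in>{q\<in>\<rat>. 0 \<le> q \<and> q < t}. \<rho> \<omega> \<le> ennreal q"
            using r by (intro bexI[of _ q]) (auto intro: ennreal_leI)
        next
          assume "\<exists>q\<in>{q\<in>\<rat>. 0 \<le> q \<and> q < t}. \<rho> \<omega> \<le> ennreal q"
          then obtain q where q: "0 \<le> q" "q < t" "\<rho> \<omega> \<le> ennreal q" by auto
          have "ennreal q < ennreal t" using q by (simp add: ennreal_less_iff)
          with q(3) show "\<rho> \<omega> < ennreal t" by (rule le_less_trans)
        qed
        then show ?thesis using A_sp False unfolding \<sigma>_def by (auto simp: min_less_iff_disj less simp del: of_nat_Suc)
      qed
      have "(\<Union>q\<in>{q\<in>\<rat>. 0 \<le> q \<and> q < t}. {\<omega>\<in>A. \<rho> \<omega> \<le> ennreal q}) \<in> sets (F (ennreal t))"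
      proof (rule sets.countable_UN'')
        show "countable {q\<in>\<rat>. 0 \<le> q \<and> q < t}" by (rule countable_subset[OF _ countable_rat]) auto
        fix q assume "q \<in> {q\<in>\<rat>. 0 \<le> q \<and> q < t}"
        then show "{\<omega>\<in>A. \<rho> \<omega> \<le> ennreal q} \<in> sets (F (ennreal t))"
          by (intro F_sets_mono[OF _ sets_pre_sigmaD[OF \<rho> A]]) (auto intro!: ennreal_leI)
      qed
      then show ?thesis unfolding eq using optional_timeD(3)[OF \<tau>_optional, of "real (Suc n)" t] by auto
    qed
  qed
  have le: "\<sigma> n \<omega> \<le> \<tau> (real (Suc n)) \<omega>" for n \<omega> by (simp add: \<sigma>_def)
  let ?Y = "\<lambda>\<omega>. if \<omega> \<in> A then upto_stop \<rho> \<omega> else B (stop \<omega>) \<omega>"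
  have lim: "AE \<omega> in M. \<forall>\<^sub>F n in sequentially. B (\<sigma> n \<omega>) \<omega> = ?Y \<omega>"
    using AE_stop_eventually_Suc AE_stop
  proof eventually_elim
    case (elim \<omega>)
    from elim(1) show ?case
    proof eventually_elim
      case (elim n)
      have "0 \<le> stop \<omega>" "stop \<omega> \<le> real (Suc n)"
        using elim \<tau>_nonneg[of "real (Suc n)" \<omega>] \<tau>_le[of "real (Suc n)" \<omega>] by auto
      then show ?case using elim by (simp add: \<sigma>_def upto_stop_def min_enn2real del: of_nat_Suc)
    qed
  qed
  have Y: "?Y \<in> borel_measurable M" by measurable
  note S = stopped_limit[OF opt le lim Y]
  show "integrable M ?Y" by (rule S(1))
  show "(\<integral>\<omega>. ?Y \<omega> \<partial>M) = x0" by (rule S(2))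
  show "0 \<le> K \<Longrightarrow> (\<integral>\<omega>. excess K (?Y \<omega>) \<partial>M) \<le> (\<integral>x. excess K x \<partial>\<mu>)" by (rule S(4))
qed

text \<open>For \<open>A\<close> the whole space, \<open>upto_stop_set\<close> gives integrability
  and the excess bound. For general \<open>A\<close>, its variable and \<open>B stop\<close> both
  have mean \<open>x0\<close> and differ only on \<open>A\<close>, so their integrals over
  \<open>A\<close> agree: \<open>upto_stop \<rho>\<close> acts as the conditional expectation of
  \<open>B stop\<close> given \<open>pre_sigma \<rho>\<close>.\<close>

lemma upto_stop:
  assumes \<rho>: "stopping_time F \<rho>"
  shows "integrable M (upto_stop \<rho>)"
    "A \<in> sets (pre_sigma \<rho>) \<Longrightarrow> (\<integral>\<omega>. upto_stop \<rho> \<omega> * indicator A \<omega> \<partial>M) = (\<integral>\<omega>. B (stop \<omega>) \<omega> * indicator A \<omega> \<partial>M)"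
    "0 \<le> K \<Longrightarrow> (\<integral>\<omega>. excess K (upto_stop \<rho> \<omega>) \<partial>M) \<le> (\<integral>x. excess K x \<partial>\<mu>)"
proof -
  have sp: "space M \<in> sets (pre_sigma \<rho>)" using sets.top[of "pre_sigma \<rho>"] by (simp add: space_pre_sigma)
  note S = upto_stop_set[OF \<rho> sp]
  show i: "integrable M (upto_stop \<rho>)"
    using S(1) by (rule Bochner_Integration.integrable_cong[THEN iffD1, rotated 2]) auto
  show "0 \<le> K \<Longrightarrow> (\<integral>\<omega>. excess K (upto_stop \<rho> \<omega>) \<partial>M) \<le> (\<integral>x. excess K x \<partial>\<mu>)"
    using S(3)[of K] by (simp cong: Bochner_Integration.integral_cong)
  assume A: "A \<in> sets (pre_sigma \<rho>)"
  have A_M: "A \<in> sets M" by (rule pre_sigma_sets_M[OF \<rho> A])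
  note i1 = integrable_real_mult_indicator[OF A_M i]
  note i2 = integrable_real_mult_indicator[OF A_M B_stop_limit(1)]
  have "x0 = (\<integral>\<omega>. (if \<omega> \<in> A then upto_stop \<rho> \<omega> else B (stop \<omega>) \<omega>) \<partial>M)" by (rule upto_stop_set(2)[OF \<rho> A, symmetric])
  also have "\<dots> = (\<integral>\<omega>. upto_stop \<rho> \<omega> * indicator A \<omega> + (B (stop \<omega>) \<omega> - B (stop \<omega>) \<omega> * indicator A \<omega>) \<partial>M)"
    by (intro Bochner_Integration.integral_cong) (auto simp: indicator_def)
  also have "\<dots> = (\<integral>\<omega>. upto_stop \<rho> \<omega> * indicator A \<omega> \<partial>M) + (x0 - (\<integral>\<omega>. B (stop \<omega>) \<omega> * indicator A \<omega> \<partial>M))"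
    using i1 i2 B_stop_limit(1) by (simp add: B_stop_limit(2))
  finally show "(\<integral>\<omega>. upto_stop \<rho> \<omega> * indicator A \<omega> \<partial>M) = (\<integral>\<omega>. B (stop \<omega>) \<omega> * indicator A \<omega> \<partial>M)" by simp
qed

section \<open>The time change and the absorbed diffusion\<close>

definition change :: "real \<Rightarrow> 'a \<Rightarrow> ennreal" where
  "change u \<omega> = Inf {ennreal s | s. 0 \<le> s \<and> ennreal u < clock s \<omega>}"

lemma change_less_iff: "change u \<omega> < t \<longleftrightarrow> (\<exists>s\<ge>0. ennreal s < t \<and> ennreal u < clock s \<omega>)"
  unfolding change_def Inf_less_iff by auto

lemma change_le_at: "0 \<le> s \<Longrightarrow> ennreal u < clock s \<omega> \<Longrightarrow> change u \<omega> \<le> ennreal s"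
  unfolding change_def by (intro Inf_lower) auto

lemma change_mono: "u \<le> v \<Longrightarrow> change u \<omega> \<le> change v \<omega>"
  unfolding change_def by (rule Inf_superset_mono) (auto intro: le_less_trans[OF ennreal_leI])

text \<open>The event \<open>change u < r\<close> is a union over rational times, hence in
  \<open>F r\<close>. The event \<open>change u \<le> t\<close> is an intersection of such events
  over rationals just above \<open>t\<close>; so it lies in \<open>F s\<close> for every
  \<open>s > t\<close>, and right-continuity of the filtration gives \<open>F t\<close>.\<close>

lemma change_stopping_time: "stopping_time F (change u)"
  unfolding stopping_time_def pred_def space_F
proof
  fix t :: ennreal
  have less: "{\<omega> \<in> space M. change u \<omega> < ennreal r} \<in> sets (F (ennreal r))" for r
  proof -
    have eq: "{\<omega> \<in> space M. change u \<omega> < ennreal r} = (\<Union>q\<in>{q\<in>\<rat>. 0 \<le> q \<and> q < r}. {\<omega>\<in>space M. ennreal u < clock q \<omega>})"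
    proof (intro set_eqI iffI)
      fix \<omega> assume w: "\<omega> \<in> {\<omega> \<in> space M. change u \<omega> < ennreal r}"
      then obtain s where s: "0 \<le> s" "ennreal s < ennreal r" "ennreal u < clock s \<omega>" by (auto simp: change_less_iff)
      then have "s < r" by (simp add: ennreal_less_iff)
      then obtain q where q: "q \<in> \<rat>" "s < q" "q < r" using Rats_dense_in_real by blast
      have "ennreal u < clock q \<omega>" using s(3) clock_mono[of \<omega> s q] w q by (auto intro: less_le_trans)
      then show "\<omega> \<in> (\<Union>q\<in>{q\<in>\<rat>. 0 \<le> q \<and> q < r}. {\<omega>\<in>space M. ennreal u < clock q \<omega>})" using q s(1) w by auto
    next
      fix \<omega> assume "\<omega> \<in> (\<Union>q\<in>{q\<in>\<rat>. 0 \<le> q \<and> q < r}. {\<omega>\<in>space M. ennreal u < clock q \<omega>})"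
      then show "\<omega> \<in> {\<omega> \<in> space M. change u \<omega> < ennreal r}" by (auto simp: change_less_iff ennreal_less_iff)
    qed
    show ?thesis unfolding eq
    proof (rule sets.countable_UN'')
      show "countable {q\<in>\<rat>. 0 \<le> q \<and> q < r}" by (rule countable_subset[OF _ countable_rat]) auto
      fix q assume "q \<in> {q\<in>\<rat>. 0 \<le> q \<and> q < r}"
      then have q: "0 \<le> q" "q \<le> r" by auto
      note [measurable] = clock_adapted[OF q(1)]
      have "{\<omega>\<in>space (F (ennreal q)). ennreal u < clock q \<omega>} \<in> sets (F (ennreal q))" by measurable
      then show "{\<omega>\<in>space M. ennreal u < clock q \<omega>} \<in> sets (F (ennreal r))"
        using q by (intro F_sets_mono[OF ennreal_leI[OF q(2)]]) (simp add: space_F)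
    qed
  qed
  show "{\<omega> \<in> space M. change u \<omega> \<le> t} \<in> sets (F t)"
  proof (cases "t = \<infinity>")
    case True then show ?thesis using sets.top[of "F t"] by (simp add: space_F)
  next
    case False
    then obtain r where r: "t = ennreal r" "0 \<le> r" by (cases t) auto
    have "{\<omega> \<in> space M. change u \<omega> \<le> t} \<in> sets (F s)" if s: "t < s" for s
    proof -
      obtain s' where s': "r < s'" "ennreal s' \<le> s"
      proof (cases s)
        case (real x) then show ?thesis using s r that[of x] by (auto simp: ennreal_less_iff)
      next
        case top then show ?thesis using that[of "r + 1"] by auto
      qed
      let ?Q = "{q\<in>\<rat>. r < q \<and> q < s'}"
      have ne: "?Q \<noteq> {}" using Rats_dense_in_real[OF s'(1)] by auto
      have eq: "{\<omega> \<in> space M. change u \<omega> \<le> t} = (\<Inter>q\<in>?Q. {\<omega> \<in> space M. change u \<omega> < ennreal q})"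
      proof (intro set_eqI iffI)
        fix \<omega> assume "\<omega> \<in> {\<omega> \<in> space M. change u \<omega> \<le> t}"
        then show "\<omega> \<in> (\<Inter>q\<in>?Q. {\<omega> \<in> space M. change u \<omega> < ennreal q})"
          using r by (auto intro: le_less_trans simp: ennreal_less_iff)
      next
        fix \<omega> assume w: "\<omega> \<in> (\<Inter>q\<in>?Q. {\<omega> \<in> space M. change u \<omega> < ennreal q})"
        have "change u \<omega> \<le> t"
        proof (rule ccontr)
          assume "\<not> change u \<omega> \<le> t"
          then have gt: "ennreal r < change u \<omega>" using r by simp
          obtain q0 where q0: "q0 \<in> ?Q" using ne by auto
          have "change u \<omega> < ennreal q0" using w q0 by auto
          then obtain y where y: "change u \<omega> = ennreal y" "0 \<le> y" "y < q0" by (cases "change u \<omega>") (auto simp: ennreal_less_iff)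
          then have "r < y" using gt r by (simp add: ennreal_less_iff)
          then obtain q where q: "q \<in> \<rat>" "r < q" "q < y" using Rats_dense_in_real by blast
          then have "q \<in> ?Q" using y(3) q0 by auto
          then have "change u \<omega> < ennreal q" using w by auto
          then show False using y q by (simp add: ennreal_less_iff)
        qed
        then show "\<omega> \<in> {\<omega> \<in> space M. change u \<omega> \<le> t}" using w ne by auto
      qed
      show ?thesis unfolding eq
      proof (rule sets.countable_INT'[OF _ ne])
        show "countable ?Q" by (rule countable_subset[OF _ countable_rat]) auto
        have "{\<omega> \<in> space M. change u \<omega> < ennreal q} \<in> sets (F s)" if "q \<in> ?Q" for q
        proof -
          have "ennreal q \<le> ennreal s'" using that by (intro ennreal_leI) simp
          also have "\<dots> \<le> s" by (rule s'(2))
          finally show ?thesis by (rule F_sets_mono[OF _ less])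
        qed
        then show "(\<lambda>q. {\<omega> \<in> space M. change u \<omega> < ennreal q}) ` ?Q \<subseteq> sets (F s)" by blast
      qed
    qed
    then show ?thesis using right_continuous[of t] False by (auto simp: less_top)
  qed
qed

definition good :: "'a \<Rightarrow> bool" where
  "good \<omega> \<longleftrightarrow> \<omega> \<in> space M \<and> confined \<omega> \<and> 0 \<le> stop \<omega> \<and> (\<forall>n\<ge>0. \<tau> n \<omega> = min n (stop \<omega>))"

lemma AE_good: "AE \<omega> in M. good \<omega>"
  using AE_confined AE_stop AE_space by eventually_elim (simp add: good_def)

lemma change_at_T:
  assumes "good \<omega>" shows "change (T \<omega>) \<omega> = ennreal (stop \<omega>)"
proof (rule antisym)
  have \<omega>: "\<omega> \<in> space M" "0 \<le> stop \<omega>" "\<And>n. 0 \<le> n \<Longrightarrow> \<tau> n \<omega> = min n (stop \<omega>)" using assms by (auto simp: good_def)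
  show "ennreal (stop \<omega>) \<le> change (T \<omega>) \<omega>"
    unfolding change_def
  proof (rule Inf_greatest, safe)
    fix s assume s: "0 \<le> s" "ennreal (T \<omega>) < clock s \<omega>"
    \<comment> \<open>The horizon \<open>s + 1\<close> is beyond \<open>s\<close>, so
      \<open>min (s + 1) (stop \<omega>) \<le> s\<close> forces
      \<open>stop \<omega> \<le> s\<close>.\<close>
    have "\<tau> (s + 1) \<omega> \<le> s" unfolding \<tau>_def using s by (intro debut_le_at) auto
    then have "stop \<omega> \<le> s" using \<omega>(3)[of "s + 1"] s(1) by auto
    then show "ennreal (stop \<omega>) \<le> ennreal s" by (rule ennreal_leI)
  qed
  show "change (T \<omega>) \<omega> \<le> ennreal (stop \<omega>)"
  proof (rule dense_ge)
    fix y assume y: "ennreal (stop \<omega>) < y"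
    show "change (T \<omega>) \<omega> \<le> y"
    proof (cases y)
      case (real t)
      then have t: "stop \<omega> < t" "0 \<le> t" using y \<omega>(2) by (auto simp: ennreal_less_iff)
      have "\<tau> t \<omega> < t" using \<omega>(3)[OF t(2)] t(1) by simp
      then have "ennreal (T \<omega>) < clock t \<omega>" by (intro clock_after_\<tau>[OF \<omega>(1)]) auto
      then show ?thesis using change_le_at[OF t(2)] real by simp
    qed simp
  qed
qed

lemma change_min: "change (min u v) \<omega> = min (change u \<omega>) (change v \<omega>)"
  using change_mono[of u v \<omega>] change_mono[of v u \<omega>] by (auto simp: min_def)

lemma clock_before_change: "ennreal q < change v \<omega> \<Longrightarrow> 0 \<le> q \<Longrightarrow> clock q \<omega> \<le> ennreal v"
  using change_le_at[of q v \<omega>] by (meson leD not_le_imp_less)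

text \<open>Once the time-changed path has left the interior of the support it stays put until \<open>stop\<close>, so
  the absorption in the definition of the diffusion changes nothing before \<open>T\<close>.\<close>

lemma absorbed_path:
  assumes good: "good \<omega>" and v: "0 \<le> v" "v \<le> T \<omega>"
  defines "Z \<equiv> \<lambda>t. B (enn2real (change t \<omega>)) \<omega>"
  shows "Z (enn2real (min (ennreal v) (Inf {ennreal t | t. 0 \<le> t \<and> Z t \<notin> I}))) = Z v"
proof -
  have \<omega>: "\<omega> \<in> space M" "confined \<omega>" using good by (auto simp: good_def)
  let ?E = "{ennreal t | t. 0 \<le> t \<and> Z t \<notin> I}"
  have fin: "change t \<omega> < \<infinity>" if "t \<le> v" for t
  proof -
    have "change t \<omega> \<le> change (T \<omega>) \<omega>" using that v by (intro change_mono) simp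
    also have "\<dots> < \<infinity>" by (simp add: change_at_T[OF good])
    finally show ?thesis .
  qed
  show ?thesis
  proof (cases "ennreal v \<le> Inf ?E")
    case True then show ?thesis using v by (simp add: min_absorb1)
  next
    case False
    then obtain \<zeta> where \<zeta>: "Inf ?E = ennreal \<zeta>" "0 \<le> \<zeta>" "\<zeta> < v"
      by (cases "Inf ?E") (auto simp: ennreal_le_iff not_le ennreal_less_iff)
    define a where "a t = enn2real (change t \<omega>)" for t
    have a: "change t \<omega> = ennreal (a t)" "0 \<le> a t" if "t \<le> v" for t using fin[OF that] by (auto simp: a_def)
    \<comment> \<open>The exit time is only an infimum, but the path is outside \<open>I\<close> at
      this time too. If \<open>B\<close> were in \<open>I\<close> at \<open>a \<zeta>\<close>, it
      would remain there up to some \<open>s\<close> with \<open>clock s\<close> above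
      \<open>\<zeta>\<close>; there are \<open>t\<close> below \<open>clock s\<close> with
      \<open>Z t\<close> outside \<open>I\<close>, and their \<open>a t\<close> lie between
      \<open>a \<zeta>\<close> and \<open>s\<close>.\<close>
    have out: "B (a \<zeta>) \<omega> \<notin> I"
    proof
      assume inI: "B (a \<zeta>) \<omega> \<in> I"
      have "open ((\<lambda>t. B t \<omega>) -` I)"
        using B_continuous[OF \<omega>(1)] open_support_interior by (rule open_vimage[rotated])
      from this[unfolded open_dist, THEN bspec, of "a \<zeta>"] inI
      obtain d where d: "0 < d" "\<And>r. dist r (a \<zeta>) < d \<Longrightarrow> B r \<omega> \<in> I" by auto
      have "change \<zeta> \<omega> < ennreal (a \<zeta> + d)" using a[of \<zeta>] \<zeta> d by (simp add: ennreal_less_iff)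
      then obtain s where s: "0 \<le> s" "ennreal s < ennreal (a \<zeta> + d)" "ennreal \<zeta> < clock s \<omega>"
        by (auto simp: change_less_iff)
      have "Inf ?E < min (clock s \<omega>) (ennreal v)" using s(3) \<zeta> by (simp add: ennreal_less_iff)
      then obtain t where t: "0 \<le> t" "Z t \<notin> I" "ennreal t < clock s \<omega>" "ennreal t < ennreal v"
        unfolding Inf_less_iff by auto
      have tv: "t \<le> v" using t by (simp add: ennreal_less_iff)
      have "Inf ?E \<le> ennreal t" using t by (intro Inf_lower) auto
      then have "\<zeta> \<le> t" using \<zeta> t(1) by (simp add: ennreal_le_iff)
      then have "ennreal (a \<zeta>) \<le> ennreal (a t)" using change_mono[of \<zeta> t \<omega>] a[of \<zeta>] a[OF tv] \<zeta> by simp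
      then have "a \<zeta> \<le> a t" using a[OF tv] by (simp add: ennreal_le_iff)
      moreover have "ennreal (a t) \<le> ennreal s" using change_le_at[OF s(1) t(3)] a[OF tv] by simp
      then have "a t \<le> s" using s(1) by (simp add: ennreal_le_iff)
      moreover have "s < a \<zeta> + d" using s(1,2) by (simp add: ennreal_less_iff)
      ultimately have "B (a t) \<omega> \<in> I" by (intro d(2)) (auto simp: dist_real_def)
      then show False using t(2) by (simp add: Z_def a_def)
    qed
    \<comment> \<open>The clock is at most \<open>v\<close> before \<open>a v\<close>, so no local
      time accumulates at the ends, and the path stays where it is at
      \<open>a \<zeta>\<close>.\<close>
    have "B (a v) \<omega> = B (a \<zeta>) \<omega>"
    proof (rule confinedD(2)[OF \<omega> _ _ _ out])
      show "0 \<le> a \<zeta>" using a \<zeta> by simp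
      have "ennreal (a \<zeta>) \<le> ennreal (a v)" using change_mono[of \<zeta> v \<omega>] a[of \<zeta>] a[of v] \<zeta> by simp
      then show "a \<zeta> \<le> a v" using a[of v] by (simp add: ennreal_le_iff)
      fix q assume q: "0 \<le> q" "q < a v"
      then have "clock q \<omega> \<le> ennreal v" using a[of v] by (intro clock_before_change) (auto simp: ennreal_less_iff)
      then show "clock q \<omega> < \<infinity>" by (metis ennreal_less_top infinity_ennreal_def le_less_trans)
    qed
    moreover have "enn2real (min (ennreal v) (Inf ?E)) = \<zeta>" using \<zeta> by (simp add: min_def ennreal_le_iff)
    ultimately show ?thesis by (simp add: Z_def a_def)
  qed
qed

text \<open>Measurability for \<open>pre_sigma \<rho>\<close> is checked on the events
  \<open>\<rho> \<le> s\<close>. For finite \<open>s = n\<close>, \<open>Y\<close> agrees there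
  almost surely with \<open>Z n\<close>, which looks at the path only up to time \<open>n\<close>;
  for \<open>s = \<infinity>\<close> the limit of \<open>Z k\<close> serves. Null sets are absorbed
  by completeness.\<close>

lemma upto_stop_adapted:
  assumes \<rho>: "stopping_time F \<rho>" and eq: "AE \<omega> in M. Y \<omega> = upto_stop \<rho> \<omega>"
  shows "Y \<in> borel_measurable (pre_sigma \<rho>)"
proof (rule measurableI)
  fix D :: "real set" assume D: "D \<in> sets borel"
  have version: "\<exists>Z. Z \<in> borel_measurable (F s) \<and> (AE \<omega> in M. \<rho> \<omega> \<le> s \<longrightarrow> Y \<omega> = Z \<omega>)" for s
  proof -
    define Z where "Z n \<omega> = B (min (enn2real (min (\<rho> \<omega>) (ennreal n))) (\<tau> n \<omega>)) \<omega>" for n \<omega>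
    have Z_meas: "Z n \<in> borel_measurable (F (ennreal n))" if n: "0 \<le> n" for n
    proof -
      have 1: "(\<lambda>\<omega>. min (\<rho> \<omega>) (ennreal n)) \<in> borel_measurable (F (ennreal n))"
      proof (rule borel_measurableI_le)
        fix y
        show "{\<omega> \<in> space (F (ennreal n)). min (\<rho> \<omega>) (ennreal n) \<le> y} \<in> sets (F (ennreal n))"
        proof (cases "ennreal n \<le> y")
          case False
          then have y: "y \<le> ennreal n" by simp
          have "{\<omega> \<in> space M. \<rho> \<omega> \<le> y} \<in> sets (F y)"
            using stopping_timeD[OF \<rho>, of y] by (simp only: pred_def space_F)
          from F_sets_mono[OF y this] show ?thesis using False by (simp only: min_le_iff_disj space_F simp_thms)
        next
          case True
          then have "{\<omega> \<in> space (F (ennreal n)). min (\<rho> \<omega>) (ennreal n) \<le> y} = space (F (ennreal n))"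
            by (auto simp: min_le_iff_disj)
          then show ?thesis by (simp only: sets.top)
        qed
      qed
      have 2: "\<tau> n \<in> borel_measurable (F (ennreal n))"
      proof (rule borel_measurableI_less)
        fix y
        show "{\<omega> \<in> space (F (ennreal n)). \<tau> n \<omega> < y} \<in> sets (F (ennreal n))"
        proof (cases "y \<le> n")
          case True
          have "{\<omega> \<in> space M. \<tau> n \<omega> < y} \<in> sets (F (ennreal n))"
            by (rule F_sets_mono[OF ennreal_leI[OF True] optional_timeD(3)[OF \<tau>_optional[OF n]]])
          then show ?thesis by (simp only: space_F)
        next
          case False
          then have "{\<omega> \<in> space (F (ennreal n)). \<tau> n \<omega> < y} = space (F (ennreal n))"
            by (auto intro: le_less_trans[OF \<tau>_le])
          then show ?thesis by (simp only: sets.top)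
        qed
      qed
      have 3: "(\<lambda>\<omega>. min (enn2real (min (\<rho> \<omega>) (ennreal n))) (\<tau> n \<omega>)) \<in> borel_measurable (F (ennreal n))"
        using measurable_compose[OF 1 borel_measurable_enn2real] 2 by measurable
      \<comment> \<open>Progressive measurability of \<open>B\<close>: with the time clipped at
        \<open>n\<close> every value is measurable for \<open>F n\<close>, and continuity gives
        joint measurability.\<close>
      have "(\<lambda>(r, \<omega>). B (min r n) \<omega>) \<in> borel_measurable (borel \<Otimes>\<^sub>M F (ennreal n))"
      proof (rule measurable_continuous_process)
        show "B (min t n) \<in> borel_measurable (F (ennreal n))" for t using n by (intro B_measurable_le) auto
        show "continuous_on UNIV (\<lambda>t. B (min t n) \<omega>)" if "\<omega> \<in> space (F (ennreal n))" for \<omega>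
          using that by (intro continuous_on_compose2[OF B_continuous[of \<omega>]] continuous_intros) (auto simp: space_F)
      qed
      from measurable_compose[OF measurable_Pair[OF 3 measurable_ident] this]
      have "(\<lambda>\<omega>. B (min (min (enn2real (min (\<rho> \<omega>) (ennreal n))) (\<tau> n \<omega>)) n) \<omega>) \<in> borel_measurable (F (ennreal n))" by simp
      moreover have "min (min x (\<tau> n \<omega>)) n = min x (\<tau> n \<omega>)" for x \<omega> using \<tau>_le[of n \<omega>] by simp
      ultimately show ?thesis by (simp add: Z_def[abs_def])
    qed
    show ?thesis
    proof (cases s)
      case (real n)
      have "AE \<omega> in M. \<rho> \<omega> \<le> s \<longrightarrow> Y \<omega> = Z n \<omega>"
        using eq AE_good
      proof eventually_elim
        case (elim \<omega>)
        then have \<tau>: "\<tau> n \<omega> = min n (stop \<omega>)" "0 \<le> stop \<omega>" using real by (auto simp: good_def)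
        show ?case
        proof
          assume "\<rho> \<omega> \<le> s"
          then obtain r where r: "\<rho> \<omega> = ennreal r" "0 \<le> r" "r \<le> n" using real by (cases "\<rho> \<omega>") (auto simp: ennreal_le_iff top_unique)
          have "min (enn2real (min (\<rho> \<omega>) (ennreal n))) (\<tau> n \<omega>) = min r (stop \<omega>)"
            using r \<tau> real by (simp add: enn2real_min_finite min_absorb1)
          moreover have "enn2real (min (\<rho> \<omega>) (ennreal (stop \<omega>))) = min r (stop \<omega>)"
            using r \<tau>(2) by (simp add: enn2real_min_finite)
          ultimately show "Y \<omega> = Z n \<omega>" using elim by (simp add: upto_stop_def Z_def)
        qed
      qed
      then show ?thesis using Z_meas real by auto
    next
      case top
      have "(\<lambda>\<omega>. lim (\<lambda>k. Z (real k) \<omega>)) \<in> borel_measurable (F s)"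
        using top by (intro borel_measurable_lim_metric F_measurable_mono[OF Z_meas]) auto
      moreover have "AE \<omega> in M. \<rho> \<omega> \<le> s \<longrightarrow> Y \<omega> = lim (\<lambda>k. Z (real k) \<omega>)"
        using eq AE_good AE_stop_eventually
      proof eventually_elim
        case (elim \<omega>)
        then have st: "0 \<le> stop \<omega>" by (simp add: good_def)
        from elim(3) have "\<forall>\<^sub>F k in sequentially. Z (real k) \<omega> = Y \<omega>"
        proof eventually_elim
          case (elim k)
          then have "stop \<omega> \<le> real k" using \<tau>_le[of "real k" \<omega>] by simp
          then show ?case using elim st \<open>Y \<omega> = upto_stop \<rho> \<omega>\<close> by (simp add: Z_def upto_stop_def min_enn2real)
        qed
        then have "(\<lambda>k. Z (real k) \<omega>) \<longlonglongrightarrow> Y \<omega>" by (rule tendsto_eventually)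
        then show ?case by (simp add: limI)
      qed
      ultimately show ?thesis by blast
    qed
  qed
  show "Y -` D \<inter> space (pre_sigma \<rho>) \<in> sets (pre_sigma \<rho>)"
  proof (rule sets_pre_sigmaI[OF \<rho>])
    fix s
    obtain Z where Z[measurable]: "Z \<in> borel_measurable (F s)" and ae: "AE \<omega> in M. \<rho> \<omega> \<le> s \<longrightarrow> Y \<omega> = Z \<omega>"
      using version by auto
    have "Z -` D \<inter> space (F s) \<in> sets (F s)" by (rule measurable_sets[OF Z D])
    moreover have "{\<omega> \<in> space (F s). \<rho> \<omega> \<le> s} \<in> sets (F s)" using stopping_timeD[OF \<rho>, of s] by (simp add: pred_def)
    ultimately have "(Z -` D \<inter> space (F s)) \<inter> {\<omega> \<in> space (F s). \<rho> \<omega> \<le> s} \<in> sets (F s)" by auto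
    then show "{\<omega> \<in> Y -` D \<inter> space (pre_sigma \<rho>). \<rho> \<omega> \<le> s} \<in> sets (F s)"
    proof (rule F_AE_eq)
      show "AE \<omega> in M. \<omega> \<in> (Z -` D \<inter> space (F s)) \<inter> {\<omega> \<in> space (F s). \<rho> \<omega> \<le> s} \<longleftrightarrow> \<omega> \<in> {\<omega> \<in> Y -` D \<inter> space (pre_sigma \<rho>). \<rho> \<omega> \<le> s}"
        using ae AE_space by eventually_elim (auto simp: space_F space_pre_sigma)
    qed (auto simp: space_pre_sigma)
  qed
qed auto

text \<open>Over sets of \<open>G s\<close> both \<open>Y s\<close> and \<open>Y t\<close> have the
  same integrals as \<open>B stop\<close>, so the martingale is closed by \<open>B stop\<close>.
  \<open>Y\<close> is prescribed only almost surely and \<open>G\<close> only by its sets, so that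
  the result applies to the given processes and not just to their regular versions.\<close>

lemma stopped_diffusion_martingale:
  assumes G: "\<And>t. space (G t) = space M" "\<And>t. 0 \<le> t \<Longrightarrow> sets (G t) = sets (pre_sigma (change t))"
    and Y: "\<And>t. 0 \<le> t \<Longrightarrow> AE \<omega> in M. Y t \<omega> = upto_stop (change t) \<omega>"
  shows "martingale M G Y" "uniformly_integrable M Y"
proof -
  note \<rho> = change_stopping_time
  have Y_G: "Y t \<in> borel_measurable (G t)" if "0 \<le> t" for t
    using upto_stop_adapted[OF \<rho> Y[OF that]] measurable_cong_sets[OF G(2)[OF that] refl] by blast
  have sub: "subalgebra M (G t)" if "0 \<le> t" for t
    unfolding subalgebra_def using G that pre_sigma_sets_M[OF \<rho>] by auto
  have Y_M: "Y t \<in> borel_measurable M" if "0 \<le> t" for t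
    by (rule measurable_from_subalg[OF sub[OF that] Y_G[OF that]])
  have Y_int: "integrable M (Y t)" if "0 \<le> t" for t
    using upto_stop(1)[OF \<rho>, of t] integrable_cong_AE[OF Y_M[OF that] upto_stop_measurable[OF \<rho>] Y[OF that]] by simp
  have mono: "sets (G s) \<subseteq> sets (G t)" if "0 \<le> s" "s \<le> t" for s t
    using that G(2)[of s] G(2)[of t] mono_pre_sigma[OF \<rho> \<rho>, of s t] change_mono[OF that(2)] by auto
  have set_int: "set_lebesgue_integral M A (Y t) = (\<integral>\<omega>. B (stop \<omega>) \<omega> * indicator A \<omega> \<partial>M)"
    if "0 \<le> t" "A \<in> sets (G t)" for t A
  proof -
    have A: "A \<in> sets (pre_sigma (change t))" using that G(2) by simp
    then have [measurable]: "A \<in> sets M" by (rule pre_sigma_sets_M[OF \<rho>])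
    note [measurable] = Y_M[OF that(1)] upto_stop_measurable[OF \<rho>, of t]
    have "set_lebesgue_integral M A (Y t) = (\<integral>\<omega>. upto_stop (change t) \<omega> * indicator A \<omega> \<partial>M)"
      unfolding set_lebesgue_integral_def
      using Y[OF that(1)] by (intro integral_cong_AE) (auto elim!: eventually_mono)
    then show ?thesis using upto_stop(2)[OF \<rho> A] by simp
  qed
  show "martingale M G Y"
    unfolding martingale_def
  proof (intro conjI allI impI)
    fix s t :: real assume "0 \<le> s \<and> s \<le> t"
    then have st: "0 \<le> s" "s \<le> t" "0 \<le> t" by auto
    interpret S: finite_measure_subalgebra M "G s" by unfold_locales (rule sub[OF st(1)])
    show "AE \<omega> in M. real_cond_exp M (G s) (Y t) \<omega> = Y s \<omega>"
    proof (rule S.real_cond_exp_charact)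
      fix A assume A: "A \<in> sets (G s)"
      then have "A \<in> sets (G t)" using mono[OF st(1,2)] by auto
      then show "set_lebesgue_integral M A (Y t) = set_lebesgue_integral M A (Y s)"
        using set_int[OF st(3)] set_int[OF st(1) A] by simp
    qed (use Y_int Y_G st in auto)
  qed (use sub mono Y_G Y_int in auto)
  show "uniformly_integrable M Y"
    unfolding uniformly_integrable_def
  proof (intro conjI allI impI)
    fix \<epsilon> :: real assume "0 < \<epsilon>"
    then obtain K where K: "0 \<le> K" "(\<integral>x. excess K x \<partial>\<mu>) \<le> \<epsilon> / 2" using excess_uniform[of "\<epsilon> / 2"] by auto
    show "\<exists>K>0. \<forall>t\<ge>0. (\<integral>\<omega>. \<bar>Y t \<omega>\<bar> * indicator {\<omega>. K < \<bar>Y t \<omega>\<bar>} \<omega> \<partial>M) \<le> \<epsilon>"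
    \<comment> \<open>If \<open>\<bar>y\<bar> > 2 * K\<close> then
      \<open>\<bar>y\<bar> \<le> 2 * excess K y\<close>; adding 1 makes the level positive when
      \<open>K = 0\<close>.\<close>
    proof (intro exI[of _ "2 * K + 1"] conjI allI impI)
      fix t :: real assume t: "0 \<le> t"
      note [measurable] = Y_M[OF t] upto_stop_measurable[OF \<rho>, of t]
      have iE: "integrable M (\<lambda>\<omega>. 2 * excess K (Y t \<omega>))" using integrable_excess[OF Y_int[OF t] K(1)] by simp
      have "(\<integral>\<omega>. \<bar>Y t \<omega>\<bar> * indicator {\<omega>. 2 * K + 1 < \<bar>Y t \<omega>\<bar>} \<omega> \<partial>M) \<le> (\<integral>\<omega>. 2 * excess K (Y t \<omega>) \<partial>M)"
      proof (rule integral_mono[OF _ iE])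
        show "integrable M (\<lambda>\<omega>. \<bar>Y t \<omega>\<bar> * indicator {\<omega>. 2 * K + 1 < \<bar>Y t \<omega>\<bar>} \<omega>)"
        proof (rule Bochner_Integration.integrable_bound[OF Y_int[OF t]])
          show "(\<lambda>\<omega>. \<bar>Y t \<omega>\<bar> * indicat_real {\<omega>. 2 * K + 1 < \<bar>Y t \<omega>\<bar>} \<omega>) \<in> borel_measurable M" by measurable
        qed (auto simp: indicator_def)
      qed (use K(1) in \<open>auto simp: indicator_def excess_def\<close>)
      also have "\<dots> = 2 * (\<integral>\<omega>. excess K (Y t \<omega>) \<partial>M)" by simp
      also have "(\<integral>\<omega>. excess K (Y t \<omega>) \<partial>M) = (\<integral>\<omega>. excess K (upto_stop (change t) \<omega>) \<partial>M)"
        using Y[OF t] by (intro integral_cong_AE) (auto elim!: eventually_mono)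
      also have "2 * \<dots> \<le> 2 * (\<epsilon> / 2)" using upto_stop(3)[OF \<rho> K(1), of t] K(2) by (intro mult_left_mono) auto
      finally show "(\<integral>\<omega>. \<bar>Y t \<omega>\<bar> * indicator {\<omega>. 2 * K + 1 < \<bar>Y t \<omega>\<bar>} \<omega> \<partial>M) \<le> \<epsilon>" by simp
    qed (use K(1) in auto)
  qed (use Y_int in auto)
qed

end

section \<open>Regular versions and the main theorem\<close>

lemma continuous_le_of_averages:
  fixes f g :: "real \<Rightarrow> real"
  assumes f: "continuous_on UNIV f" "\<And>y. 0 \<le> f y" and g: "continuous_on UNIV g" "\<And>y. 0 \<le> g y" and \<delta>: "0 < \<delta>"
    and le: "\<And>e. 0 < e \<Longrightarrow> e < \<delta> \<Longrightarrow> (\<integral>\<^sup>+y\<in>{x - e<..<x + e}. ennreal (f y) \<partial>lborel) \<le> (\<integral>\<^sup>+y\<in>{x - e<..<x + e}. ennreal (g y) \<partial>lborel)"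
  shows "f x \<le> g x"
proof -
  let ?I = "\<lambda>k. {x - 1 / real (Suc k)<..<x + 1 / real (Suc k)}"
  have avg: "(\<lambda>k. ennreal (real (Suc k) / 2) * (\<integral>\<^sup>+y\<in>?I k. ennreal (h y) \<partial>lborel)) \<longlonglongrightarrow> ennreal (h x)"
    if "continuous_on UNIV h" "\<And>y. 0 \<le> h y" for h :: "real \<Rightarrow> real"
    using that by (intro average_tendsto borel_measurable_continuous_onI) (auto simp: continuous_on_eq_continuous_at)
  have "\<forall>\<^sub>F k in sequentially. 1 / real (Suc k) < \<delta>"
    using LIMSEQ_Suc[OF lim_1_over_n[where 'a=real]] \<delta> by (rule order_tendstoD)
  then have "\<forall>\<^sub>F k in sequentially. ennreal (real (Suc k) / 2) * (\<integral>\<^sup>+y\<in>?I k. ennreal (f y) \<partial>lborel)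
      \<le> ennreal (real (Suc k) / 2) * (\<integral>\<^sup>+y\<in>?I k. ennreal (g y) \<partial>lborel)"
    by eventually_elim (intro mult_left_mono le, auto)
  then have "ennreal (f x) \<le> ennreal (g x)"
    by (rule tendsto_le[OF sequentially_bot avg[OF g] avg[OF f]])
  then show ?thesis using g(2) by (simp add: ennreal_le_iff)
qed

text \<open>Each property is first one of the occupation times of small intervals around
  \<open>x\<close>, and passes to the level \<open>x\<close> by continuity of the density.
  Occupation sets grow with time and are within \<open>{0}\<close> at time 0; a path that avoids
  \<open>x\<close> on \<open>[s, t]\<close> avoids a neighbourhood of \<open>x\<close>, by
  compactness.\<close>

lemma occupation_density_path:
  fixes b :: "real \<Rightarrow> real" and l :: "real \<Rightarrow> real \<Rightarrow> real"
  assumes b: "continuous_on UNIV b" and l: "continuous_on (UNIV \<times> {0..}) (\<lambda>(x, t). l x t)"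
    and nonneg: "\<And>x t. 0 \<le> t \<Longrightarrow> 0 \<le> l x t"
    and occ: "\<And>t D. 0 \<le> t \<Longrightarrow> D \<in> sets borel \<Longrightarrow> emeasure lborel {s \<in> {0..t}. b s \<in> D} = (\<integral>\<^sup>+x\<in>D. ennreal (l x t) \<partial>lborel)"
  shows "l x 0 = 0" and "0 \<le> s \<Longrightarrow> s \<le> t \<Longrightarrow> l x s \<le> l x t"
    and "0 \<le> s \<Longrightarrow> s \<le> t \<Longrightarrow> \<forall>r\<in>{s..t}. b r \<noteq> x \<Longrightarrow> l x s = l x t"
proof -
  have cont: "continuous_on UNIV (\<lambda>x. l x t)" if "0 \<le> t" for t
  proof -
    have "continuous_on UNIV (\<lambda>x. (\<lambda>(x, t). l x t) (x, t))"
      by (rule continuous_on_compose2[OF l]) (use that in \<open>auto intro!: continuous_intros\<close>)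
    then show ?thesis by simp
  qed
  have b_meas[measurable]: "b \<in> borel_measurable borel" by (rule borel_measurable_continuous_onI[OF b])
  have meas: "{s \<in> {0..t}. b s \<in> D} \<in> sets lborel" if "D \<in> sets borel" for t D
  proof -
    have "{s \<in> {0..t}. b s \<in> D} = {0..t} \<inter> (b -` D \<inter> space borel)" by auto
    also have "\<dots> \<in> sets borel" using measurable_sets[OF b_meas that] by auto
    finally show ?thesis by simp
  qed
  have mono: "(\<integral>\<^sup>+y\<in>D. ennreal (l y s) \<partial>lborel) \<le> (\<integral>\<^sup>+y\<in>D. ennreal (l y t) \<partial>lborel)"
    if "0 \<le> s" "s \<le> t" "D \<in> sets borel" for s t D
    using that occ[OF that(1,3), symmetric] occ[of t D, symmetric] by (simp only:) (intro emeasure_mono meas, auto)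
  show mono': "l x s \<le> l x t" if "0 \<le> s" "s \<le> t" for s t x
    using that by (intro continuous_le_of_averages[OF cont _ cont _ zero_less_one] mono nonneg) auto
  show "l x 0 = 0"
  proof (rule antisym)
    show "l x 0 \<le> 0"
    proof (rule continuous_le_of_averages[OF cont nonneg _ _ zero_less_one])
      fix e :: real
      have "{s \<in> {0..0}. b s \<in> {x - e<..<x + e}} \<subseteq> {0}" by auto
      then have "emeasure lborel {s \<in> {0..0}. b s \<in> {x - e<..<x + e}} \<le> emeasure lborel {0 :: real}"
        by (intro emeasure_mono) auto
      then show "(\<integral>\<^sup>+y\<in>{x - e<..<x + e}. ennreal (l y 0) \<partial>lborel) \<le> (\<integral>\<^sup>+y\<in>{x - e<..<x + e}. ennreal 0 \<partial>lborel)"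
        by (subst occ[symmetric]) auto
    qed auto
  qed (rule nonneg, simp)
  assume st: "0 \<le> s" "s \<le> t" and avoid: "\<forall>r\<in>{s..t}. b r \<noteq> x"
  have "closed (b ` {s..t})"
    by (intro compact_imp_closed compact_continuous_image continuous_on_subset[OF b]) auto
  then have "open (- (b ` {s..t}))" by auto
  moreover have "x \<in> - (b ` {s..t})" using avoid by auto
  ultimately obtain d where d: "0 < d" "ball x d \<subseteq> - (b ` {s..t})" by (rule openE)
  show "l x s = l x t"
  proof (rule antisym[OF mono'[OF st]])
    show "l x t \<le> l x s"
    proof (rule continuous_le_of_averages[OF cont _ cont _ d(1)])
      fix e assume e: "0 < e" "e < d"
      have avoid': "b r \<notin> {x - e<..<x + e}" if "r \<in> {s..t}" for r
      proof
        assume "b r \<in> {x - e<..<x + e}"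
        then have "b r \<in> ball x d" using e by (auto simp: dist_real_def)
        then show False using d(2) that by auto
      qed
      have "r \<in> {0..t} \<and> b r \<in> {x - e<..<x + e} \<longleftrightarrow> r \<in> {0..s} \<and> b r \<in> {x - e<..<x + e}" for r
        using avoid'[of r] st by (cases "r \<le> s") auto
      then have "{r \<in> {0..t}. b r \<in> {x - e<..<x + e}} = {r \<in> {0..s}. b r \<in> {x - e<..<x + e}}"
        by (rule Collect_cong)
      then show "(\<integral>\<^sup>+y\<in>{x - e<..<x + e}. ennreal (l y t) \<partial>lborel) \<le> (\<integral>\<^sup>+y\<in>{x - e<..<x + e}. ennreal (l y s) \<partial>lborel)"
        using occ[of t "{x - e<..<x + e}"] occ[of s "{x - e<..<x + e}"] st by simp
    qed (use st nonneg in auto)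
  qed
qed

context usual_conditions
begin

lemma martingale_AE_cong:
  assumes Y: "martingale M G Y" and eq: "\<And>t. 0 \<le> t \<Longrightarrow> AE \<omega> in M. Y' t \<omega> = Y t \<omega>"
    and meas: "\<And>t. 0 \<le> t \<Longrightarrow> Y' t \<in> borel_measurable (G t)"
  shows "martingale M G Y'"
proof -
  have sub: "subalgebra M (G t)" if "0 \<le> t" for t using Y that by (auto simp: martingale_def)
  have int: "integrable M (Y t)" if "0 \<le> t" for t using Y that by (auto simp: martingale_def)
  have Y'_M: "Y' t \<in> borel_measurable M" if "0 \<le> t" for t by (rule measurable_from_subalg[OF sub[OF that] meas[OF that]])
  have int': "integrable M (Y' t)" if "0 \<le> t" for t
    using int[OF that] integrable_cong_AE[OF Y'_M[OF that] _ eq[OF that]] by (simp add: borel_measurable_integrable int that)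
  show ?thesis unfolding martingale_def
  proof (intro conjI allI impI)
    fix s t :: real assume st: "0 \<le> s \<and> s \<le> t"
    interpret S: finite_measure_subalgebra M "G s" by unfold_locales (rule sub, use st in simp)
    have "AE \<omega> in M. real_cond_exp M (G s) (Y' t) \<omega> = real_cond_exp M (G s) (Y t) \<omega>"
      using st by (intro S.real_cond_exp_cong eq Y'_M borel_measurable_integrable int) auto
    moreover have "AE \<omega> in M. real_cond_exp M (G s) (Y t) \<omega> = Y s \<omega>" using Y st by (auto simp: martingale_def)
    moreover have "AE \<omega> in M. Y' s \<omega> = Y s \<omega>" using st eq by auto
    ultimately show "AE \<omega> in M. real_cond_exp M (G s) (Y' t) \<omega> = Y' s \<omega>" by eventually_elim simp
  qed (use sub meas int' Y in \<open>auto simp: martingale_def\<close>)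
qed

lemma distributed_AE_cong:
  assumes D: "distributed M N X f" and eq: "AE \<omega> in M. X' \<omega> = X \<omega>" and X': "X' \<in> measurable M N"
  shows "distributed M N X' f"
proof -
  have X: "X \<in> measurable M N" using D by (simp add: distributed_def)
  have "distr M N X' = distr M N X" by (rule distr_cong_AE[OF refl refl eq X' X])
  then show ?thesis using D X' by (simp add: distributed_def)
qed

text \<open>On the null set of irregular paths the processes are replaced by the constants
  \<open>x0\<close> and 0; as this set belongs to every \<open>F t\<close>, adaptedness and the
  martingale property survive. Monotonicity and support of the local times come from
  \<open>occupation_density_path\<close>.\<close>

lemma regular_version:
  assumes B: "brownian_motion M F B" and B0: "AE \<omega> in M. B 0 \<omega> = x0" and L: "brownian_local_time M F B L"
  obtains N B' L' where "N \<in> null_sets M" "brownian_local_time_space M F B' L' x0"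
    "\<And>\<omega> t. \<omega> \<in> space M \<Longrightarrow> \<omega> \<notin> N \<Longrightarrow> 0 \<le> t \<Longrightarrow> B' t \<omega> = B t \<omega>"
    "\<And>\<omega> x t. \<omega> \<in> space M \<Longrightarrow> \<omega> \<notin> N \<Longrightarrow> 0 \<le> t \<Longrightarrow> L' x t \<omega> = L x t \<omega>"
proof -
  define regular where "regular \<omega> \<longleftrightarrow> continuous_on {0..} (\<lambda>t. B t \<omega>) \<and> B 0 \<omega> = x0 \<and>
     continuous_on (UNIV \<times> {0..}) (\<lambda>(x, t). L x t \<omega>) \<and> (\<forall>x. \<forall>t\<ge>0. 0 \<le> L x t \<omega>) \<and>
     (\<forall>t\<ge>0. \<forall>D\<in>sets borel. emeasure lborel {s \<in> {0..t}. B s \<omega> \<in> D} = (\<integral>\<^sup>+x\<in>D. ennreal (L x t \<omega>) \<partial>lborel))" for \<omega>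
  have ae: "AE \<omega> in M. regular \<omega>"
    using B B0 L unfolding brownian_motion_def brownian_local_time_def regular_def by auto
  define N where "N = {\<omega>\<in>space M. \<not> regular \<omega>}"
  have N: "N \<in> null_sets M" using ae unfolding N_def by (simp add: AE_iff_null_sets)
  have ae_N: "AE \<omega> in M. \<omega> \<notin> N" by (rule AE_not_in[OF N])
  have N_F: "N \<in> sets (F t)" for t by (rule F_null[OF N])
  define B' where "B' t \<omega> = (if t \<le> 0 \<or> \<omega> \<in> N then x0 else B t \<omega>)" for t \<omega>
  define L' where "L' x t \<omega> = (if t \<le> 0 \<or> \<omega> \<in> N then 0 else L x t \<omega>)" for x t \<omega>
  have B'_max: "B' t \<omega> = B (max 0 t) \<omega>" if "\<omega> \<in> space M" "\<omega> \<notin> N" for t \<omega>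
    using that by (auto simp: B'_def N_def regular_def max_def)
  have B'_cont: "continuous_on UNIV (\<lambda>t. B' t \<omega>)" if \<omega>: "\<omega> \<in> space M" for \<omega>
  proof (cases "\<omega> \<in> N")
    case True then show ?thesis by (simp add: B'_def)
  next
    case False
    then have "continuous_on {0..} (\<lambda>t. B t \<omega>)" using \<omega> by (simp add: N_def regular_def)
    then have "continuous_on UNIV (\<lambda>t. B (max 0 t) \<omega>)"
      by (rule continuous_on_compose2) (auto intro!: continuous_intros)
    then show ?thesis using B'_max[OF \<omega> False] by simp
  qed
  have path: "L x 0 \<omega> = 0" "0 \<le> s \<Longrightarrow> s \<le> t \<Longrightarrow> L x s \<omega> \<le> L x t \<omega>"
    "0 \<le> s \<Longrightarrow> s \<le> t \<Longrightarrow> \<forall>r\<in>{s..t}. B' r \<omega> \<noteq> x \<Longrightarrow> L x s \<omega> = L x t \<omega>"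
    if \<omega>: "\<omega> \<in> space M" "\<omega> \<notin> N" for \<omega> x s t
  proof -
    have reg: "regular \<omega>" using \<omega> by (simp add: N_def)
    have occ: "emeasure lborel {s \<in> {0..t}. B' s \<omega> \<in> D} = (\<integral>\<^sup>+x\<in>D. ennreal (L x t \<omega>) \<partial>lborel)"
      if "0 \<le> t" "D \<in> sets borel" for t D
    proof -
      have "{s \<in> {0..t}. B' s \<omega> \<in> D} = {s \<in> {0..t}. B s \<omega> \<in> D}" using B'_max[OF \<omega>] by (auto simp: max_def)
      then show ?thesis using reg that by (simp add: regular_def)
    qed
    have cont: "continuous_on (UNIV \<times> {0..}) (\<lambda>(x, t). L x t \<omega>)" and nn: "\<And>x t. 0 \<le> t \<Longrightarrow> 0 \<le> L x t \<omega>"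
      using reg by (auto simp: regular_def)
    note P = occupation_density_path[where b="\<lambda>t. B' t \<omega>" and l="\<lambda>x t. L x t \<omega>", OF B'_cont[OF \<omega>(1)] cont nn occ]
    show "L x 0 \<omega> = 0" "0 \<le> s \<Longrightarrow> s \<le> t \<Longrightarrow> L x s \<omega> \<le> L x t \<omega>"
      "0 \<le> s \<Longrightarrow> s \<le> t \<Longrightarrow> \<forall>r\<in>{s..t}. B' r \<omega> \<noteq> x \<Longrightarrow> L x s \<omega> = L x t \<omega>"
      using P by blast+
  qed
  have L'_max: "L' x t \<omega> = L x (max 0 t) \<omega>" if "\<omega> \<in> space M" "\<omega> \<notin> N" for x t \<omega>
    using that path(1) by (auto simp: L'_def max_def)
  have B_adapted: "B t \<in> borel_measurable (F (ennreal t))" if "0 \<le> t" for t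
    using B that by (simp add: brownian_motion_def)
  have B'_adapted: "B' t \<in> borel_measurable (F (ennreal t))" if "0 \<le> t" for t
  proof (cases "t = 0")
    case False
    then have "B' t = (\<lambda>\<omega>. if \<omega> \<in> N then x0 else B t \<omega>)" using that by (auto simp: B'_def)
    then show ?thesis using N_F[of "ennreal t"] B_adapted[OF that] by (auto intro!: measurable_If_set)
  next
    case True
    then have "B' t = (\<lambda>\<omega>. x0)" by (auto simp: B'_def)
    then show ?thesis by simp
  qed
  \<comment> \<open>Adaptedness of the local time is inherited from Tanaka's martingale, which
    differs from \<open>\<bar>B t - x\<bar>\<close> by the local time.\<close>
  have L_adapted: "L x t \<in> borel_measurable (F (ennreal t))" if "0 \<le> t" for x t
  proof -
    have "(\<lambda>\<omega>. \<bar>B t \<omega> - x\<bar> - L x t \<omega>) \<in> borel_measurable (F (ennreal t))"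
      using L that by (simp add: brownian_local_time_def martingale_def)
    then have "(\<lambda>\<omega>. \<bar>B t \<omega> - x\<bar> - (\<bar>B t \<omega> - x\<bar> - L x t \<omega>)) \<in> borel_measurable (F (ennreal t))"
      using B_adapted[OF that] by measurable
    then show ?thesis by simp
  qed
  have L'_adapted: "L' x t \<in> borel_measurable (F (ennreal t))" if "0 \<le> t" for x t
  proof (cases "t = 0")
    case False
    then have "L' x t = (\<lambda>\<omega>. if \<omega> \<in> N then 0 else L x t \<omega>)" using that by (auto simp: L'_def)
    then show ?thesis using N_F[of "ennreal t"] L_adapted[OF that] by (auto intro!: measurable_If_set)
  next
    case True
    then have "L' x t = (\<lambda>\<omega>. 0)" by (auto simp: L'_def)
    then show ?thesis by simp
  qed
  have B'_M: "B' t \<in> borel_measurable M" and B_M: "B t \<in> borel_measurable M" if "0 \<le> t" for t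
    using F_measurable_M[OF B'_adapted[OF that]] F_measurable_M[OF B_adapted[OF that]] by auto
  have B'_eq: "AE \<omega> in M. B' t \<omega> = B t \<omega>" if "0 \<le> t" for t
    using ae_N AE_space by eventually_elim (use B'_max that in auto)
  have L'_eq: "AE \<omega> in M. L' x t \<omega> = L x t \<omega>" if "0 \<le> t" for x t
    using ae_N AE_space by eventually_elim (use L'_max that in auto)
  have "brownian_local_time_space M F B' L' x0"
  proof
    fix s t :: real assume st: "0 \<le> s" "s < t"
    note [measurable] = B'_M[OF st(1)] B'_M[of t] B_M[OF st(1)] B_M[of t]
    have t: "0 \<le> t" using st by simp
    have d_eq: "AE \<omega> in M. B' t \<omega> - B' s \<omega> = B t \<omega> - B s \<omega>"
      using B'_eq[OF st(1)] B'_eq[OF t] by eventually_elim simp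
    show "distributed M lborel (\<lambda>\<omega>. B' t \<omega> - B' s \<omega>) (normal_density 0 (sqrt (t - s)))"
      using B st t by (intro distributed_AE_cong[OF _ d_eq]) (auto simp: brownian_motion_def)
    have ind: "indep_set (sets (F (ennreal s))) (sets (vimage_algebra (space M) (\<lambda>\<omega>. B t \<omega> - B s \<omega>) borel))"
      using B st by (simp add: brownian_motion_def)
    show "indep_set (sets (F (ennreal s))) (sets (vimage_algebra (space M) (\<lambda>\<omega>. B' t \<omega> - B' s \<omega>) borel))"
      unfolding indep_sets2_eq
    proof (intro conjI ballI)
      show "sets (F (ennreal s)) \<subseteq> events" using F_sets_M by auto
      have m': "(\<lambda>\<omega>. B' t \<omega> - B' s \<omega>) \<in> borel_measurable M" and m: "(\<lambda>\<omega>. B t \<omega> - B s \<omega>) \<in> borel_measurable M"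
        using t by measurable
      show "sets (vimage_algebra (space M) (\<lambda>\<omega>. B' t \<omega> - B' s \<omega>) borel) \<subseteq> events"
        using measurable_sets[OF m'] by (auto simp: sets_vimage_algebra2)
      fix C X assume C: "C \<in> sets (F (ennreal s))" and "X \<in> sets (vimage_algebra (space M) (\<lambda>\<omega>. B' t \<omega> - B' s \<omega>) borel)"
      then obtain D where X: "X = (\<lambda>\<omega>. B' t \<omega> - B' s \<omega>) -` D \<inter> space M" and D: "D \<in> sets borel"
        by (auto simp: sets_vimage_algebra2)
      define X2 where "X2 = (\<lambda>\<omega>. B t \<omega> - B s \<omega>) -` D \<inter> space M"
      have X2: "X2 \<in> sets (vimage_algebra (space M) (\<lambda>\<omega>. B t \<omega> - B s \<omega>) borel)"
        using D by (auto simp: X2_def sets_vimage_algebra2)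
      have XM: "X \<in> events" "X2 \<in> events" using measurable_sets[OF m' D] measurable_sets[OF m D] by (auto simp: X X2_def)
      have CM: "C \<in> events" using C by (rule F_sets_M)
      have "prob (C \<inter> X) = prob (C \<inter> X2)"
        using d_eq XM CM by (intro finite_measure_eq_AE) (auto simp: X X2_def elim!: eventually_mono)
      also have "\<dots> = prob C * prob X2" by (rule indep_setD[OF ind C X2])
      also have "prob X2 = prob X"
        using d_eq XM by (intro finite_measure_eq_AE) (auto simp: X X2_def elim!: eventually_mono)
      finally show "prob (C \<inter> X) = prob C * prob X" .
    qed
  next
    fix \<omega> assume \<omega>: "\<omega> \<in> space M"
    show "continuous_on UNIV (\<lambda>(x, t). L' x t \<omega>)"
    proof (cases "\<omega> \<in> N")
      case True then show ?thesis by (simp add: L'_def case_prod_beta)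
    next
      case False
      then have "continuous_on (UNIV \<times> {0..}) (\<lambda>(x, t). L x t \<omega>)" using \<omega> by (simp add: N_def regular_def)
      then have "continuous_on UNIV (\<lambda>p. (\<lambda>(x, t). L x t \<omega>) (fst p, max 0 (snd p)))"
        by (rule continuous_on_compose2) (auto intro!: continuous_intros)
      then show ?thesis using L'_max[OF \<omega> False] by (simp add: case_prod_beta)
    qed
  next
    fix \<omega> x and t :: real assume \<omega>: "\<omega> \<in> space M"
    show "0 \<le> L' x t \<omega>" using \<omega> by (auto simp: L'_def N_def regular_def)
  next
    fix \<omega> x and s t :: real assume \<omega>: "\<omega> \<in> space M" and st: "s \<le> t"
    show "L' x s \<omega> \<le> L' x t \<omega>"
      using L'_max[OF \<omega>] path(2)[OF \<omega>, of "max 0 s" "max 0 t" x] st by (cases "\<omega> \<in> N") (auto simp: L'_def[of _ _ \<omega>])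
    assume avoid: "\<forall>r\<in>{s..t}. B' r \<omega> \<noteq> x"
    show "L' x s \<omega> = L' x t \<omega>"
    proof (cases "\<omega> \<in> N \<or> t \<le> 0")
      case False
      then show ?thesis
        using L'_max[OF \<omega>] path(3)[OF \<omega>, of "max 0 s" "max 0 t" x] st avoid by auto
    qed (use st in \<open>auto simp: L'_def\<close>)
  next
    show "AE \<omega> in M. \<forall>t\<ge>0. \<forall>D\<in>sets borel. emeasure lborel {s \<in> {0..t}. B' s \<omega> \<in> D} = (\<integral>\<^sup>+x\<in>D. ennreal (L' x t \<omega>) \<partial>lborel)"
      using ae ae_N AE_space
    proof eventually_elim
      case (elim \<omega>)
      show ?case
      proof (intro allI impI ballI)
        fix t :: real and D :: "real set" assume t: "0 \<le> t" and D: "D \<in> sets borel"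
        have "{s \<in> {0..t}. B' s \<omega> \<in> D} = {s \<in> {0..t}. B s \<omega> \<in> D}" using B'_max[OF elim(3,2)] by (auto simp: max_def)
        then show "emeasure lborel {s \<in> {0..t}. B' s \<omega> \<in> D} = (\<integral>\<^sup>+x\<in>D. ennreal (L' x t \<omega>) \<partial>lborel)"
          using elim(1) t D L'_max[OF elim(3,2)] by (simp add: regular_def max_absorb2)
      qed
    qed
  next
    fix x
    have N0: "martingale M (\<lambda>t. F (ennreal t)) (\<lambda>t \<omega>. \<bar>B t \<omega> - x\<bar> - L x t \<omega>)"
      using L by (simp add: brownian_local_time_def)
    show "martingale M (\<lambda>t. F (ennreal t)) (\<lambda>t \<omega>. \<bar>B' t \<omega> - x\<bar> - L' x t \<omega>)"
    proof (rule martingale_AE_cong[OF N0])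
      fix t :: real assume t: "0 \<le> t"
      show "AE \<omega> in M. \<bar>B' t \<omega> - x\<bar> - L' x t \<omega> = \<bar>B t \<omega> - x\<bar> - L x t \<omega>"
        using B'_eq[OF t] L'_eq[OF t, of x] by eventually_elim simp
      show "(\<lambda>\<omega>. \<bar>B' t \<omega> - x\<bar> - L' x t \<omega>) \<in> borel_measurable (F (ennreal t))"
        using B'_adapted[OF t] L'_adapted[OF t] by measurable
    qed
  qed (use B'_adapted L'_adapted B'_cont in \<open>auto simp: B'_def L'_def\<close>)
  then show ?thesis
    using that[OF N, of B' L'] B'_max L'_max by (simp add: max_absorb2)
qed

end

theorem theorem3p1:
  fixes \<mu> m :: "real measure" and x0 :: real
    and M :: "'a measure" and F :: "ennreal \<Rightarrow> 'a measure"
    and B X :: "real \<Rightarrow> 'a \<Rightarrow> real" and L :: "real \<Rightarrow> real \<Rightarrow> 'a \<Rightarrow> real" and T :: "'a \<Rightarrow> real"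
  assumes "prob_space \<mu>" and "sets \<mu> = sets borel"
    and "\<forall>a. \<mu> \<noteq> return borel a"
    and "integrable \<mu> (\<lambda>x. x)" and "(\<integral>x. x \<partial>\<mu>) = x0"
    and "speed_measure_for \<mu> x0 m"
    and "usual_conditions M F"
    and "brownian_motion M F B" and "AE \<omega> in M. B 0 \<omega> = x0"
    and "brownian_local_time M F B L"
    and "X = generalised_diffusion m x0 B L"
    and "T \<in> borel_measurable (F 0)"
    and "distributed M lborel T (exponential_density 1)"
    and "prob_space.indep_set M (sets (vimage_algebra (space M) T borel))
      (sets (vimage_algebra (space M) (\<lambda>\<omega>. \<lambda>t\<in>{0..}. X t \<omega>) (PiM {0..} (\<lambda>_. borel))))"
  shows "(\<lambda>\<omega>. X (T \<omega>) \<omega>) \<in> borel_measurable M \<and>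
         distr M borel (\<lambda>\<omega>. X (T \<omega>) \<omega>) = \<mu> \<and>
         martingale M (time_changed_filtration M F m L) (\<lambda>t \<omega>. X (min t (T \<omega>)) \<omega>) \<and>
         uniformly_integrable M (\<lambda>t \<omega>. X (min t (T \<omega>)) \<omega>)"
proof -
  interpret usual_conditions M F by fact
  obtain N B' L' where N: "N \<in> null_sets M" and space': "brownian_local_time_space M F B' L' x0"
    and B': "\<And>\<omega> t. \<omega> \<in> space M \<Longrightarrow> \<omega> \<notin> N \<Longrightarrow> 0 \<le> t \<Longrightarrow> B' t \<omega> = B t \<omega>"
    and L': "\<And>\<omega> x t. \<omega> \<in> space M \<Longrightarrow> \<omega> \<notin> N \<Longrightarrow> 0 \<le> t \<Longrightarrow> L' x t \<omega> = L x t \<omega>"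
    using regular_version[OF assms(8,9,10)] by blast
  have T_M: "T \<in> borel_measurable M" by (rule F_measurable_M[OF assms(12)])
  \<comment> \<open>A version of \<open>T\<close> that is nonnegative everywhere; the two agree
    almost surely.\<close>
  define T' where "T' \<omega> = max 0 (T \<omega>)" for \<omega>
  have "prob {\<omega>\<in>space M. 0 < T \<omega>} = 1"
    using exponential_distributedD_gt[OF assms(13), of 0] by simp
  then have "AE \<omega> in M. \<omega> \<in> {\<omega>\<in>space M. 0 < T \<omega>}" by (rule AE_prob_1)
  then have T_pos: "AE \<omega> in M. 0 < T \<omega>" by eventually_elim simp
  interpret E: embedding M F B' L' x0 \<mu> T'
  proof (intro embedding.intro embedding_axioms.intro space')
    show "target_law \<mu> x0"
      using assms(1-5) by unfold_locales (auto simp: centred_law_def)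
    show "T' \<in> borel_measurable (F 0)" unfolding T'_def using assms(12) by measurable
    show "0 \<le> T' \<omega>" for \<omega> by (simp add: T'_def)
    show "distributed M lborel T' (exponential_density 1)"
    proof (rule distributed_AE_cong[OF assms(13)])
      show "AE \<omega> in M. T' \<omega> = T \<omega>" using T_pos by eventually_elim (simp add: T'_def)
      show "T' \<in> measurable M lborel" unfolding T'_def using T_M by measurable
    qed
  qed
  have ae: "AE \<omega> in M. E.good \<omega> \<and> \<omega> \<notin> N \<and> 0 < T \<omega>"
    using E.AE_good AE_not_in[OF N] T_pos by eventually_elim simp
  have change: "time_change m L t \<omega> = E.change t \<omega>" if "E.good \<omega>" "\<omega> \<notin> N" for t \<omega>
  proof -
    have \<omega>: "\<omega> \<in> space M" "E.confined \<omega>" using that(1) by (auto simp: E.good_def)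
    have "additive_functional m L s \<omega> = E.clock s \<omega>" if "0 \<le> s" for s
    proof -
      have "additive_functional m L s \<omega> = additive_functional m L' s \<omega>"
        unfolding additive_functional_def using L'[OF \<omega>(1) \<open>\<omega> \<notin> N\<close> \<open>0 \<le> s\<close>] by simp
      also have "\<dots> = E.clock s \<omega>" by (rule E.additive_functional_eq_clock[OF assms(6) \<omega> that])
      finally show ?thesis .
    qed
    then show ?thesis unfolding time_change_def E.change_def by (intro arg_cong[where f=Inf]) auto
  qed
  \<comment> \<open>Up to time \<open>T\<close> the time change is at most \<open>stop\<close>,
    hence finite, and \<open>absorbed_path\<close> removes the absorption at the exit time from the
    definition of the diffusion.\<close>
  have X: "X u \<omega> = B' (enn2real (E.change u \<omega>)) \<omega>"
    if good: "E.good \<omega>" "\<omega> \<notin> N" and u: "0 \<le> u" "u \<le> T' \<omega>" for u \<omega>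
  proof -
    have \<omega>: "\<omega> \<in> space M" using good(1) by (auto simp: E.good_def)
    have proc: "time_changed_process m B L t \<omega> = B' (enn2real (E.change t \<omega>)) \<omega>" for t
      unfolding time_changed_process_def change[OF good] by (rule B'[OF \<omega> good(2), symmetric]) simp
    have interior: "ereal y \<notin> {ell_minus m x0<..<ell_plus m x0} \<longleftrightarrow> y \<notin> support_interior \<mu>" for y
      by (simp add: E.ell_bounds[OF assms(6)] support_interior_def)
    show ?thesis
      unfolding assms(11) generalised_diffusion_def exit_time_def proc interior
      by (rule E.absorbed_path[OF good(1) u])
  qed
  have X_T: "AE \<omega> in M. X (T \<omega>) \<omega> = B' (E.stop \<omega>) \<omega>"
    using ae
  proof eventually_elim
    case (elim \<omega>)
    then have "T \<omega> = T' \<omega>" by (simp add: T'_def)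
    then show ?case using X[of \<omega> "T' \<omega>"] E.change_at_T[of \<omega>] elim by (simp add: E.good_def T'_def)
  qed
  have Y: "AE \<omega> in M. X (min t (T \<omega>)) \<omega> = E.upto_stop (E.change t) \<omega>" if t: "0 \<le> t" for t
    using ae
  proof eventually_elim
    case (elim \<omega>)
    then have T: "T \<omega> = T' \<omega>" by (simp add: T'_def)
    have "X (min t (T \<omega>)) \<omega> = B' (enn2real (E.change (min t (T' \<omega>)) \<omega>)) \<omega>"
      unfolding T using elim t by (intro X) (auto simp: T'_def)
    then show ?case using elim by (simp add: E.change_min E.change_at_T E.upto_stop_def)
  qed
  have B'_stop: "(\<lambda>\<omega>. B' (E.stop \<omega>) \<omega>) \<in> borel_measurable M" by measurable
  \<comment> \<open>Off the exceptional null set \<open>X\<close> at time \<open>T\<close> is the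
    measurable variable \<open>B' stop\<close>; completeness of the space takes care of the null
    set.\<close>
  have X_T_meas: "(\<lambda>\<omega>. X (T \<omega>) \<omega>) \<in> borel_measurable M"
    by (rule measurable_AE_eq[OF _ _ B'_stop X_T]) (auto simp: subalgebra_def)
  moreover have "distr M borel (\<lambda>\<omega>. X (T \<omega>) \<omega>) = \<mu>"
    using distr_cong_AE[OF refl refl X_T X_T_meas B'_stop] E.law_stop by simp
  \<comment> \<open>The filtration of the claim is built from the given local time. Its time change
    agrees almost surely with the stopping time \<open>change\<close>, which is enough for equality
    of the \<sigma>-algebras.\<close>
  moreover have "space (time_changed_filtration M F m L t) = space M"
    "sets (time_changed_filtration M F m L t) = sets (pre_sigma (E.change t))" for t
  proof -
    have "AE \<omega> in M. time_change m L t \<omega> = E.change t \<omega>"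
      using ae by eventually_elim (simp add: change)
    then show "sets (time_changed_filtration M F m L t) = sets (pre_sigma (E.change t))"
      unfolding time_changed_filtration_def by (rule stopping_time_AE_eq(2)[OF E.change_stopping_time])
    show "space (time_changed_filtration M F m L t) = space M"
      unfolding time_changed_filtration_def by (rule space_pre_sigma)
  qed
  note G = this
  ultimately show ?thesis
    using E.stopped_diffusion_martingale[OF G(1) G(2) Y] by blast
qed

end
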